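(* Let $k$ be a field and let $H=(H,\Delta,\varepsilon,\Phi,\alpha,\beta,S)$ be a finite-dimensional quasi-Hopf algebra over $k$. Let $\{e_i\}_{i\in I}$ be a basis of $H$ and $\{e^i\}_{i\in I}$ its dual basis of $H^*$. Let $\mathcal{H}_1(H^* )$ be the first Heisenberg double of $H^*$, and let $U=U^1\otimes U^2\in H\otimes H$ be the element $U=g^1S(q^2)\otimes g^2S(q^1)$ (all defined in the context). Put $$W=\sum_{i\in I}(\varepsilon\# e_i)\otimes(e^i\# 1_H),\qquad \tilde W=\sum_{i\in I}(\varepsilon\# S(e_iU^1))\otimes(e^i\# U^2)\quad\text{in }\mathcal{H}_1(H^* )^{\otimes 2},$$ and $$\boldsymbol{\Phi}^{-1}=(\varepsilon\# x^1)\otimes(\varepsilon\# x^2)\otimes(\varepsilon\# x^3),\qquad \boldsymbol{\Phi}^{321}_S=(\varepsilon\# S(X^3))\otimes(\varepsilon\# S(X^2))\otimes(\varepsilon\# S(X^1))\quad\text{in }\mathcal{H}_1(H^* )^{\otimes 3},$$ where $\Phi=X^1\otimes X^2\otimes X^3$ and $\Phi^{-1}=x^1\otimes x^2\otimes x^3$. Then, in $\mathcal{H}_1(H^* )^{\otimes 3}$, $$W_{12}W_{13}W_{23}=W_{23}W_{12}\boldsymbol{\Phi}^{-1},\qquad \tilde W_{23}\tilde W_{13}\tilde W_{12}=\boldsymbol{\Phi}^{321}_S\tilde W_{12}\tilde W_{23}.$$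
   Context: All algebras, spaces and maps are $k$-linear, $\otimes=\otimes_k$. Quasi-bialgebra: a unital associative algebra $H$ with an invertible $\Phi\in H^{\otimes3}$ and algebra maps $\Delta:H\to H\otimes H$, $\varepsilon:H\to k$ such that for all $h\in H$: $(\mathrm{Id}\otimes\Delta)(\Delta(h))=\Phi(\Delta\otimes\mathrm{Id})(\Delta(h))\Phi^{-1}$; $(\mathrm{Id}\otimes\varepsilon)(\Delta(h))=h=(\varepsilon\otimes\mathrm{Id})(\Delta(h))$; $(1\otimes\Phi)(\mathrm{Id}\otimes\Delta\otimes\mathrm{Id})(\Phi)(\Phi\otimes1)=(\mathrm{Id}\otimes\mathrm{Id}\otimes\Delta)(\Phi)(\Delta\otimes\mathrm{Id}\otimes\mathrm{Id})(\Phi)$; $(\mathrm{Id}\otimes\varepsilon\otimes\mathrm{Id})(\Phi)=1\otimes1$. Quasi-Hopf algebra: a quasi-bialgebra with an anti-algebra map $S:H\to H$ and $\alpha,\beta\in H$ such that $S(h_1)\alpha h_2=\varepsilon(h)\alpha$, $h_1\beta S(h_2)=\varepsilon(h)\beta$ for all $h$, and $X^1\beta S(X^2)\alpha X^3=1_H$, $S(x^1)\alpha x^2\beta S(x^3)=1_H$. Notation (summation suppressed): $\Delta(h)=h_1\otimes h_2$, $\Phi=X^1\otimes X^2\otimes X^3$, $\Phi^{-1}=x^1\otimes x^2\otimes x^3$; $\Delta^{\mathrm{cop}}(h)=h_2\otimes h_1$; $X^1_1\otimes X^1_2=\Delta(X^1)$, etc. When $H$ is finite-dimensional, $S$ is bijective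 (known fact). Drinfel'd twist: with $\gamma=S(X^2x^1_2)\alpha X^3x^2\otimes S(X^1x^1_1)\alpha x^3$ and $\delta=X^1_1x^1\beta S(X^3)\otimes X^1_2x^2\beta S(X^2x^3)$, the invertible element $f=f^1\otimes f^2\in H\otimes H$ is $f=(S\otimes S)(\Delta^{\mathrm{cop}}(x^1))\,\gamma\,\Delta(x^2\beta S(x^3))$, with inverse $f^{-1}=g^1\otimes g^2=\Delta(S(x^1)\alpha x^2)\,\delta\,(S\otimes S)(\Delta^{\mathrm{cop}}(x^3))$. Put $q_R=q^1\otimes q^2=X^1\otimes S^{-1}(\alpha X^3)X^2$ and $U=U^1\otimes U^2=g^1S(q^2)\otimes g^2S(q^1)$. Actions of $H$ on $H^*$: $(h\rightharpoonup\xi)(a)=\xi(ah)$. Convolution: $(\xi*\nu)(a)=\xi(a_1)\nu(a_2)$. First Heisenberg double $\mathcal{H}_1(H^* )$ of $H^*$: the vector space $H^*\otimes H$, with $\xi\otimes a$ written $\xi\# a$, and the (in general nonassociative) multiplication $$(\xi\# a)(\nu\# b)=(x^1\rightharpoonup\xi)*(x^2a_1\rightharpoonup\nu)\,\#\,x^3a_2b,$$ with unit $\varepsilon\# 1_H$ (it also carries the right $H$-action $(\xi\# a)\triangleleft h=(\xi\leftharpoonup h)\# a$, $(\xi\leftharpoonup h)(a)=\xi(ha)$, making it an algebra in the monoidal category of right $H$-modules). Tensor powers of $\mathcal{H}_1(H^* )$ are multiplied componentwise. For $A=\sum a\otimes a'\in\mathcal{H}_1(H^* )^{\otimes2}$,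 $A_{ij}\in\mathcal{H}_1(H^* )^{\otimes3}$ ($i<j$) has $a$ in slot $i$, $a'$ in slot $j$ and the unit $\varepsilon\#1_H$ in the remaining slot. In all triple products in the claim the two bracketings $(AB)C$ and $A(BC)$ coincide (the product of three elements $\xi\#a,\nu\#b,\zeta\#c$ of $\mathcal{H}_1(H^* )$ is independent of bracketing if one of $\xi,\nu,\zeta$ is $\varepsilon$), so brackets are omitted. *)

theory Defs
  imports Complex_Main "HOL-Library.Function_Algebras"
begin

section \<open>Tensor products over a field\<close>

text \<open>
  A linear subspace \<open>car\<close> of an ambient type together with its scalar multiplication, a (not
  necessarily associative) product and a unit. Addition is that of the ambient type; on
  function types it is pointwise.
\<close>

record ('k, 'v) kalg =
  car :: "'v set"
  scl :: "'k \<Rightarrow> 'v \<Rightarrow> 'v"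
  mul :: "'v \<Rightarrow> 'v \<Rightarrow> 'v"
  unt :: "'v"

definition bilinear_on ::
  "('k::field, 'v::ab_group_add) kalg \<Rightarrow> ('k, 'w::ab_group_add) kalg \<Rightarrow>
   ('k \<Rightarrow> 'z::ab_group_add \<Rightarrow> 'z) \<Rightarrow> ('v \<Rightarrow> 'w \<Rightarrow> 'z) \<Rightarrow> bool" where
  "bilinear_on V W s B \<longleftrightarrow>
     (\<forall>x\<in>car V. \<forall>x'\<in>car V. \<forall>y\<in>car W. B (x + x') y = B x y + B x' y) \<and>
     (\<forall>c. \<forall>x\<in>car V. \<forall>y\<in>car W. B (scl V c x) y = s c (B x y)) \<and>
     (\<forall>x\<in>car V. \<forall>y\<in>car W. \<forall>y'\<in>car W. B x (y + y') = B x y + B x y') \<and>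
     (\<forall>c. \<forall>x\<in>car V. \<forall>y\<in>car W. B x (scl W c y) = s c (B x y))"

text \<open>
  The tensor product of \<open>V\<close> and \<open>W\<close> is realised inside the dual of the space of bilinear forms
  on \<open>V \<times> W\<close>: the pure tensor of \<open>x\<close> and \<open>y\<close> is evaluation at \<open>(x, y)\<close> (the value 0 on
  non-bilinear arguments only serves extensionality), and the tensor product consists of the
  finite sums of pure tensors. Over a field the canonical map from the abstract tensor product
  into this dual is injective, so this is a model of it; the universal property is proved below
  as \<open>tlift_tens\<close>, \<open>tlift_add\<close> and \<open>tlift_scale\<close>.
\<close>

type_synonym ('k, 'v, 'w) tens = "('v \<Rightarrow> 'w \<Rightarrow> 'k) \<Rightarrow> 'k"

definition tens ::
  "('k::field, 'v::ab_group_add) kalg \<Rightarrow> ('k, 'w::ab_group_add) kalg \<Rightarrow> 'v \<Rightarrow> 'w \<Rightarrow> ('k, 'v, 'w) tens"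
  where "tens V W x y = (\<lambda>F. if bilinear_on V W (*) F then F x y else 0)"

definition tsum ::
  "('k::field, 'v::ab_group_add) kalg \<Rightarrow> ('k, 'w::ab_group_add) kalg \<Rightarrow> ('v \<times> 'w) list \<Rightarrow> ('k, 'v, 'w) tens"
  where "tsum V W xs = (\<Sum>(x, y)\<leftarrow>xs. tens V W x y)"

definition fscale :: "'k::times \<Rightarrow> ('a \<Rightarrow> 'k) \<Rightarrow> 'a \<Rightarrow> 'k" where
  "fscale c f = (\<lambda>x. c * f x)"

text \<open>
  The linear map on the tensor product that a map \<open>B\<close>, bilinear on the carriers, induces:
  \<open>tlift V W B\<close> sends the sum of the pure tensors of \<open>x\<^sub>i\<close> and \<open>y\<^sub>i\<close> to the sum of the
  \<open>B x\<^sub>i y\<^sub>i\<close>. In Sweedler-like notation, \<open>tlift V W (\<lambda>x y. B x y) t\<close> is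
  \<open>B(t\<^sup>1, t\<^sup>2)\<close>, summation suppressed.
\<close>

definition tlift ::
  "('k::field, 'v::ab_group_add) kalg \<Rightarrow> ('k, 'w::ab_group_add) kalg \<Rightarrow>
   ('v \<Rightarrow> 'w \<Rightarrow> 'z::ab_group_add) \<Rightarrow> ('k, 'v, 'w) tens \<Rightarrow> 'z" where
  "tlift V W B t =
     (\<Sum>(x, y)\<leftarrow>(SOME xs. set xs \<subseteq> car V \<times> car W \<and> tsum V W xs = t). B x y)"

definition tensor_alg ::
  "('k::field, 'v::ab_group_add) kalg \<Rightarrow> ('k, 'w::ab_group_add) kalg \<Rightarrow> ('k, ('k, 'v, 'w) tens) kalg"
  where
  "tensor_alg V W =
     \<lparr>car = {tsum V W xs | xs. set xs \<subseteq> car V \<times> car W},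
      scl = fscale,
      mul = (\<lambda>t u. tlift V W (\<lambda>x y. tlift V W (\<lambda>x' y'. tens V W (mul V x x') (mul W y y')) u) t),
      unt = tens V W (unt V) (unt W)\<rparr>"

definition alg_inverts :: "('k, 'v) kalg \<Rightarrow> 'v \<Rightarrow> 'v \<Rightarrow> bool" where
  "alg_inverts A x y \<longleftrightarrow> y \<in> car A \<and> mul A x y = unt A \<and> mul A y x = unt A"

definition alg_inv :: "('k, 'v) kalg \<Rightarrow> 'v \<Rightarrow> 'v" where
  "alg_inv A x = (THE y. alg_inverts A x y)"

lemma vector_space_fscale: "vector_space (fscale :: 'k::field \<Rightarrow> ('a \<Rightarrow> 'k) \<Rightarrow> _)"
  by unfold_locales (auto simp: fscale_def fun_eq_iff algebra_simps)

lemma tsum_apply: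
  assumes "bilinear_on V W (*) F"
  shows "tsum V W xs F = (\<Sum>(x, y)\<leftarrow>xs. F x y)"
  by (induction xs) (auto simp: tsum_def tens_def assms split: prod.splits)

lemma bilinear_sum_cong:
  fixes s :: "'k::field \<Rightarrow> 'z::ab_group_add \<Rightarrow> 'z"
  assumes s: "vector_space s" and B: "bilinear_on V W s B"
    and "tsum V W xs = tsum V W ys"
  shows "(\<Sum>(x, y)\<leftarrow>xs. B x y) = (\<Sum>(x, y)\<leftarrow>ys. B x y)"
proof (rule ccontr)
  interpret Z: vector_space s by fact
  interpret vector_space_pair s "(*) :: 'k \<Rightarrow> 'k \<Rightarrow> 'k"
    by unfold_locales (auto simp: algebra_simps)
  define z where "z = (\<Sum>(x, y)\<leftarrow>xs. B x y) - (\<Sum>(x, y)\<leftarrow>ys. B x y)"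
  assume "(\<Sum>(x, y)\<leftarrow>xs. B x y) \<noteq> (\<Sum>(x, y)\<leftarrow>ys. B x y)"
  hence "z \<noteq> 0" by (simp add: z_def)
  hence "Z.independent {z}" by (simp add: Z.dependent_single)
  then obtain g where g: "Vector_Spaces.linear s (*) g" "g z = (1::'k)"
    using linear_independent_extend[of "{z}" "\<lambda>_. 1"] by auto
  interpret g: Vector_Spaces.linear s "(*)" g by fact
  have gB: "bilinear_on V W (*) (\<lambda>x y. g (B x y))"
    using B by (simp add: bilinear_on_def g.add g.scale)
  have gsum: "g (\<Sum>(x, y)\<leftarrow>zs. B x y) = (\<Sum>(x, y)\<leftarrow>zs. g (B x y))" for zs
    by (induction zs) (auto simp: g.add g.zero)
  have "g z = tsum V W xs (\<lambda>x y. g (B x y)) - tsum V W ys (\<lambda>x y. g (B x y))"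
    by (simp add: z_def g.diff gsum tsum_apply[OF gB])
  thus False using g assms(3) by simp
qed

lemma tlift_tsum:
  assumes "vector_space s" and "bilinear_on V W s B" and xs: "set xs \<subseteq> car V \<times> car W"
  shows "tlift V W B (tsum V W xs) = (\<Sum>(x, y)\<leftarrow>xs. B x y)"
proof -
  let ?P = "\<lambda>ys. set ys \<subseteq> car V \<times> car W \<and> tsum V W ys = tsum V W xs"
  have "?P (SOME ys. ?P ys)" by (rule someI[of ?P xs]) (use xs in simp)
  thus ?thesis unfolding tlift_def by (intro bilinear_sum_cong[OF assms(1,2)]) blast
qed

lemma tlift_tens:
  assumes "vector_space s" "bilinear_on V W s B" "x \<in> car V" "y \<in> car W"
  shows "tlift V W B (tens V W x y) = B x y"
  using tlift_tsum[OF assms(1,2), of "[(x, y)]"] assms(3,4) by (simp add: tsum_def)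

lemma tlift_add:
  assumes "vector_space s" "bilinear_on V W s B"
    and "t \<in> car (tensor_alg V W)" "u \<in> car (tensor_alg V W)"
  shows "tlift V W B (t + u) = tlift V W B t + tlift V W B u"
proof -
  obtain xs ys where "t = tsum V W xs" "u = tsum V W ys"
    "set xs \<subseteq> car V \<times> car W" "set ys \<subseteq> car V \<times> car W"
    using assms(3,4) by (auto simp: tensor_alg_def)
  moreover from this have "t + u = tsum V W (xs @ ys)" by (simp add: tsum_def)
  ultimately show ?thesis using tlift_tsum[OF assms(1,2)] by simp
qed

lemma tlift_scale:
  assumes s: "vector_space s" and B: "bilinear_on V W s B"
    and V: "\<And>c x. x \<in> car V \<Longrightarrow> scl V c x \<in> car V" and t: "t \<in> car (tensor_alg V W)"
  shows "tlift V W B (fscale c t) = s c (tlift V W B t)"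
proof -
  interpret vector_space s by fact
  obtain xs where xs: "t = tsum V W xs" "set xs \<subseteq> car V \<times> car W"
    using t by (auto simp: tensor_alg_def)
  define ys where "ys = map (\<lambda>(x, y). (scl V c x, y)) xs"
  have ys: "set ys \<subseteq> car V \<times> car W" using xs V by (auto simp: ys_def)
  have "tsum V W ys = fscale c t"
    using xs(2) unfolding xs(1) ys_def
    by (induction xs)
      (auto simp: tsum_def fscale_def tens_def fun_eq_iff bilinear_on_def algebra_simps)
  moreover have "(\<Sum>(x, y)\<leftarrow>ys. B x y) = s c (\<Sum>(x, y)\<leftarrow>xs. B x y)"
    using xs(2) B unfolding ys_def
    by (induction xs) (auto simp: bilinear_on_def scale_right_distrib)
  ultimately show ?thesis
    using tlift_tsum[OF s B ys] tlift_tsum[OF s B xs(2)] xs(1) by simp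
qed

section \<open>Quasi-bialgebras and quasi-Hopf algebras\<close>

text \<open>
  The underlying unital associative algebra is the whole type \<open>'h::ring_1\<close> with the scalar
  multiplication \<open>hscale\<close>. (The class \<open>ring_1\<close> requires 0 and 1 to differ, which is automatic
  in the presence of a counit.) Threefold and fourfold tensor powers are nested to the right.
\<close>

type_synonym ('k, 'h) t2 = "('k, 'h, 'h) tens"
type_synonym ('k, 'h) t3 = "('k, 'h, ('k, 'h) t2) tens"

record ('k, 'h) qbialg =
  hscale :: "'k \<Rightarrow> 'h \<Rightarrow> 'h"
  Delta :: "'h \<Rightarrow> ('k, 'h) t2"
  eps :: "'h \<Rightarrow> 'k"
  Phi :: "('k, 'h) t3"

record ('k, 'h) qhopf = "('k, 'h) qbialg" +
  alpha :: "'h"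
  beta :: "'h"
  antipode :: "'h \<Rightarrow> 'h"

definition Halg :: "('k::field, 'h::ring_1, 'z) qbialg_scheme \<Rightarrow> ('k, 'h) kalg" where
  "Halg Q = \<lparr>car = UNIV, scl = hscale Q, mul = (*), unt = 1\<rparr>"

definition H2 :: "('k::field, 'h::ring_1, 'z) qbialg_scheme \<Rightarrow> ('k, ('k, 'h) t2) kalg" where
  "H2 Q = tensor_alg (Halg Q) (Halg Q)"

definition H3 :: "('k::field, 'h::ring_1, 'z) qbialg_scheme \<Rightarrow> ('k, ('k, 'h) t3) kalg" where
  "H3 Q = tensor_alg (Halg Q) (H2 Q)"

definition H4 :: "('k::field, 'h::ring_1, 'z) qbialg_scheme \<Rightarrow> ('k, ('k, 'h, ('k, 'h) t3) tens) kalg" where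
  "H4 Q = tensor_alg (Halg Q) (H3 Q)"

definition tens2 :: "('k::field, 'h::ring_1, 'z) qbialg_scheme \<Rightarrow> 'h \<Rightarrow> 'h \<Rightarrow> ('k, 'h) t2" where
  "tens2 Q x y = tens (Halg Q) (Halg Q) x y"

definition tens3 :: "('k::field, 'h::ring_1, 'z) qbialg_scheme \<Rightarrow> 'h \<Rightarrow> 'h \<Rightarrow> 'h \<Rightarrow> ('k, 'h) t3" where
  "tens3 Q x y z = tens (Halg Q) (H2 Q) x (tens2 Q y z)"

definition tens4 ::
  "('k::field, 'h::ring_1, 'z) qbialg_scheme \<Rightarrow> 'h \<Rightarrow> 'h \<Rightarrow> 'h \<Rightarrow> 'h \<Rightarrow> ('k, 'h, ('k, 'h) t3) tens" where
  "tens4 Q w x y z = tens (Halg Q) (H3 Q) w (tens3 Q x y z)"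

definition lift2 ::
  "('k::field, 'h::ring_1, 'z) qbialg_scheme \<Rightarrow> ('h \<Rightarrow> 'h \<Rightarrow> 'c::ab_group_add) \<Rightarrow> ('k, 'h) t2 \<Rightarrow> 'c" where
  "lift2 Q B t = tlift (Halg Q) (Halg Q) B t"

definition lift3 ::
  "('k::field, 'h::ring_1, 'z) qbialg_scheme \<Rightarrow> ('h \<Rightarrow> 'h \<Rightarrow> 'h \<Rightarrow> 'c::ab_group_add) \<Rightarrow> ('k, 'h) t3 \<Rightarrow> 'c"
  where "lift3 Q B t = tlift (Halg Q) (H2 Q) (\<lambda>x u. lift2 Q (B x) u) t"

definition Phi_inv :: "('k::field, 'h::ring_1, 'z) qbialg_scheme \<Rightarrow> ('k, 'h) t3" where
  "Phi_inv Q = alg_inv (H3 Q) (Phi Q)"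

definition quasi_bialgebra :: "('k::field, 'h::ring_1, 'z) qbialg_scheme \<Rightarrow> bool" where
  "quasi_bialgebra Q \<longleftrightarrow>
     vector_space (hscale Q) \<and>
     (\<forall>c a b. hscale Q c (a * b) = hscale Q c a * b \<and> hscale Q c (a * b) = a * hscale Q c b) \<and>
     (Phi Q \<in> car (H3 Q) \<and> (\<exists>y. alg_inverts (H3 Q) (Phi Q) y)) \<and>
     (\<forall>h. Delta Q h \<in> car (H2 Q)) \<and>
     Vector_Spaces.linear (hscale Q) fscale (Delta Q) \<and>
     (\<forall>a b. Delta Q (a * b) = mul (H2 Q) (Delta Q a) (Delta Q b)) \<and>
     Delta Q 1 = unt (H2 Q) \<and>
     Vector_Spaces.linear (hscale Q) (*) (eps Q) \<and>
     (\<forall>a b. eps Q (a * b) = eps Q a * eps Q b) \<and>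
     eps Q 1 = 1 \<and>
     (\<forall>h. lift2 Q (\<lambda>h1 h2. lift2 Q (\<lambda>h21 h22. tens3 Q h1 h21 h22) (Delta Q h2)) (Delta Q h) =
          mul (H3 Q)
            (mul (H3 Q) (Phi Q)
               (lift2 Q (\<lambda>h1 h2. lift2 Q (\<lambda>h11 h12. tens3 Q h11 h12 h2) (Delta Q h1)) (Delta Q h)))
            (Phi_inv Q)) \<and>
     (\<forall>h. lift2 Q (\<lambda>h1 h2. hscale Q (eps Q h2) h1) (Delta Q h) = h) \<and>
     (\<forall>h. lift2 Q (\<lambda>h1 h2. hscale Q (eps Q h1) h2) (Delta Q h) = h) \<and>
     mul (H4 Q)
       (mul (H4 Q)
          (tens (Halg Q) (H3 Q) 1 (Phi Q))
          (lift3 Q (\<lambda>x y z. lift2 Q (\<lambda>y1 y2. tens4 Q x y1 y2 z) (Delta Q y)) (Phi Q)))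
       (lift3 Q (\<lambda>x y z. tens4 Q x y z 1) (Phi Q)) =
     mul (H4 Q)
       (lift3 Q (\<lambda>x y z. lift2 Q (\<lambda>z1 z2. tens4 Q x y z1 z2) (Delta Q z)) (Phi Q))
       (lift3 Q (\<lambda>x y z. lift2 Q (\<lambda>x1 x2. tens4 Q x1 x2 y z) (Delta Q x)) (Phi Q)) \<and>
     lift3 Q (\<lambda>x y z. tens2 Q x (hscale Q (eps Q y) z)) (Phi Q) = tens2 Q 1 1"

definition quasi_hopf_algebra :: "('k::field, 'h::ring_1, 'z) qhopf_scheme \<Rightarrow> bool" where
  "quasi_hopf_algebra Q \<longleftrightarrow>
     quasi_bialgebra Q \<and>
     Vector_Spaces.linear (hscale Q) (hscale Q) (antipode Q) \<and>
     (\<forall>a b. antipode Q (a * b) = antipode Q b * antipode Q a) \<and>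
     antipode Q 1 = 1 \<and>
     (\<forall>h. lift2 Q (\<lambda>h1 h2. antipode Q h1 * alpha Q * h2) (Delta Q h) = hscale Q (eps Q h) (alpha Q)) \<and>
     (\<forall>h. lift2 Q (\<lambda>h1 h2. h1 * beta Q * antipode Q h2) (Delta Q h) = hscale Q (eps Q h) (beta Q)) \<and>
     lift3 Q (\<lambda>X1 X2 X3. X1 * beta Q * antipode Q X2 * alpha Q * X3) (Phi Q) = 1 \<and>
     lift3 Q (\<lambda>x1 x2 x3. antipode Q x1 * alpha Q * x2 * beta Q * antipode Q x3) (Phi_inv Q) = 1"


section \<open>The elements \<open>f\<^sup>-\<^sup>1\<close>, \<open>q\<^sub>R\<close> and \<open>U\<close>\<close>

definition twist_delta :: "('k::field, 'h::ring_1, 'z) qhopf_scheme \<Rightarrow> ('k, 'h) t2" where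
  "twist_delta Q =
     lift3 Q (\<lambda>X1 X2 X3.
       lift2 Q (\<lambda>X11 X12.
         lift3 Q (\<lambda>x1 x2 x3.
           tens2 Q (X11 * x1 * beta Q * antipode Q X3)
                   (X12 * x2 * beta Q * antipode Q (X2 * x3)))
         (Phi_inv Q))
       (Delta Q X1))
     (Phi Q)"

text \<open>The inverse \<open>g\<^sup>1 \<otimes> g\<^sup>2\<close> of the Drinfel'd twist, given by its explicit formula
  \<open>\<Delta>(S(x\<^sup>1)\<alpha>x\<^sup>2) \<delta> (S \<otimes> S)(\<Delta>\<^sup>c\<^sup>o\<^sup>p(x\<^sup>3))\<close>.\<close>

definition twist_inv :: "('k::field, 'h::ring_1, 'z) qhopf_scheme \<Rightarrow> ('k, 'h) t2" where
  "twist_inv Q =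
     lift3 Q (\<lambda>x1 x2 x3.
       mul (H2 Q)
         (mul (H2 Q) (Delta Q (antipode Q x1 * alpha Q * x2)) (twist_delta Q))
         (lift2 Q (\<lambda>x31 x32. tens2 Q (antipode Q x32) (antipode Q x31)) (Delta Q x3)))
     (Phi_inv Q)"

definition q_R :: "('k::field, 'h::ring_1, 'z) qhopf_scheme \<Rightarrow> ('k, 'h) t2" where
  "q_R Q = lift3 Q (\<lambda>X1 X2 X3. tens2 Q X1 (inv (antipode Q) (alpha Q * X3) * X2)) (Phi Q)"

definition U_elem :: "('k::field, 'h::ring_1, 'z) qhopf_scheme \<Rightarrow> ('k, 'h) t2" where
  "U_elem Q =
     lift2 Q (\<lambda>g1 g2.
       lift2 Q (\<lambda>q1 q2. tens2 Q (g1 * antipode Q q2) (g2 * antipode Q q1)) (q_R Q))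
     (twist_inv Q)"


section \<open>The first Heisenberg double of the dual\<close>

definition conv ::
  "('k::field, 'h::ring_1, 'z) qbialg_scheme \<Rightarrow> ('h \<Rightarrow> 'k) \<Rightarrow> ('h \<Rightarrow> 'k) \<Rightarrow> 'h \<Rightarrow> 'k" where
  "conv Q \<xi> \<nu> = (\<lambda>a. lift2 Q (\<lambda>a1 a2. \<xi> a1 * \<nu> a2) (Delta Q a))"

definition hit :: "'h::times \<Rightarrow> ('h \<Rightarrow> 'k) \<Rightarrow> 'h \<Rightarrow> 'k" where
  "hit h \<xi> = (\<lambda>a. \<xi> (a * h))"

definition dual_alg :: "('k::field, 'h::ring_1, 'z) qbialg_scheme \<Rightarrow> ('k, 'h \<Rightarrow> 'k) kalg" where
  "dual_alg Q =
     \<lparr>car = {\<xi>. Vector_Spaces.linear (hscale Q) (*) \<xi>}, scl = fscale, mul = conv Q, unt = eps Q\<rparr>"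

type_synonym ('k, 'h) h1 = "('k, 'h \<Rightarrow> 'k, 'h) tens"

text \<open>\<open>hash Q \<xi> a\<close> is \<open>\<xi> # a\<close>.\<close>

definition hash :: "('k::field, 'h::ring_1, 'z) qbialg_scheme \<Rightarrow> ('h \<Rightarrow> 'k) \<Rightarrow> 'h \<Rightarrow> ('k, 'h) h1" where
  "hash Q \<xi> a = tens (dual_alg Q) (Halg Q) \<xi> a"

definition heis_mul ::
  "('k::field, 'h::ring_1, 'z) qbialg_scheme \<Rightarrow> ('k, 'h) h1 \<Rightarrow> ('k, 'h) h1 \<Rightarrow> ('k, 'h) h1" where
  "heis_mul Q p r =
     tlift (dual_alg Q) (Halg Q) (\<lambda>\<xi> a.
       tlift (dual_alg Q) (Halg Q) (\<lambda>\<nu> b.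
         lift3 Q (\<lambda>x1 x2 x3.
           lift2 Q (\<lambda>a1 a2.
             hash Q (conv Q (hit x1 \<xi>) (hit (x2 * a1) \<nu>)) (x3 * a2 * b))
           (Delta Q a))
         (Phi_inv Q))
       r)
     p"

definition heis :: "('k::field, 'h::ring_1, 'z) qbialg_scheme \<Rightarrow> ('k, ('k, 'h) h1) kalg" where
  "heis Q =
     \<lparr>car = car (tensor_alg (dual_alg Q) (Halg Q)), scl = fscale, mul = heis_mul Q,
      unt = hash Q (eps Q) 1\<rparr>"

type_synonym ('k, 'h) h1_2 = "('k, ('k, 'h) h1, ('k, 'h) h1) tens"
type_synonym ('k, 'h) h1_3 = "('k, ('k, 'h) h1, ('k, 'h) h1_2) tens"

definition heis2 :: "('k::field, 'h::ring_1, 'z) qbialg_scheme \<Rightarrow> ('k, ('k, 'h) h1_2) kalg" where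
  "heis2 Q = tensor_alg (heis Q) (heis Q)"

definition heis3 :: "('k::field, 'h::ring_1, 'z) qbialg_scheme \<Rightarrow> ('k, ('k, 'h) h1_3) kalg" where
  "heis3 Q = tensor_alg (heis Q) (heis2 Q)"

definition htens2 ::
  "('k::field, 'h::ring_1, 'z) qbialg_scheme \<Rightarrow> ('k, 'h) h1 \<Rightarrow> ('k, 'h) h1 \<Rightarrow> ('k, 'h) h1_2" where
  "htens2 Q p r = tens (heis Q) (heis Q) p r"

definition htens3 ::
  "('k::field, 'h::ring_1, 'z) qbialg_scheme \<Rightarrow> ('k, 'h) h1 \<Rightarrow> ('k, 'h) h1 \<Rightarrow> ('k, 'h) h1 \<Rightarrow> ('k, 'h) h1_3"
  where "htens3 Q p r s = tens (heis Q) (heis2 Q) p (htens2 Q r s)"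

definition slot12 ::
  "('k::field, 'h::ring_1, 'z) qbialg_scheme \<Rightarrow> ('k, 'h) h1_2 \<Rightarrow> ('k, 'h) h1_3" where
  "slot12 Q A = tlift (heis Q) (heis Q) (\<lambda>a a'. htens3 Q a a' (unt (heis Q))) A"

definition slot13 ::
  "('k::field, 'h::ring_1, 'z) qbialg_scheme \<Rightarrow> ('k, 'h) h1_2 \<Rightarrow> ('k, 'h) h1_3" where
  "slot13 Q A = tlift (heis Q) (heis Q) (\<lambda>a a'. htens3 Q a (unt (heis Q)) a') A"

definition slot23 ::
  "('k::field, 'h::ring_1, 'z) qbialg_scheme \<Rightarrow> ('k, 'h) h1_2 \<Rightarrow> ('k, 'h) h1_3" where
  "slot23 Q A = tlift (heis Q) (heis Q) (\<lambda>a a'. htens3 Q (unt (heis Q)) a a') A"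


section \<open>Bases and the elements of the pentagon equations\<close>

definition is_basis :: "('k::field \<Rightarrow> 'h::ab_group_add \<Rightarrow> 'h) \<Rightarrow> 'i set \<Rightarrow> ('i \<Rightarrow> 'h) \<Rightarrow> bool" where
  "is_basis s I e \<longleftrightarrow>
     inj_on e I \<and> \<not> module.dependent s (e ` I) \<and> module.span s (e ` I) = UNIV"

definition is_dual_basis ::
  "('k::field \<Rightarrow> 'h::ab_group_add \<Rightarrow> 'h) \<Rightarrow> 'i set \<Rightarrow> ('i \<Rightarrow> 'h) \<Rightarrow> ('i \<Rightarrow> 'h \<Rightarrow> 'k) \<Rightarrow> bool" where
  "is_dual_basis s I e e' \<longleftrightarrow>
     (\<forall>i\<in>I. Vector_Spaces.linear s (*) (e' i) \<and> (\<forall>j\<in>I. e' i (e j) = (if i = j then 1 else 0)))"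

definition W_elem ::
  "('k::field, 'h::ring_1, 'z) qhopf_scheme \<Rightarrow> 'i set \<Rightarrow> ('i \<Rightarrow> 'h) \<Rightarrow> ('i \<Rightarrow> 'h \<Rightarrow> 'k) \<Rightarrow> ('k, 'h) h1_2" where
  "W_elem Q I e e' = (\<Sum>i\<in>I. htens2 Q (hash Q (eps Q) (e i)) (hash Q (e' i) 1))"

definition W_tilde ::
  "('k::field, 'h::ring_1, 'z) qhopf_scheme \<Rightarrow> 'i set \<Rightarrow> ('i \<Rightarrow> 'h) \<Rightarrow> ('i \<Rightarrow> 'h \<Rightarrow> 'k) \<Rightarrow> ('k, 'h) h1_2" where
  "W_tilde Q I e e' =
     (\<Sum>i\<in>I. lift2 Q (\<lambda>U1 U2.
        htens2 Q (hash Q (eps Q) (antipode Q (e i * U1))) (hash Q (e' i) U2)) (U_elem Q))"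

definition heis_Phi_inv :: "('k::field, 'h::ring_1, 'z) qhopf_scheme \<Rightarrow> ('k, 'h) h1_3" where
  "heis_Phi_inv Q =
     lift3 Q (\<lambda>x1 x2 x3. htens3 Q (hash Q (eps Q) x1) (hash Q (eps Q) x2) (hash Q (eps Q) x3))
     (Phi_inv Q)"

definition heis_Phi_S321 :: "('k::field, 'h::ring_1, 'z) qhopf_scheme \<Rightarrow> ('k, 'h) h1_3" where
  "heis_Phi_S321 Q =
     lift3 Q (\<lambda>X1 X2 X3.
       htens3 Q (hash Q (eps Q) (antipode Q X3)) (hash Q (eps Q) (antipode Q X2))
                (hash Q (eps Q) (antipode Q X1)))
     (Phi Q)"

end

theory Submission
  imports Defs
begin

text \<open>
  Elements of tensor powers are tested against multilinear forms: \<open>phi C\<close>, \<open>psi C\<close> and \<open>cop h C\<close>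
  are the values of a form \<open>C\<close> on \<open>\<Phi>\<close>, \<open>\<Phi>\<^sup>-\<^sup>1\<close> and \<open>\<Delta>(h)\<close>. The equation for \<open>W\<close> then only uses that
  \<open>\<Sum> e\<^sub>i \<otimes> e\<^sup>i\<close> represents the identity.

  For \<open>W\<^sup>~\<close>, the antipode is an epimorphism of algebras. By Fitting's lemma the projection onto the
  image of a high power of \<open>S\<^sup>2\<close> along its kernel is an algebra map; it agrees with the identity on
  that image, hence everywhere, so \<open>S\<close> is surjective. Hence \<open>S(q\<^sup>2) = S(X\<^sup>2) \<alpha> X\<^sup>3\<close>. The element \<open>U\<close> satisfies
  \<open>\<Delta>(S(h\<^sub>1)) U (h\<^sub>2 \<otimes> 1) = U (1 \<otimes> S(h))\<close> and \<open>U (1 \<otimes> \<alpha>) = \<Delta>(S(X\<^sup>1) \<alpha>) (X\<^sup>2 \<otimes> X\<^sup>3)\<close>, and together with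
  the pentagon these two identities yield
  \<open>(id \<otimes> \<Delta>)(U) (1 \<otimes> U) = \<Phi> (\<Delta> \<otimes> id)(\<Delta>(S(X\<^sup>1)) U) (X\<^sup>2 \<otimes> X\<^sup>3 \<otimes> 1)\<close>, which is the equation for \<open>W\<^sup>~\<close>
  written out in the basis.
\<close>

section \<open>Linear maps out of tensor products\<close>

text \<open>\<open>\<alpha>\<close> need not be invertible, so an identity known only after right
  multiplication by \<open>\<alpha>\<close> cannot simply be cancelled. The axiom
  \<open>S(x1) \<alpha> x2 \<beta> S(x3) = 1\<close> takes the place of cancellation, provided that
  both sides also commute with \<open>S(h)\<close> in the same way. This is why identities come in
  pairs, a commutation rule and a value at \<open>\<alpha>\<close>, both for \<open>U\<close> and
  for the two sides of its pentagon. The formula for \<open>U\<close> mixes many copies of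
  \<open>\<Phi>\<close>, its inverse, \<open>S\<close>, \<open>\<alpha>\<close> and
  \<open>\<beta>\<close>. The antipode axioms are therefore turned into invariance of forms under
  coproduct factors (\<open>linv\<close>, \<open>rinv\<close>); after that the computations involve
  \<open>\<Phi>\<close> and \<open>\<Delta>\<close> only, and different placements of the antipode
  become instances of one lemma. For the epimorphism property, two algebra maps
  \<open>\<pi>\<close>, \<open>\<rho>\<close> that agree on the image of \<open>S\<close> are
  compared through the element \<open>\<pi>(X1 \<beta> S(X2)) \<rho>(\<alpha> X3)\<close>: it
  intertwines them, and it equals 1, again by the axiom above.\<close>

lemma tlift_add_fun: "tlift V W (\<lambda>x y. B x y + B' x y) t = tlift V W B t + tlift V W B' t"
proof -
  have "(\<Sum>(x, y)\<leftarrow>xs. B x y + B' x y) = (\<Sum>(x, y)\<leftarrow>xs. B x y) + (\<Sum>(x, y)\<leftarrow>xs. B' x y)" for xs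
    by (induction xs) (auto simp: algebra_simps)
  then show ?thesis by (simp add: tlift_def)
qed

lemma sum_list_hom_on:
  assumes "\<And>x y. (x, y) \<in> set xs \<Longrightarrow> F x y \<in> A" "0 \<in> A" "\<And>u v. u \<in> A \<Longrightarrow> v \<in> A \<Longrightarrow> u + v \<in> A"
    and "g 0 = 0" "\<And>u v. u \<in> A \<Longrightarrow> v \<in> A \<Longrightarrow> g (u + v) = g u + g v"
  shows "(\<Sum>(x, y)\<leftarrow>xs. F x y) \<in> A \<and> g (\<Sum>(x, y)\<leftarrow>xs. F x y) = (\<Sum>(x, y)\<leftarrow>xs. g (F x y))"
  using assms(1) by (induction xs) (auto simp: assms(2-))

text \<open>For fixed \<open>t\<close>, the value \<open>tlift V W B t\<close> is a sum of
  \<open>B\<close> over one list chosen from \<open>t\<close> alone. Additive maps, sums of forms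
  and a second \<open>tlift\<close> therefore pass through without any bilinearity of
  \<open>B\<close>; the same observation proves \<open>tlift_add_fun\<close> and
  \<open>tlift_swap\<close>.\<close>

lemma tlift_hom:
  assumes "g 0 = 0" "\<And>u v. g (u + v) = g u + g v"
  shows "g (tlift V W B t) = tlift V W (\<lambda>x y. g (B x y)) t"
  unfolding tlift_def by (rule sum_list_hom_on[where A = UNIV, THEN conjunct2]) (use assms in auto)

lemma tlift_zero_fun [simp]: "tlift V W (\<lambda>x y. 0) t = 0"
  by (rule tlift_hom[of "\<lambda>_. 0", symmetric, simplified])

lemma tlift_swap:
  "tlift V W (\<lambda>x y. tlift V' W' (\<lambda>x' y'. F x y x' y') u) t =
   tlift V' W' (\<lambda>x' y'. tlift V W (\<lambda>x y. F x y x' y') t) u"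
proof -
  have "(\<Sum>(x, y)\<leftarrow>xs. tlift V' W' (\<lambda>x' y'. F x y x' y') u) =
    tlift V' W' (\<lambda>x' y'. \<Sum>(x, y)\<leftarrow>xs. F x y x' y') u" for xs
    by (induction xs) (auto simp: tlift_add_fun)
  then show ?thesis unfolding tlift_def[of V W] .
qed

text \<open>Membership in the carrier guarantees that a representing list exists; for any other
  \<open>t\<close> the chosen list would be arbitrary.\<close>

lemma tlift_list:
  assumes "t \<in> car (tensor_alg V W)"
  shows "set (SOME xs. set xs \<subseteq> car V \<times> car W \<and> tsum V W xs = t) \<subseteq> car V \<times> car W"
proof -
  let ?P = "\<lambda>xs. set xs \<subseteq> car V \<times> car W \<and> tsum V W xs = t"
  have "?P (SOME xs. ?P xs)"
    by (rule someI_ex[of ?P]) (use assms in \<open>auto simp: tensor_alg_def\<close>)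
  then show ?thesis by blast
qed

lemma tlift_cong:
  assumes "t \<in> car (tensor_alg V W)" "\<And>x y. x \<in> car V \<Longrightarrow> y \<in> car W \<Longrightarrow> B x y = B' x y"
  shows "tlift V W B t = tlift V W B' t"
  unfolding tlift_def
  by (rule arg_cong[where f = sum_list], rule map_cong)
    (use tlift_list[OF assms(1)] in \<open>auto simp: assms(2)\<close>)

text \<open>Additivity of \<open>g\<close> is required only on \<open>A\<close>, because the typical
  \<open>g\<close> is itself a map \<open>tlift V' W' B\<close>, which is additive only on the
  carrier of its tensor product.\<close>

lemma tlift_hom_on:
  assumes "t \<in> car (tensor_alg V W)" "\<And>x y. x \<in> car V \<Longrightarrow> y \<in> car W \<Longrightarrow> B x y \<in> A"
    and "0 \<in> A" "\<And>u v. u \<in> A \<Longrightarrow> v \<in> A \<Longrightarrow> u + v \<in> A"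
    and "g 0 = 0" "\<And>u v. u \<in> A \<Longrightarrow> v \<in> A \<Longrightarrow> g (u + v) = g u + g v"
  shows "tlift V W B t \<in> A" "g (tlift V W B t) = tlift V W (\<lambda>x y. g (B x y)) t"
proof -
  have "tlift V W B t \<in> A \<and> g (tlift V W B t) = tlift V W (\<lambda>x y. g (B x y)) t"
    unfolding tlift_def
    by (rule sum_list_hom_on) (use tlift_list[OF assms(1)] assms(2) in blast, (fact assms(3-6))+)
  then show "tlift V W B t \<in> A" "g (tlift V W B t) = tlift V W (\<lambda>x y. g (B x y)) t" by auto
qed

lemma car_tensor_zero [simp]: "0 \<in> car (tensor_alg V W)"
  by (auto simp: tensor_alg_def tsum_def intro: exI[of _ "[]"])

lemma car_tensor_add:
  assumes "t \<in> car (tensor_alg V W)" "u \<in> car (tensor_alg V W)"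
  shows "t + u \<in> car (tensor_alg V W)"
proof -
  obtain xs ys where "t = tsum V W xs" "u = tsum V W ys"
    "set xs \<subseteq> car V \<times> car W" "set ys \<subseteq> car V \<times> car W"
    using assms by (auto simp: tensor_alg_def)
  moreover from this have "t + u = tsum V W (xs @ ys)" by (simp add: tsum_def)
  ultimately show ?thesis unfolding tensor_alg_def
    by (auto intro!: exI[of _ "xs @ ys"])
qed

lemma car_tensor_tens: "x \<in> car V \<Longrightarrow> y \<in> car W \<Longrightarrow> tens V W x y \<in> car (tensor_alg V W)"
  by (auto simp: tensor_alg_def tsum_def intro!: exI[of _ "[(x, y)]"])

lemma car_tensor_tlift:
  assumes "t \<in> car (tensor_alg V W)"
    and "\<And>x y. x \<in> car V \<Longrightarrow> y \<in> car W \<Longrightarrow> B x y \<in> car (tensor_alg V' W')"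
  shows "tlift V W B t \<in> car (tensor_alg V' W')"
  by (rule tlift_hom_on(1)[where g = "\<lambda>x. x"]) (auto simp: assms car_tensor_add)

lemma vector_space_times: "vector_space ((*) :: 'k::field \<Rightarrow> 'k \<Rightarrow> 'k)"
  by unfold_locales (auto simp: algebra_simps)

lemma tlift_zero:
  assumes "vector_space s" "bilinear_on V W s B"
  shows "tlift V W B 0 = 0"
  using tlift_tsum[OF assms, of "[]"] by (simp add: tsum_def)

lemma tlift_tlift:
  assumes "vector_space s" "bilinear_on V' W' s B" "t \<in> car (tensor_alg V W)"
    and "\<And>x y. x \<in> car V \<Longrightarrow> y \<in> car W \<Longrightarrow> F x y \<in> car (tensor_alg V' W')"
  shows "tlift V' W' B (tlift V W F t) = tlift V W (\<lambda>x y. tlift V' W' B (F x y)) t"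
  by (rule tlift_hom_on(2)[where A = "car (tensor_alg V' W')"])
    (fact assms car_tensor_zero tlift_zero[OF assms(1,2)] | rule car_tensor_add tlift_add[OF assms(1,2)] assms(4); assumption)+

lemma bilinear_on_tens: "bilinear_on V W fscale (tens V W)"
  by (auto simp: bilinear_on_def tens_def fscale_def fun_eq_iff)

lemma tlift_tens_self:
  assumes "t \<in> car (tensor_alg V W)"
  shows "tlift V W (tens V W) t = t"
proof -
  obtain xs where xs: "set xs \<subseteq> car V \<times> car W" "t = tsum V W xs"
    using assms by (auto simp: tensor_alg_def)
  show ?thesis unfolding xs(2)
    by (subst tlift_tsum[OF vector_space_fscale bilinear_on_tens xs(1)]) (simp add: tsum_def)
qed

text \<open>The scalar is moved into the left factor of every pure tensor; a scalar multiple of a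
  function on forms is not visibly a sum of pure tensors.\<close>

lemma car_tensor_scale:
  assumes "t \<in> car (tensor_alg V W)" "\<And>c x. x \<in> car V \<Longrightarrow> scl V c x \<in> car V"
  shows "fscale c t \<in> car (tensor_alg V W)"
proof -
  have "fscale c t = tlift V W (\<lambda>x y. fscale c (tens V W x y)) t"
    using tlift_hom[of "fscale c" V W "tens V W" t] tlift_tens_self[OF assms(1)]
    by (simp add: fscale_def fun_eq_iff algebra_simps)
  also have "\<dots> = tlift V W (\<lambda>x y. tens V W (scl V c x) y) t"
    by (rule tlift_cong[OF assms(1)]) (use bilinear_on_tens[of V W] in \<open>simp add: bilinear_on_def\<close>)
  also have "\<dots> \<in> car (tensor_alg V W)"
    by (intro car_tensor_tlift assms car_tensor_tens)
  finally show ?thesis .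
qed

text \<open>A tensor is a function on forms. On a bilinear form it returns the value of the induced
  linear map, elsewhere the default 0, so bilinear forms separate tensors.\<close>

lemma tensor_apply:
  assumes "t \<in> car (tensor_alg V W)"
  shows "t F = (if bilinear_on V W (*) F then tlift V W F t else 0)"
proof -
  have "tlift V W (tens V W) t F = tlift V W (\<lambda>x y. tens V W x y F) t"
    by (rule tlift_hom[of "\<lambda>t. t F"]) auto
  then show ?thesis by (simp add: tlift_tens_self[OF assms] tens_def)
qed

lemma tensor_eqI:
  assumes "t \<in> car (tensor_alg V W)" "u \<in> car (tensor_alg V W)"
    and "\<And>F. bilinear_on V W (*) F \<Longrightarrow> t F = u F"
  shows "t = u"
  using assms by (auto simp: fun_eq_iff tensor_apply)

lemma car_tensor_mul:
  assumes "t \<in> car (tensor_alg V W)" "u \<in> car (tensor_alg V W)"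
    and "\<And>x x'. x \<in> car V \<Longrightarrow> x' \<in> car V \<Longrightarrow> mul V x x' \<in> car V"
    and "\<And>y y'. y \<in> car W \<Longrightarrow> y' \<in> car W \<Longrightarrow> mul W y y' \<in> car W"
  shows "mul (tensor_alg V W) t u \<in> car (tensor_alg V W)"
proof -
  have "tlift V W (\<lambda>x y. tlift V W (\<lambda>x' y'. tens V W (mul V x x') (mul W y y')) u) t
      \<in> car (tensor_alg V W)"
    using assms by (intro car_tensor_tlift car_tensor_tens)
  then show ?thesis by (simp add: tensor_alg_def)
qed

lemma tlift_mul:
  assumes s: "vector_space s" and B: "bilinear_on V W s B"
    and t: "t \<in> car (tensor_alg V W)" and u: "u \<in> car (tensor_alg V W)"
    and V: "\<And>x x'. x \<in> car V \<Longrightarrow> x' \<in> car V \<Longrightarrow> mul V x x' \<in> car V"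
    and W: "\<And>y y'. y \<in> car W \<Longrightarrow> y' \<in> car W \<Longrightarrow> mul W y y' \<in> car W"
  shows "tlift V W B (mul (tensor_alg V W) t u) =
    tlift V W (\<lambda>x y. tlift V W (\<lambda>x' y'. B (mul V x x') (mul W y y')) u) t"
proof -
  have "tlift V W B (mul (tensor_alg V W) t u) =
    tlift V W B (tlift V W (\<lambda>x y. tlift V W (\<lambda>x' y'. tens V W (mul V x x') (mul W y y')) u) t)"
    by (simp add: tensor_alg_def)
  also have "\<dots> = tlift V W (\<lambda>x y. tlift V W B
      (tlift V W (\<lambda>x' y'. tens V W (mul V x x') (mul W y y')) u)) t"
    by (intro tlift_tlift[OF s B t] car_tensor_tlift[OF u] car_tensor_tens V W)
  also have "\<dots> = tlift V W (\<lambda>x y. tlift V W (\<lambda>x' y'. B (mul V x x') (mul W y y')) u) t"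
  proof (rule tlift_cong[OF t])
    fix x y assume xy: "x \<in> car V" "y \<in> car W"
    have "tlift V W B (tlift V W (\<lambda>x' y'. tens V W (mul V x x') (mul W y y')) u) =
      tlift V W (\<lambda>x' y'. tlift V W B (tens V W (mul V x x') (mul W y y'))) u"
      by (intro tlift_tlift[OF s B u] car_tensor_tens V W xy)
    also have "\<dots> = tlift V W (\<lambda>x' y'. B (mul V x x') (mul W y y')) u"
      by (intro tlift_cong[OF u] tlift_tens[OF s B] V W xy)
    finally show "tlift V W B (tlift V W (\<lambda>x' y'. tens V W (mul V x x') (mul W y y')) u) =
      tlift V W (\<lambda>x' y'. B (mul V x x') (mul W y y')) u" .
  qed
  finally show ?thesis .
qed

section \<open>Multilinear forms on a quasi-bialgebra and its tensor powers\<close>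

named_theorems lin

locale quasi_bialg =
  fixes Q :: "('k::field, 'h::ring_1, 'z) qbialg_scheme"
  assumes quasi_bialgebra: "quasi_bialgebra Q"
begin

abbreviation linK :: "('h \<Rightarrow> 'k) \<Rightarrow> bool" where "linK \<equiv> Vector_Spaces.linear (hscale Q) (*)"
abbreviation linH :: "('h \<Rightarrow> 'h) \<Rightarrow> bool" where "linH \<equiv> Vector_Spaces.linear (hscale Q) (hscale Q)"

text \<open>Scalar values suffice, since tensor-valued maps are evaluated at a form first. The rules
  collected in \<open>lin\<close> derive multilinearity of a composite expression slot by slot, from
  the outside in.\<close>

definition ml2 :: "('h \<Rightarrow> 'h \<Rightarrow> 'k) \<Rightarrow> bool" where
  "ml2 B \<longleftrightarrow> (\<forall>b. linK (\<lambda>a. B a b)) \<and> (\<forall>a. linK (\<lambda>b. B a b))"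

definition ml3 :: "('h \<Rightarrow> 'h \<Rightarrow> 'h \<Rightarrow> 'k) \<Rightarrow> bool" where
  "ml3 C \<longleftrightarrow> (\<forall>b c. linK (\<lambda>a. C a b c)) \<and> (\<forall>a c. linK (\<lambda>b. C a b c)) \<and> (\<forall>a b. linK (\<lambda>c. C a b c))"

definition ml4 :: "('h \<Rightarrow> 'h \<Rightarrow> 'h \<Rightarrow> 'h \<Rightarrow> 'k) \<Rightarrow> bool" where
  "ml4 C \<longleftrightarrow> (\<forall>b c d. linK (\<lambda>a. C a b c d)) \<and> (\<forall>a c d. linK (\<lambda>b. C a b c d)) \<and>
     (\<forall>a b d. linK (\<lambda>c. C a b c d)) \<and> (\<forall>a b c. linK (\<lambda>d. C a b c d))"

definition cop :: "'h \<Rightarrow> ('h \<Rightarrow> 'h \<Rightarrow> 'v::ab_group_add) \<Rightarrow> 'v" where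
  "cop h B = lift2 Q B (Delta Q h)"

definition phi :: "('h \<Rightarrow> 'h \<Rightarrow> 'h \<Rightarrow> 'v::ab_group_add) \<Rightarrow> 'v" where
  "phi C = lift3 Q C (Phi Q)"

definition psi :: "('h \<Rightarrow> 'h \<Rightarrow> 'h \<Rightarrow> 'v::ab_group_add) \<Rightarrow> 'v" where
  "psi C = lift3 Q C (Phi_inv Q)"

lemmas qb = quasi_bialgebra[unfolded quasi_bialgebra_def]

lemma vector_space_H: "vector_space (hscale Q)"
  using qb by blast

lemma hscale_mult_left: "hscale Q c (a * b) = hscale Q c a * b"
  using qb by blast

lemma hscale_mult_right: "hscale Q c (a * b) = a * hscale Q c b"
  using qb by blast

lemma linear_Delta: "Vector_Spaces.linear (hscale Q) fscale (Delta Q)"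
  using qb by blast

lemma linK_eps: "linK (eps Q)"
  using qb by blast

lemma linK_iff: "linK f \<longleftrightarrow> (\<forall>x y. f (x + y) = f x + f y) \<and> (\<forall>c x. f (hscale Q c x) = c * f x)"
  by (simp add: Vector_Spaces.linear_iff vector_space_H vector_space_times)

lemma linH_iff: "linH f \<longleftrightarrow> (\<forall>x y. f (x + y) = f x + f y) \<and> (\<forall>c x. f (hscale Q c x) = hscale Q c (f x))"
  by (simp add: Vector_Spaces.linear_iff vector_space_H)

lemma linH_id [lin]: "linH (\<lambda>x. x)"
  by (simp add: linH_iff)

lemma linH_mult [lin]: "linH f \<Longrightarrow> linH (\<lambda>x. f x * c)" "linH f \<Longrightarrow> linH (\<lambda>x. c * f x)"
  by (auto simp: linH_iff algebra_simps hscale_mult_left[symmetric] hscale_mult_right[symmetric])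

lemma linK_comp: "linK g \<Longrightarrow> linH f \<Longrightarrow> linK (\<lambda>x. g (f x))"
  by (simp add: linK_iff linH_iff)

lemma linH_comp: "linH g \<Longrightarrow> linH f \<Longrightarrow> linH (\<lambda>x. g (f x))"
  by (simp add: linH_iff)

lemma linK_eps_comp [lin]: "linH f \<Longrightarrow> linK (\<lambda>x. eps Q (f x))"
  by (rule linK_comp[OF linK_eps])

lemma linK_mult [lin]: "linK f \<Longrightarrow> linK (\<lambda>x. f x * c)" "linK f \<Longrightarrow> linK (\<lambda>x. c * f x)"
  by (auto simp: linK_iff algebra_simps)

lemma linK_sum: "(\<And>i. i \<in> I \<Longrightarrow> linK (\<lambda>x. f i x)) \<Longrightarrow> linK (\<lambda>x. \<Sum>i\<in>I. f i x)"
  by (auto simp: linK_iff sum.distrib sum_distrib_left)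

lemma ml2I: "(\<And>b. linK (\<lambda>a. B a b)) \<Longrightarrow> (\<And>a. linK (\<lambda>b. B a b)) \<Longrightarrow> ml2 B"
  by (simp add: ml2_def)

lemma ml3I: "(\<And>b c. linK (\<lambda>a. C a b c)) \<Longrightarrow> (\<And>a c. linK (\<lambda>b. C a b c)) \<Longrightarrow>
    (\<And>a b. linK (\<lambda>c. C a b c)) \<Longrightarrow> ml3 C"
  by (simp add: ml3_def)

lemma ml4I: "(\<And>b c d. linK (\<lambda>a. C a b c d)) \<Longrightarrow> (\<And>a c d. linK (\<lambda>b. C a b c d)) \<Longrightarrow>
    (\<And>a b d. linK (\<lambda>c. C a b c d)) \<Longrightarrow> (\<And>a b c. linK (\<lambda>d. C a b c d)) \<Longrightarrow> ml4 C"
  by (simp add: ml4_def)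

lemma ml2D:
  assumes "ml2 B"
  shows "linH t \<Longrightarrow> linK (\<lambda>x. B (t x) b)" "linH t \<Longrightarrow> linK (\<lambda>x. B a (t x))"
  using assms by (auto simp: ml2_def linK_iff linH_iff)

lemma ml3D:
  assumes "ml3 C"
  shows "linH t \<Longrightarrow> linK (\<lambda>x. C (t x) b c)" "linH t \<Longrightarrow> linK (\<lambda>x. C a (t x) c)"
    "linH t \<Longrightarrow> linK (\<lambda>x. C a b (t x))"
  using assms by (auto simp: ml3_def linK_iff linH_iff)

lemma ml4D:
  assumes "ml4 C"
  shows "linH t \<Longrightarrow> linK (\<lambda>x. C (t x) b c d)" "linH t \<Longrightarrow> linK (\<lambda>x. C a (t x) c d)"
    "linH t \<Longrightarrow> linK (\<lambda>x. C a b (t x) d)" "linH t \<Longrightarrow> linK (\<lambda>x. C a b c (t x))"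
  using assms by (auto simp: ml4_def linK_iff linH_iff)

lemma Halg_simps [simp]: "car (Halg Q) = UNIV" "scl (Halg Q) = hscale Q" "mul (Halg Q) = (*)"
    "unt (Halg Q) = 1"
  by (auto simp: Halg_def)

lemma lift2_hom:
  assumes "g 0 = 0" "\<And>u v. g (u + v) = g u + g v"
  shows "g (lift2 Q B t) = lift2 Q (\<lambda>x y. g (B x y)) t"
  unfolding lift2_def by (rule tlift_hom) (use assms in auto)

lemma lift2_add_fun: "lift2 Q (\<lambda>x y. B x y + B' x y) t = lift2 Q B t + lift2 Q B' t"
  by (simp add: lift2_def tlift_add_fun)

lemma lift2_zero_fun [simp]: "lift2 Q (\<lambda>x y. 0) t = 0"
  by (simp add: lift2_def)

lemma lift2_cmult: "lift2 Q (\<lambda>x y. c * B x y) t = c * (lift2 Q B t :: 'k)"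
  by (rule lift2_hom[symmetric]) (auto simp: algebra_simps)

lemma lift3_hom:
  assumes "g 0 = 0" "\<And>u v. g (u + v) = g u + g v"
  shows "g (lift3 Q C t) = lift3 Q (\<lambda>x y z. g (C x y z)) t"
  unfolding lift3_def by (simp add: tlift_hom[of g] lift2_hom[of g] assms)

lemma lift3_add_fun: "lift3 Q (\<lambda>x y z. C x y z + C' x y z) t = lift3 Q C t + lift3 Q C' t"
  by (simp add: lift3_def lift2_add_fun tlift_add_fun)

lemma lift3_zero_fun [simp]: "lift3 Q (\<lambda>x y z. 0) t = 0"
  by (simp add: lift3_def)

lemma lift3_cmult: "lift3 Q (\<lambda>x y z. c * C x y z) t = c * (lift3 Q C t :: 'k)"
  by (rule lift3_hom[symmetric]) (auto simp: algebra_simps)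

lemma lift22_swap:
  "lift2 Q (\<lambda>a b. lift2 Q (\<lambda>c d. F a b c d) u) t = lift2 Q (\<lambda>c d. lift2 Q (\<lambda>a b. F a b c d) t) u"
  unfolding lift2_def by (rule tlift_swap)

lemma lift2_tlift_swap:
  "lift2 Q (\<lambda>a b. tlift V W (\<lambda>c d. F a b c d) u) t = tlift V W (\<lambda>c d. lift2 Q (\<lambda>a b. F a b c d) t) u"
  unfolding lift2_def by (rule tlift_swap)

lemma lift3_tlift_swap:
  "lift3 Q (\<lambda>a b e. tlift V W (\<lambda>c d. F a b e c d) u) t = tlift V W (\<lambda>c d. lift3 Q (\<lambda>a b e. F a b e c d) t) u"
  unfolding lift3_def lift2_tlift_swap by (rule tlift_swap)

lemma lift23_swap:
  "lift2 Q (\<lambda>a b. lift3 Q (\<lambda>c d e. F a b c d e) u) t = lift3 Q (\<lambda>c d e. lift2 Q (\<lambda>a b. F a b c d e) t) u"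
  unfolding lift2_def by (rule lift3_tlift_swap[symmetric])

lemma lift33_swap:
  "lift3 Q (\<lambda>a b c. lift3 Q (\<lambda>d e f. F a b c d e f) u) t =
   lift3 Q (\<lambda>d e f. lift3 Q (\<lambda>a b c. F a b c d e f) t) u"
  unfolding lift3_def[of _ _ u] lift3_tlift_swap
  by (intro arg_cong[where f = "\<lambda>B. tlift _ _ B u"] ext) (rule lift23_swap[symmetric])

lemma cop_hom:
  assumes "g 0 = 0" "\<And>u v. g (u + v) = g u + g v"
  shows "g (cop h B) = cop h (\<lambda>x y. g (B x y))"
  unfolding cop_def by (rule lift2_hom) (use assms in auto)

lemma phi_hom:
  assumes "g 0 = 0" "\<And>u v. g (u + v) = g u + g v"
  shows "g (phi C) = phi (\<lambda>x y z. g (C x y z))"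
  unfolding phi_def by (rule lift3_hom) (use assms in auto)

lemma psi_hom:
  assumes "g 0 = 0" "\<And>u v. g (u + v) = g u + g v"
  shows "g (psi C) = psi (\<lambda>x y z. g (C x y z))"
  unfolding psi_def by (rule lift3_hom) (use assms in auto)

lemma bilinear_on_HH: "bilinear_on (Halg Q) (Halg Q) (*) B \<longleftrightarrow> ml2 B"
  by (auto simp: bilinear_on_def ml2_def linK_iff)

lemma lift2_tens2: "ml2 B \<Longrightarrow> lift2 Q B (tens2 Q a b) = B a b"
  unfolding lift2_def tens2_def
  by (rule tlift_tens[OF vector_space_times]) (auto simp: bilinear_on_HH)

lemma lift2_add: "ml2 B \<Longrightarrow> t \<in> car (H2 Q) \<Longrightarrow> u \<in> car (H2 Q) \<Longrightarrow> lift2 Q B (t + u) = lift2 Q B t + lift2 Q B u"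
  unfolding lift2_def H2_def
  by (rule tlift_add[OF vector_space_times]) (auto simp: bilinear_on_HH)

lemma lift2_scale: "ml2 B \<Longrightarrow> t \<in> car (H2 Q) \<Longrightarrow> lift2 Q B (fscale c t) = c * lift2 Q B t"
  unfolding lift2_def H2_def
  by (rule tlift_scale[OF vector_space_times]) (auto simp: bilinear_on_HH)

lemma lift2_mul:
  assumes "ml2 B" "t \<in> car (H2 Q)" "u \<in> car (H2 Q)"
  shows "lift2 Q B (mul (H2 Q) t u) = lift2 Q (\<lambda>a b. lift2 Q (\<lambda>c d. B (a * c) (b * d)) u) t"
  using tlift_mul[OF vector_space_times, of "Halg Q" "Halg Q" B t u] assms
  by (simp add: bilinear_on_HH H2_def lift2_def)

lemma tens2_car [simp]: "tens2 Q a b \<in> car (H2 Q)"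
  by (simp add: tens2_def H2_def car_tensor_tens)

lemma H2_mul_car: "t \<in> car (H2 Q) \<Longrightarrow> u \<in> car (H2 Q) \<Longrightarrow> mul (H2 Q) t u \<in> car (H2 Q)"
  unfolding H2_def by (rule car_tensor_mul) auto

lemma Delta_car [simp]: "Delta Q h \<in> car (H2 Q)"
  using qb by blast

lemma bilinear_on_H12:
  "ml3 C \<Longrightarrow> bilinear_on (Halg Q) (H2 Q) (*) (\<lambda>x u. lift2 Q (C x) u)"
  unfolding bilinear_on_def
proof (intro conjI ballI allI)
  assume C: "ml3 C"
  have C': "ml2 (C x)" for x using C by (simp add: ml2_def ml3_def)
  show "lift2 Q (C (x + x')) y = lift2 Q (C x) y + lift2 Q (C x') y" for x x' y
  proof -
    have "C (x + x') = (\<lambda>b c. C x b c + C x' b c)"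
      using C by (intro ext) (simp add: ml3_def linK_iff)
    then show ?thesis by (simp add: lift2_add_fun)
  qed
  show "lift2 Q (C (scl (Halg Q) c x)) y = c * lift2 Q (C x) y" for c x y
  proof -
    have "C (hscale Q c x) = (\<lambda>a b. c * C x a b)"
      using C by (intro ext) (simp add: ml3_def linK_iff)
    then show ?thesis by (simp add: lift2_cmult)
  qed
  show "y \<in> car (H2 Q) \<Longrightarrow> y' \<in> car (H2 Q) \<Longrightarrow> lift2 Q (C x) (y + y') = lift2 Q (C x) y + lift2 Q (C x) y'" for x y y'
    by (rule lift2_add[OF C'])
  show "y \<in> car (H2 Q) \<Longrightarrow> lift2 Q (C x) (scl (H2 Q) c y) = c * lift2 Q (C x) y" for x y c
    using lift2_scale[OF C'] by (simp add: H2_def tensor_alg_def)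
qed

lemma lift3_add: "ml3 C \<Longrightarrow> t \<in> car (H3 Q) \<Longrightarrow> u \<in> car (H3 Q) \<Longrightarrow> lift3 Q C (t + u) = lift3 Q C t + lift3 Q C u"
  unfolding lift3_def H3_def
  by (rule tlift_add[OF vector_space_times]) (auto simp: bilinear_on_H12)

lemma lift3_scale: "ml3 C \<Longrightarrow> t \<in> car (H3 Q) \<Longrightarrow> lift3 Q C (fscale c t) = c * lift3 Q C t"
  unfolding lift3_def H3_def
  by (rule tlift_scale[OF vector_space_times]) (auto simp: bilinear_on_H12)

lemma tens3_car [simp]: "tens3 Q a b c \<in> car (H3 Q)"
  by (simp add: tens3_def H3_def car_tensor_tens)

lemma H3_mul_car: "t \<in> car (H3 Q) \<Longrightarrow> u \<in> car (H3 Q) \<Longrightarrow> mul (H3 Q) t u \<in> car (H3 Q)"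
  unfolding H3_def by (rule car_tensor_mul) (auto intro: H2_mul_car)

lemma lift3_tens:
  assumes "ml3 C" "u \<in> car (H2 Q)"
  shows "lift3 Q C (tens (Halg Q) (H2 Q) a u) = lift2 Q (C a) u"
  unfolding lift3_def
  using tlift_tens[OF vector_space_times bilinear_on_H12[OF assms(1)]] assms(2) by simp

lemma lift3_tens3:
  assumes "ml3 C"
  shows "lift3 Q C (tens3 Q a b c) = C a b c"
proof -
  have "ml2 (C a)" using assms by (simp add: ml2_def ml3_def)
  then show ?thesis unfolding tens3_def by (simp add: lift3_tens assms lift2_tens2)
qed

lemma lift3_mul:
  assumes C: "ml3 C" and t: "t \<in> car (H3 Q)" and u: "u \<in> car (H3 Q)"
  shows "lift3 Q C (mul (H3 Q) t u) =
    lift3 Q (\<lambda>a b c. lift3 Q (\<lambda>a' b' c'. C (a * a') (b * b') (c * c')) u) t"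
proof -
  have C': "ml2 (C x)" for x using C by (simp add: ml2_def ml3_def)
  have "lift3 Q C (mul (H3 Q) t u) =
    tlift (Halg Q) (H2 Q) (\<lambda>x y. tlift (Halg Q) (H2 Q) (\<lambda>x' y'. lift2 Q (C (x * x')) (mul (H2 Q) y y')) u) t"
    using tlift_mul[OF vector_space_times bilinear_on_H12[OF C], of t u] t u
    by (simp add: H3_def lift3_def H2_mul_car)
  also have "\<dots> = tlift (Halg Q) (H2 Q) (\<lambda>x y. tlift (Halg Q) (H2 Q) (\<lambda>x' y'.
      lift2 Q (\<lambda>b c. lift2 Q (\<lambda>b' c'. C (x * x') (b * b') (c * c')) y') y) u) t"
    using t u unfolding H3_def by (intro tlift_cong) (auto simp: lift2_mul C')
  also have "\<dots> = lift3 Q (\<lambda>a b c. lift3 Q (\<lambda>a' b' c'. C (a * a') (b * b') (c * c')) u) t"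
    unfolding lift3_def
    by (intro arg_cong[where f = "\<lambda>B. tlift _ _ B t"] ext) (rule lift2_tlift_swap[symmetric])
  finally show ?thesis .
qed

definition lift4 :: "('h \<Rightarrow> 'h \<Rightarrow> 'h \<Rightarrow> 'h \<Rightarrow> 'k) \<Rightarrow> ('k, 'h, ('k, 'h) t3) tens \<Rightarrow> 'k" where
  "lift4 D t = tlift (Halg Q) (H3 Q) (\<lambda>x u. lift3 Q (D x) u) t"

lemma bilinear_on_H13:
  assumes D: "ml4 D"
  shows "bilinear_on (Halg Q) (H3 Q) (*) (\<lambda>x u. lift3 Q (D x) u)"
  unfolding bilinear_on_def
proof (intro conjI ballI allI)
  have D': "ml3 (D x)" for x using D by (simp add: ml4_def ml3_def)
  show "lift3 Q (D (x + x')) y = lift3 Q (D x) y + lift3 Q (D x') y" for x x' y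
  proof -
    have "D (x + x') = (\<lambda>b c d. D x b c d + D x' b c d)"
      using D by (intro ext) (simp add: ml4_def linK_iff)
    then show ?thesis by (simp add: lift3_add_fun)
  qed
  show "lift3 Q (D (scl (Halg Q) c x)) y = c * lift3 Q (D x) y" for c x y
  proof -
    have "D (hscale Q c x) = (\<lambda>a b d. c * D x a b d)"
      using D by (intro ext) (simp add: ml4_def linK_iff)
    then show ?thesis by (simp add: lift3_cmult)
  qed
  show "y \<in> car (H3 Q) \<Longrightarrow> y' \<in> car (H3 Q) \<Longrightarrow> lift3 Q (D x) (y + y') = lift3 Q (D x) y + lift3 Q (D x) y'" for x y y'
    by (rule lift3_add[OF D'])
  show "y \<in> car (H3 Q) \<Longrightarrow> lift3 Q (D x) (scl (H3 Q) c y) = c * lift3 Q (D x) y" for x y c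
    using lift3_scale[OF D'] by (simp add: H3_def tensor_alg_def)
qed

lemma tens4_car [simp]: "tens4 Q a b c d \<in> car (H4 Q)"
  by (simp add: tens4_def H4_def car_tensor_tens)

lemma H4_mul_car: "t \<in> car (H4 Q) \<Longrightarrow> u \<in> car (H4 Q) \<Longrightarrow> mul (H4 Q) t u \<in> car (H4 Q)"
  unfolding H4_def by (rule car_tensor_mul) (auto intro: H3_mul_car)

lemma lift4_tens:
  assumes "ml4 D" "u \<in> car (H3 Q)"
  shows "lift4 D (tens (Halg Q) (H3 Q) a u) = lift3 Q (D a) u"
  unfolding lift4_def
  using tlift_tens[OF vector_space_times bilinear_on_H13[OF assms(1)]] assms(2) by simp

lemma lift4_tens4:
  assumes "ml4 D"
  shows "lift4 D (tens4 Q a b c d) = D a b c d"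
proof -
  have "ml3 (D a)" using assms by (simp add: ml4_def ml3_def)
  then show ?thesis unfolding tens4_def by (simp add: lift4_tens assms lift3_tens3)
qed

lemma lift4_mul:
  assumes D: "ml4 D" and t: "t \<in> car (H4 Q)" and u: "u \<in> car (H4 Q)"
  shows "lift4 D (mul (H4 Q) t u) =
    lift4 (\<lambda>a b c d. lift4 (\<lambda>a' b' c' d'. D (a * a') (b * b') (c * c') (d * d')) u) t"
proof -
  have D': "ml3 (D x)" for x using D by (simp add: ml3_def ml4_def)
  have "lift4 D (mul (H4 Q) t u) =
    tlift (Halg Q) (H3 Q) (\<lambda>x y. tlift (Halg Q) (H3 Q) (\<lambda>x' y'. lift3 Q (D (x * x')) (mul (H3 Q) y y')) u) t"
    using tlift_mul[OF vector_space_times bilinear_on_H13[OF D], of t u] t u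
    by (simp add: H4_def lift4_def H3_mul_car)
  also have "\<dots> = tlift (Halg Q) (H3 Q) (\<lambda>x y. tlift (Halg Q) (H3 Q) (\<lambda>x' y'.
      lift3 Q (\<lambda>b c d. lift3 Q (\<lambda>b' c' d'. D (x * x') (b * b') (c * c') (d * d')) y') y) u) t"
    using t u unfolding H4_def by (intro tlift_cong) (auto simp: lift3_mul D')
  also have "\<dots> = lift4 (\<lambda>a b c d. lift4 (\<lambda>a' b' c' d'. D (a * a') (b * b') (c * c') (d * d')) u) t"
    unfolding lift4_def
    by (intro arg_cong[where f = "\<lambda>B. tlift _ _ B t"] ext) (rule lift3_tlift_swap[symmetric])
  finally show ?thesis .
qed

text \<open>A bilinear form on \<open>H\<close> and \<open>H2\<close> is determined by the trilinear
  form obtained by restricting its second argument to pure tensors, since these span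
  \<open>H2\<close>. Hence trilinear forms already separate the elements of
  \<open>H3\<close>.\<close>

lemma H3_eqI:
  assumes "t \<in> car (H3 Q)" "u \<in> car (H3 Q)" "\<And>C. ml3 C \<Longrightarrow> lift3 Q C t = lift3 Q C u"
  shows "t = u"
proof (rule tensor_eqI[OF assms(1,2)[unfolded H3_def]])
  fix F assume F: "bilinear_on (Halg Q) (H2 Q) (*) F"
  define C where "C = (\<lambda>a b c. F a (tens2 Q b c))"
  have tt: "bilinear_on (Halg Q) (Halg Q) fscale (tens2 Q)"
    unfolding tens2_def by (rule bilinear_on_tens)
  have tadd: "tens2 Q (b + b') c = tens2 Q b c + tens2 Q b' c" "tens2 Q b (c + c') = tens2 Q b c + tens2 Q b c'"
    "tens2 Q (hscale Q r b) c = fscale r (tens2 Q b c)" "tens2 Q b (hscale Q r c) = fscale r (tens2 Q b c)" for b b' c c' r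
    using tt by (auto simp: bilinear_on_def)
  have sc: "scl (H2 Q) = fscale" by (simp add: H2_def tensor_alg_def)
  have C: "ml3 C"
    unfolding C_def ml3_def linK_iff
    using F[unfolded bilinear_on_def sc Halg_simps] tens2_car by (simp only: tadd) blast
  have eq: "v F = lift3 Q C v" if v: "v \<in> car (H3 Q)" for v
  proof -
    have "v F = tlift (Halg Q) (H2 Q) F v"
      using tensor_apply[OF v[unfolded H3_def], of F] F by simp
    also have "\<dots> = lift3 Q C v"
      unfolding lift3_def
    proof (rule tlift_cong[OF v[unfolded H3_def]])
      fix x y assume y: "y \<in> car (H2 Q)"
      have "F x y = F x (tlift (Halg Q) (Halg Q) (tens2 Q) y)"
        using tlift_tens_self[OF y[unfolded H2_def]] by (simp add: tens2_def[abs_def])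
      also have "\<dots> = lift2 Q (C x) y"
        unfolding lift2_def C_def
      proof (rule tlift_hom_on(2)[OF y[unfolded H2_def], where A = "car (H2 Q)"])
        show add: "F x (u + v) = F x u + F x v" if "u \<in> car (H2 Q)" "v \<in> car (H2 Q)" for u v
          using F that unfolding bilinear_on_def Halg_simps by blast
        show zero: "0 \<in> car (H2 Q)" unfolding H2_def by (rule car_tensor_zero)
        show "F x 0 = 0" using add[OF zero zero] by (simp only: add_0_left add_cancel_right_right)
        show "u + v \<in> car (H2 Q)" if "u \<in> car (H2 Q)" "v \<in> car (H2 Q)" for u v
          using that unfolding H2_def by (rule car_tensor_add)
      qed (rule tens2_car)
      finally show "F x y = lift2 Q (C x) y" .
    qed
    finally show ?thesis .
  qed
  show "t F = u F" by (simp only: eq[OF assms(1)] eq[OF assms(2)] assms(3)[OF C])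
qed

end

section \<open>Forms evaluated at the coproduct and the associator\<close>

text \<open>Induced linear maps are only controlled on carriers, so additivity is relativised to a
  set. Closure of that set under addition is included, which makes the predicate double as a source
  of membership facts.\<close>

definition additive_on :: "'a::ab_group_add set \<Rightarrow> ('a \<Rightarrow> 'b::ab_group_add) \<Rightarrow> bool" where
  "additive_on A g \<longleftrightarrow> 0 \<in> A \<and> (\<forall>u\<in>A. \<forall>v\<in>A. u + v \<in> A) \<and> g 0 = 0 \<and> (\<forall>u\<in>A. \<forall>v\<in>A. g (u + v) = g u + g v)"

lemma additive_on_tlift:
  assumes "vector_space s" "bilinear_on V W s B"
  shows "additive_on (car (tensor_alg V W)) (tlift V W B)"
  unfolding additive_on_def
proof (intro conjI ballI)
  show "0 \<in> car (tensor_alg V W)" by (rule car_tensor_zero)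
  show "tlift V W B 0 = 0" by (rule tlift_zero[OF assms])
qed (auto intro: car_tensor_add simp only: tlift_add[OF assms])

lemma additive_on_sum:
  assumes "additive_on A g" "\<And>i. i \<in> I \<Longrightarrow> f i \<in> A"
  shows "sum f I \<in> A" "g (sum f I) = (\<Sum>i\<in>I. g (f i))"
proof -
  have "sum f I \<in> A \<and> g (sum f I) = (\<Sum>i\<in>I. g (f i))"
    using assms(2)
  proof (induction I rule: infinite_finite_induct)
    case (insert x F)
    then have "f x \<in> A" "sum f F \<in> A \<and> g (sum f F) = (\<Sum>i\<in>F. g (f i))" by blast+
    then show ?case using assms(1) unfolding additive_on_def sum.insert[OF insert(1,2)] by metis
  qed (use assms(1) in \<open>simp_all only: additive_on_def sum.infinite sum.empty simp_thms\<close>)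
  then show "sum f I \<in> A" "g (sum f I) = (\<Sum>i\<in>I. g (f i))" by auto
qed

lemma additive_on_tlift_comp:
  assumes "additive_on A g" "t \<in> car (tensor_alg V W)"
    and "\<And>x y. x \<in> car V \<Longrightarrow> y \<in> car W \<Longrightarrow> B x y \<in> A"
  shows "tlift V W B t \<in> A" "g (tlift V W B t) = tlift V W (\<lambda>x y. g (B x y)) t"
  by (rule tlift_hom_on[OF assms(2), where A = A and g = g];
    use assms(1,3) in \<open>unfold additive_on_def, blast\<close>)+

context quasi_bialg
begin

lemma additive_on_lift2_comp:
  assumes "additive_on A g" "\<And>x y. F x y \<in> A"
  shows "lift2 Q F t \<in> A" "g (lift2 Q F t) = lift2 Q (\<lambda>x y. g (F x y)) t"
proof -
  have "lift2 Q F t \<in> A \<and> g (lift2 Q F t) = lift2 Q (\<lambda>x y. g (F x y)) t"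
    unfolding lift2_def tlift_def
    by (rule sum_list_hom_on) (use assms in \<open>unfold additive_on_def, blast\<close>)+
  then show "lift2 Q F t \<in> A" "g (lift2 Q F t) = lift2 Q (\<lambda>x y. g (F x y)) t" by auto
qed

lemma additive_on_lift3_comp:
  assumes "additive_on A g" "\<And>x y z. F x y z \<in> A"
  shows "lift3 Q F t \<in> A" "g (lift3 Q F t) = lift3 Q (\<lambda>x y z. g (F x y z)) t"
proof -
  note l2 = additive_on_lift2_comp[OF assms(1), of "F _", OF assms(2)]
  have "lift3 Q F t \<in> A \<and> g (lift3 Q F t) = tlift (Halg Q) (H2 Q) (\<lambda>x u. g (lift2 Q (F x) u)) t"
    unfolding lift3_def tlift_def
    by (rule sum_list_hom_on) (use assms l2(1) in \<open>unfold additive_on_def, blast\<close>)+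
  then show "lift3 Q F t \<in> A" "g (lift3 Q F t) = lift3 Q (\<lambda>x y z. g (F x y z)) t"
    unfolding lift3_def l2(2) by auto
qed

lemma additive_on_lift2: "ml2 B \<Longrightarrow> additive_on (car (H2 Q)) (lift2 Q B)"
  unfolding lift2_def[abs_def] H2_def
  by (rule additive_on_tlift[OF vector_space_times]) (simp add: bilinear_on_HH)

lemma additive_on_lift3: "ml3 C \<Longrightarrow> additive_on (car (H3 Q)) (lift3 Q C)"
  unfolding lift3_def[abs_def] H3_def
  by (rule additive_on_tlift[OF vector_space_times bilinear_on_H12])

lemma additive_on_lift4: "ml4 D \<Longrightarrow> additive_on (car (H4 Q)) (lift4 D)"
  unfolding lift4_def[abs_def] H4_def
  by (rule additive_on_tlift[OF vector_space_times bilinear_on_H13])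

lemma cop_add_fun: "cop h (\<lambda>a b. B a b + B' a b) = cop h B + cop h B'"
  by (simp add: cop_def lift2_add_fun)

lemma cop_cmult: "c * cop h B = cop h (\<lambda>a b. c * B a b)" for c :: 'k
  by (simp add: cop_def lift2_cmult)

lemma phi_add_fun: "phi (\<lambda>a b c. B a b c + B' a b c) = phi B + phi B'"
  by (simp add: phi_def lift3_add_fun)

lemma phi_cmult: "r * phi C = phi (\<lambda>a b c. r * C a b c)" for r :: 'k
  by (simp add: phi_def lift3_cmult)

lemma psi_add_fun: "psi (\<lambda>a b c. B a b c + B' a b c) = psi B + psi B'"
  by (simp add: psi_def lift3_add_fun)

lemma psi_cmult: "r * psi C = psi (\<lambda>a b c. r * C a b c)" for r :: 'k
  by (simp add: psi_def lift3_cmult)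

lemma linK_lift2 [lin]: "(\<And>a b. linK (\<lambda>x. F x a b)) \<Longrightarrow> linK (\<lambda>x. lift2 Q (\<lambda>a b. F x a b) t)"
proof -
  assume F: "\<And>a b. linK (\<lambda>x. F x a b)"
  have "F (x + y) = (\<lambda>a b. F x a b + F y a b)" "F (hscale Q c x) = (\<lambda>a b. c * F x a b)" for x y c
    using F by (intro ext; simp add: linK_iff)+
  then show ?thesis by (simp add: linK_iff lift2_add_fun lift2_cmult)
qed

lemma linK_lift3 [lin]: "(\<And>a b c. linK (\<lambda>x. F x a b c)) \<Longrightarrow> linK (\<lambda>x. lift3 Q (\<lambda>a b c. F x a b c) t)"
proof -
  assume F: "\<And>a b c. linK (\<lambda>x. F x a b c)"
  have "F (x + y) = (\<lambda>a b c. F x a b c + F y a b c)" "F (hscale Q r x) = (\<lambda>a b c. r * F x a b c)" for x y r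
    using F by (intro ext; simp add: linK_iff)+
  then show ?thesis by (simp add: linK_iff lift3_add_fun lift3_cmult)
qed

lemma linK_cop_fun [lin]: "(\<And>a b. linK (\<lambda>x. F x a b)) \<Longrightarrow> linK (\<lambda>x. cop h (\<lambda>a b. F x a b))"
  unfolding cop_def by (rule linK_lift2)

lemma linK_phi [lin]: "(\<And>a b c. linK (\<lambda>x. F x a b c)) \<Longrightarrow> linK (\<lambda>x. phi (\<lambda>a b c. F x a b c))"
  unfolding phi_def by (rule linK_lift3)

lemma linK_psi [lin]: "(\<And>a b c. linK (\<lambda>x. F x a b c)) \<Longrightarrow> linK (\<lambda>x. psi (\<lambda>a b c. F x a b c))"
  unfolding psi_def by (rule linK_lift3)

lemma linK_cop:
  assumes "ml2 B" shows "linK (\<lambda>h. cop h B)"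
proof -
  have "Delta Q (x + y) = Delta Q x + Delta Q y" "Delta Q (hscale Q c x) = fscale c (Delta Q x)" for x y c
    using linear_Delta by (auto simp: Vector_Spaces.linear_iff)
  then show ?thesis using assms by (simp add: linK_iff cop_def lift2_add lift2_scale)
qed

lemma linK_cop_arg [lin]:
  assumes "\<And>b. linK (\<lambda>a. B a b)" "\<And>a. linK (\<lambda>b. B a b)" "linH t"
  shows "linK (\<lambda>x. cop (t x) (\<lambda>a b. B a b))"
  by (rule linK_comp[OF linK_cop assms(3)]) (rule ml2I[OF assms(1,2)])

lemma cop_cop_swap: "cop t (\<lambda>a b. cop u (\<lambda>c d. F a b c d)) = cop u (\<lambda>c d. cop t (\<lambda>a b. F a b c d))"
  unfolding cop_def by (rule lift22_swap)

lemma cop_phi_swap: "cop t (\<lambda>a b. phi (\<lambda>x y z. F a b x y z)) = phi (\<lambda>x y z. cop t (\<lambda>a b. F a b x y z))"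
  unfolding cop_def phi_def by (rule lift23_swap)

lemma cop_psi_swap: "cop t (\<lambda>a b. psi (\<lambda>x y z. F a b x y z)) = psi (\<lambda>x y z. cop t (\<lambda>a b. F a b x y z))"
  unfolding cop_def psi_def by (rule lift23_swap)

lemma psi_phi_swap: "psi (\<lambda>a b c. phi (\<lambda>x y z. F a b c x y z)) = phi (\<lambda>x y z. psi (\<lambda>a b c. F a b c x y z))"
  unfolding phi_def psi_def by (rule lift33_swap)

lemma phi_phi_swap: "phi (\<lambda>a b c. phi (\<lambda>x y z. F a b c x y z)) = phi (\<lambda>x y z. phi (\<lambda>a b c. F a b c x y z))"
  unfolding phi_def by (rule lift33_swap)

lemma psi_psi_swap: "psi (\<lambda>a b c. psi (\<lambda>x y z. F a b c x y z)) = psi (\<lambda>x y z. psi (\<lambda>a b c. F a b c x y z))"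
  unfolding psi_def by (rule lift33_swap)

lemma Phi_car: "Phi Q \<in> car (H3 Q)"
  using qb by blast

lemma unt_H2: "unt (H2 Q) = tens2 Q 1 1"
  by (simp add: H2_def tens2_def tensor_alg_def)

lemma unt_H3: "unt (H3 Q) = tens3 Q 1 1 1"
  by (simp add: H3_def tens3_def tensor_alg_def unt_H2)

text \<open>\<open>Phi_inv\<close> is a definite description, so uniqueness of the inverse must be
  shown. It is the usual computation \<open>z = z (\<Phi> y) = (z \<Phi>) y = y\<close>, tested on
  trilinear forms so that associativity is only used inside \<open>'h\<close>.\<close>

lemma Phi_inv_inverts: "alg_inverts (H3 Q) (Phi Q) (Phi_inv Q)"
proof -
  obtain y where y: "alg_inverts (H3 Q) (Phi Q) y" using qb by blast
  have "z = y" if z: "alg_inverts (H3 Q) (Phi Q) z" for z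
  proof (rule H3_eqI)
    show zc: "z \<in> car (H3 Q)" and yc: "y \<in> car (H3 Q)" using y z by (auto simp: alg_inverts_def)
    fix C assume C: "ml3 C"
    have zP: "mul (H3 Q) z (Phi Q) = tens3 Q 1 1 1" and Py: "mul (H3 Q) (Phi Q) y = tens3 Q 1 1 1"
      using y z by (auto simp: alg_inverts_def unt_H3)
    define D where "D = (\<lambda>a b c. lift3 Q (\<lambda>a' b' c'. C (a * a') (b * b') (c * c')) y)"
    have D: "ml3 D" unfolding D_def by (intro ml3I lin ml3D[OF C])
    have E: "ml3 (\<lambda>a' b' c'. C (a * a') (b * b') (c * c'))" for a b c by (intro ml3I lin ml3D[OF C])
    have "lift3 Q C y = D 1 1 1" by (simp add: D_def)
    also have "\<dots> = lift3 Q D (mul (H3 Q) z (Phi Q))" unfolding zP by (rule lift3_tens3[OF D, symmetric])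
    also have "\<dots> = lift3 Q (\<lambda>a b c. lift3 Q (\<lambda>a' b' c'. D (a * a') (b * b') (c * c')) (Phi Q)) z"
      by (rule lift3_mul[OF D zc Phi_car])
    also have "\<dots> = lift3 Q (\<lambda>a b c. lift3 Q (\<lambda>a' b' c'. C (a * a') (b * b') (c * c')) (mul (H3 Q) (Phi Q) y)) z"
      unfolding D_def by (simp only: lift3_mul[OF E Phi_car yc] mult.assoc)
    also have "\<dots> = lift3 Q C z" unfolding Py by (simp only: lift3_tens3[OF E] mult_1_right)
    finally show "lift3 Q C z = lift3 Q C y" by simp
  qed
  then have "\<exists>!y. alg_inverts (H3 Q) (Phi Q) y" using y by blast
  then show ?thesis unfolding Phi_inv_def alg_inv_def by (rule theI')
qed

lemma Phi_inv_car: "Phi_inv Q \<in> car (H3 Q)"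
  using Phi_inv_inverts by (simp add: alg_inverts_def)

lemma phi_psi: "ml3 C \<Longrightarrow> phi (\<lambda>X1 X2 X3. psi (\<lambda>x1 x2 x3. C (X1 * x1) (X2 * x2) (X3 * x3))) = C 1 1 1"
  using Phi_inv_inverts lift3_mul[of C "Phi Q" "Phi_inv Q"]
  by (simp add: phi_def psi_def alg_inverts_def unt_H3 lift3_tens3 Phi_car)

lemma psi_phi: "ml3 C \<Longrightarrow> psi (\<lambda>x1 x2 x3. phi (\<lambda>X1 X2 X3. C (x1 * X1) (x2 * X2) (x3 * X3))) = C 1 1 1"
  using Phi_inv_inverts lift3_mul[of C "Phi_inv Q" "Phi Q"]
  by (simp add: phi_def psi_def alg_inverts_def unt_H3 lift3_tens3 Phi_car)

lemma cop_one: "ml2 B \<Longrightarrow> cop 1 B = B 1 1"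
  using qb by (simp add: cop_def unt_H2 lift2_tens2)

lemma cop_mult:
  "ml2 B \<Longrightarrow> cop (a * b) B = cop a (\<lambda>a1 a2. cop b (\<lambda>b1 b2. B (a1 * b1) (a2 * b2)))"
  using qb by (simp add: cop_def lift2_mul)

lemma eps_mult [simp]: "eps Q (a * b) = eps Q a * eps Q b" and eps_one [simp]: "eps Q 1 = 1"
  using qb by auto

lemma cop_hom_linK: "linK f \<Longrightarrow> f (lift2 Q B t) = lift2 Q (\<lambda>a b. f (B a b)) t"
proof (rule lift2_hom)
  assume "linK f"
  then show "f (u + v) = f u + f v" for u v by (simp add: linK_iff)
  from this[of 0 0] show "f 0 = 0" by (simp only: add_0_left add_cancel_right_right)
qed

lemma linK_hscale: "linK f \<Longrightarrow> f (hscale Q c x) = c * f x"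
  by (simp add: linK_iff)

lemma cop_eps_right: "linK f \<Longrightarrow> cop h (\<lambda>a b. eps Q b * f a) = f h"
proof -
  assume f: "linK f"
  have "f (lift2 Q (\<lambda>h1 h2. hscale Q (eps Q h2) h1) (Delta Q h)) = f h" using qb by simp
  then show ?thesis by (simp add: cop_def cop_hom_linK[OF f] linK_hscale[OF f])
qed

lemma cop_eps_left: "linK f \<Longrightarrow> cop h (\<lambda>a b. eps Q a * f b) = f h"
proof -
  assume f: "linK f"
  have "f (lift2 Q (\<lambda>h1 h2. hscale Q (eps Q h1) h2) (Delta Q h)) = f h" using qb by simp
  then show ?thesis by (simp add: cop_def cop_hom_linK[OF f] linK_hscale[OF f])
qed

lemma phi_eps2: "ml2 B \<Longrightarrow> phi (\<lambda>X1 X2 X3. eps Q X2 * B X1 X3) = B 1 1"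
proof -
  assume B: "ml2 B"
  have "lift2 Q B (lift3 Q (\<lambda>x y z. tens2 Q x (hscale Q (eps Q y) z)) (Phi Q)) = B 1 1"
    using qb by (simp add: lift2_tens2[OF B])
  moreover have "linK (B a)" for a using B by (simp add: ml2_def)
  ultimately show ?thesis
    by (simp add: additive_on_lift3_comp[OF additive_on_lift2[OF B]] lift2_tens2[OF B] phi_def linK_hscale)
qed

text \<open>The axiom conjugates by \<open>\<Phi>\<close>. Testing it on the form \<open>E\<close>,
  which is \<open>C\<close> translated on the right by \<open>\<Phi>\<close>, cancels the inverse
  and leaves one \<open>\<Phi>\<close> on each side.\<close>

lemma coassoc:
  assumes C: "ml3 C"
  shows "phi (\<lambda>X1 X2 X3. cop h (\<lambda>h1 h2. cop h1 (\<lambda>h11 h12. C (X1 * h11) (X2 * h12) (X3 * h2)))) =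
    phi (\<lambda>X1 X2 X3. cop h (\<lambda>h1 h2. cop h2 (\<lambda>h21 h22. C (h1 * X1) (h21 * X2) (h22 * X3))))"
proof -
  let ?L = "lift2 Q (\<lambda>h1 h2. lift2 Q (\<lambda>h21 h22. tens3 Q h1 h21 h22) (Delta Q h2)) (Delta Q h)"
  let ?R = "lift2 Q (\<lambda>h1 h2. lift2 Q (\<lambda>h11 h12. tens3 Q h11 h12 h2) (Delta Q h1)) (Delta Q h)"
  have eq: "?L = mul (H3 Q) (mul (H3 Q) (Phi Q) ?R) (Phi_inv Q)" using qb by blast
  \<comment> \<open>The zero form serves only to extract from \<open>additive_on\<close> that
    \<open>car (H3 Q)\<close> is closed under sums.\<close>
  have ad3: "additive_on (car (H3 Q)) (lift3 Q (\<lambda>_ _ _. 0 :: 'k))"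
    by (rule additive_on_lift3) (simp add: ml3_def linK_iff)
  have Rc: "?R \<in> car (H3 Q)"
    by (intro additive_on_lift2_comp(1)[OF ad3] tens3_car)
  have L: "lift3 Q D ?L = cop h (\<lambda>h1 h2. cop h2 (\<lambda>h21 h22. D h1 h21 h22))" if D: "ml3 D" for D
    by (simp add: cop_def additive_on_lift2_comp[OF additive_on_lift3[OF D]]
        additive_on_lift2_comp(1)[OF ad3] lift3_tens3[OF D])
  have R: "lift3 Q D ?R = cop h (\<lambda>h1 h2. cop h1 (\<lambda>h11 h12. D h11 h12 h2))" if D: "ml3 D" for D
    by (simp add: cop_def additive_on_lift2_comp[OF additive_on_lift3[OF D]]
        additive_on_lift2_comp(1)[OF ad3] lift3_tens3[OF D])
  have main: "cop h (\<lambda>h1 h2. cop h2 (\<lambda>h21 h22. D h1 h21 h22)) = phi (\<lambda>X1 X2 X3. cop h (\<lambda>h1 h2. cop h1 (\<lambda>h11 h12.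
      psi (\<lambda>x1 x2 x3. D (X1 * h11 * x1) (X2 * h12 * x2) (X3 * h2 * x3)))))" if D: "ml3 D" for D
  proof -
    define D' where "D' = (\<lambda>a b c. psi (\<lambda>x1 x2 x3. D (a * x1) (b * x2) (c * x3)))"
    have D': "ml3 D'" unfolding D'_def by (intro ml3I lin ml3D[OF D])
    have D'': "ml3 (\<lambda>a b c. D' (X1 * a) (X2 * b) (X3 * c))" for X1 X2 X3 by (intro ml3I lin ml3D[OF D'])
    have "lift3 Q D ?L = lift3 Q D' (mul (H3 Q) (Phi Q) ?R)"
      unfolding eq D'_def psi_def by (rule lift3_mul[OF D H3_mul_car[OF Phi_car Rc] Phi_inv_car])
    also have "\<dots> = phi (\<lambda>X1 X2 X3. lift3 Q (\<lambda>a b c. D' (X1 * a) (X2 * b) (X3 * c)) ?R)"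
      unfolding phi_def by (rule lift3_mul[OF D' Phi_car Rc])
    finally show ?thesis unfolding L[OF D] R[OF D''] by (simp add: D'_def)
  qed
  define E where "E = (\<lambda>a b c. phi (\<lambda>X1 X2 X3. C (a * X1) (b * X2) (c * X3)))"
  have E: "ml3 E" unfolding E_def by (intro ml3I lin ml3D[OF C])
  have C': "ml3 (\<lambda>x1 x2 x3. C (a * x1) (b * x2) (c * x3))" for a b c by (intro ml3I lin ml3D[OF C])
  have "phi (\<lambda>X1 X2 X3. cop h (\<lambda>h1 h2. cop h2 (\<lambda>h21 h22. C (h1 * X1) (h21 * X2) (h22 * X3)))) =
    cop h (\<lambda>h1 h2. cop h2 (\<lambda>h21 h22. E h1 h21 h22))"
    by (simp only: E_def cop_phi_swap)
  also have "\<dots> = phi (\<lambda>X1 X2 X3. cop h (\<lambda>h1 h2. cop h1 (\<lambda>h11 h12. C (X1 * h11) (X2 * h12) (X3 * h2))))"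
    by (subst main[OF E]) (simp only: E_def psi_phi[OF C', folded mult.assoc] mult_1_right)
  finally show ?thesis by simp
qed

text \<open>\<open>E\<close>, \<open>G\<close> and \<open>K\<close> are \<open>C\<close> with its
  right-hand factors already absorbed, so each product in \<open>H4\<close> is peeled off by one use
  of \<open>lift4_mul\<close>. On the left, \<open>A\<close>, \<open>B\<close>, \<open>Z\<close> run
  through \<open>1 \<otimes> \<Phi>\<close>,
  \<open>(id \<otimes> \<Delta> \<otimes> id)(\<Phi>)\<close> and
  \<open>\<Phi> \<otimes> 1\<close>.\<close>

lemma pentagon:
  assumes C: "ml4 C"
  shows "phi (\<lambda>A1 A2 A3. phi (\<lambda>B1 B2 B3. cop B2 (\<lambda>B21 B22. phi (\<lambda>Z1 Z2 Z3.
       C (B1 * Z1) (A1 * (B21 * Z2)) (A2 * (B22 * Z3)) (A3 * B3))))) =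
    phi (\<lambda>A1 A2 A3. cop A3 (\<lambda>A31 A32. phi (\<lambda>B1 B2 B3. cop B1 (\<lambda>B11 B12.
       C (A1 * B11) (A2 * B12) (A31 * B2) (A32 * B3)))))"
proof -
  let ?A = "tens (Halg Q) (H3 Q) 1 (Phi Q)"
  let ?B = "lift3 Q (\<lambda>x y z. lift2 Q (\<lambda>y1 y2. tens4 Q x y1 y2 z) (Delta Q y)) (Phi Q)"
  let ?Z = "lift3 Q (\<lambda>x y z. tens4 Q x y z 1) (Phi Q)"
  let ?X = "lift3 Q (\<lambda>x y z. lift2 Q (\<lambda>z1 z2. tens4 Q x y z1 z2) (Delta Q z)) (Phi Q)"
  let ?Y = "lift3 Q (\<lambda>x y z. lift2 Q (\<lambda>x1 x2. tens4 Q x1 x2 y z) (Delta Q x)) (Phi Q)"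
  have eq: "mul (H4 Q) (mul (H4 Q) ?A ?B) ?Z = mul (H4 Q) ?X ?Y" using qb by blast
  have ad: "additive_on (car (H4 Q)) (lift4 (\<lambda>_ _ _ _. 0))"
    by (rule additive_on_lift4) (simp add: ml4_def linK_iff)
  note mem = additive_on_lift2_comp(1)[OF ad] additive_on_lift3_comp(1)[OF ad] tens4_car
  have Ac: "?A \<in> car (H4 Q)" unfolding H4_def
    by (rule car_tensor_tens) (auto simp: Phi_car)
  have Bc: "?B \<in> car (H4 Q)" and Zc: "?Z \<in> car (H4 Q)" and Xc: "?X \<in> car (H4 Q)" and Yc: "?Y \<in> car (H4 Q)"
    by (intro mem)+
  have l: "lift4 D ?A = phi (D 1)"
    "lift4 D ?B = phi (\<lambda>B1 B2 B3. cop B2 (\<lambda>B21 B22. D B1 B21 B22 B3))"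
    "lift4 D ?Z = phi (\<lambda>Z1 Z2 Z3. D Z1 Z2 Z3 1)"
    "lift4 D ?X = phi (\<lambda>A1 A2 A3. cop A3 (\<lambda>A31 A32. D A1 A2 A31 A32))"
    "lift4 D ?Y = phi (\<lambda>A1 A2 A3. cop A1 (\<lambda>A11 A12. D A11 A12 A2 A3))" if D: "ml4 D" for D
    by (simp_all add: cop_def phi_def lift4_tens[OF D Phi_car] additive_on_lift3_comp[OF additive_on_lift4[OF D]]
        additive_on_lift2_comp[OF additive_on_lift4[OF D]] mem lift4_tens4[OF D])
  define E where "E = (\<lambda>a b c d. phi (\<lambda>Z1 Z2 Z3. C (a * Z1) (b * Z2) (c * Z3) d))"
  have E: "ml4 E" unfolding E_def by (intro ml4I lin ml4D[OF C])
  define G where "G = (\<lambda>a b c d. phi (\<lambda>B1 B2 B3. cop B2 (\<lambda>B21 B22. E (a * B1) (b * B21) (c * B22) (d * B3))))"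
  have G: "ml4 G" unfolding G_def by (intro ml4I lin ml4D[OF E])
  have C': "ml4 (\<lambda>a' b' c' d'. C (a * a') (b * b') (c * c') (d * d'))" for a b c d by (intro ml4I lin ml4D[OF C])
  have E': "ml4 (\<lambda>a' b' c' d'. E (a * a') (b * b') (c * c') (d * d'))" for a b c d by (intro ml4I lin ml4D[OF E])
  define K where "K = (\<lambda>a b c d. phi (\<lambda>B1 B2 B3. cop B1 (\<lambda>B11 B12. C (a * B11) (b * B12) (c * B2) (d * B3))))"
  have K: "ml4 K" unfolding K_def by (intro ml4I lin ml4D[OF C])
  have "lift4 C (mul (H4 Q) (mul (H4 Q) ?A ?B) ?Z) = lift4 E (mul (H4 Q) ?A ?B)"
    by (simp only: lift4_mul[OF C H4_mul_car[OF Ac Bc] Zc] l[OF C'] E_def mult_1_right)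
  also have "\<dots> = lift4 G ?A"
    by (simp only: lift4_mul[OF E Ac Bc] l[OF E'] G_def)
  also have "\<dots> = phi (\<lambda>A1 A2 A3. phi (\<lambda>B1 B2 B3. cop B2 (\<lambda>B21 B22. phi (\<lambda>Z1 Z2 Z3.
       C (B1 * Z1) (A1 * (B21 * Z2)) (A2 * (B22 * Z3)) (A3 * B3)))))"
    unfolding l[OF G] by (simp add: G_def E_def mult.assoc)
  finally have 1: "lift4 C (mul (H4 Q) (mul (H4 Q) ?A ?B) ?Z) = \<dots>" .
  have "lift4 C (mul (H4 Q) ?X ?Y) = lift4 K ?X"
    by (simp only: lift4_mul[OF C Xc Yc] l[OF C'] K_def)
  also have "\<dots> = phi (\<lambda>A1 A2 A3. cop A3 (\<lambda>A31 A32. phi (\<lambda>B1 B2 B3. cop B1 (\<lambda>B11 B12.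
       C (A1 * B11) (A2 * B12) (A31 * B2) (A32 * B3)))))"
    unfolding l[OF K] by (simp only: K_def)
  finally show ?thesis using 1 eq by simp
qed

text \<open>Writing \<open>C\<close> as the translate by \<open>\<Phi>\<close> of a form
  \<open>F\<close> (fact \<open>CF\<close>) brings the left side into the shape of
  \<open>coassoc\<close>; the product of \<open>\<Phi>\<^sup>-\<^sup>1\<close> and
  \<open>\<Phi>\<close> that then appears on the left cancels.\<close>

lemma psi_coassoc:
  assumes C: "ml3 C"
  shows "psi (\<lambda>x1 x2 x3. cop h (\<lambda>h1 h2. cop h2 (\<lambda>h21 h22. C (x1 * h1) (x2 * h21) (x3 * h22)))) =
    psi (\<lambda>x1 x2 x3. cop h (\<lambda>h1 h2. cop h1 (\<lambda>h11 h12. C (h11 * x1) (h12 * x2) (h2 * x3))))"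
proof -
  define F where "F = (\<lambda>a b c. psi (\<lambda>x1 x2 x3. C (a * x1) (b * x2) (c * x3)))"
  have F: "ml3 F" unfolding F_def by (intro ml3I lin ml3D[OF C])
  have F': "ml3 (\<lambda>a b c. F (x * a) (y * b) (z * c))" for x y z by (intro ml3I lin ml3D[OF F])
  have F'': "ml3 (\<lambda>a b c. cop h (\<lambda>h1 h2. cop h1 (\<lambda>h11 h12. F (a * h11) (b * h12) (c * h2))))"
    by (intro ml3I lin ml3D[OF F])
  have C': "ml3 (\<lambda>a b c. C (x * a) (y * b) (z * c))" for x y z by (intro ml3I lin ml3D[OF C])
  have CF: "C a b c = phi (\<lambda>X1 X2 X3. F (a * X1) (b * X2) (c * X3))" for a b c
    unfolding F_def using phi_psi[OF C', of a b c] by (simp only: mult.assoc mult_1_right)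
  have "psi (\<lambda>x1 x2 x3. cop h (\<lambda>h1 h2. cop h2 (\<lambda>h21 h22. C (x1 * h1) (x2 * h21) (x3 * h22)))) =
    psi (\<lambda>x1 x2 x3. phi (\<lambda>X1 X2 X3. cop h (\<lambda>h1 h2. cop h2 (\<lambda>h21 h22.
      F (x1 * (h1 * X1)) (x2 * (h21 * X2)) (x3 * (h22 * X3))))))"
    by (simp only: CF cop_phi_swap mult.assoc)
  also have "\<dots> = psi (\<lambda>x1 x2 x3. phi (\<lambda>X1 X2 X3. cop h (\<lambda>h1 h2. cop h1 (\<lambda>h11 h12.
      F (x1 * (X1 * h11)) (x2 * (X2 * h12)) (x3 * (X3 * h2))))))"
    by (simp only: coassoc[OF F'])
  also have "\<dots> = cop h (\<lambda>h1 h2. cop h1 (\<lambda>h11 h12. F h11 h12 h2))"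
    using psi_phi[OF F''] by (simp only: mult.assoc mult_1_left)
  also have "\<dots> = psi (\<lambda>x1 x2 x3. cop h (\<lambda>h1 h2. cop h1 (\<lambda>h11 h12. C (h11 * x1) (h12 * x2) (h2 * x3))))"
    by (simp only: F_def cop_psi_swap)
  finally show ?thesis .
qed

text \<open>The axioms only give the counit on the middle leg. Applying \<open>\<epsilon>\<close> to
  the second leg of the pentagon yields \<open>(1 \<otimes> (\<epsilon> \<otimes> id \<otimes>
  id)(\<Phi>)) \<Phi> = \<Phi>\<close> (fact \<open>main\<close>), and \<open>\<Phi>\<close> is
  cancelled by testing on the form \<open>F\<close> translated by the inverse.\<close>

lemma phi_eps1:
  assumes B: "ml2 B" shows "phi (\<lambda>X1 X2 X3. eps Q X1 * B X2 X3) = B 1 1"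
proof -
  have main: "phi (\<lambda>B1 B2 B3. phi (\<lambda>A1 A2 A3. eps Q A1 * F B1 (A2 * B2) (A3 * B3))) = phi F" if F: "ml3 F" for F
  proof -
    have C: "ml4 (\<lambda>a b c d. eps Q b * F a c d)" by (intro ml4I lin ml3D[OF F])
    have l1: "linK (\<lambda>b. F a (c * b) e)" for a c e by (intro lin ml3D[OF F])
    have m1: "ml2 (\<lambda>a b. F (c * a) (d * (e * b)) g)" for c d e g by (intro ml2I lin ml3D[OF F])
    have l2: "linK (\<lambda>b. F (a * b) c d)" for a c d by (intro lin ml3D[OF F])
    have "phi (\<lambda>B1 B2 B3. phi (\<lambda>A1 A2 A3. eps Q A1 * F B1 (A2 * B2) (A3 * B3))) =
      phi (\<lambda>A1 A2 A3. phi (\<lambda>B1 B2 B3. eps Q A1 * F B1 (A2 * B2) (A3 * B3)))"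
      by (rule phi_phi_swap)
    also have "\<dots> = phi (\<lambda>A1 A2 A3. phi (\<lambda>B1 B2 B3. cop B2 (\<lambda>B21 B22. phi (\<lambda>Z1 Z2 Z3.
       eps Q (A1 * (B21 * Z2)) * F (B1 * Z1) (A2 * (B22 * Z3)) (A3 * B3)))))"
      by (simp only: eps_mult mult.assoc phi_cmult[symmetric] cop_cmult[symmetric] phi_eps2[OF m1]
          cop_eps_left[OF l1] mult_1_right)
    also have "\<dots> = phi (\<lambda>A1 A2 A3. cop A3 (\<lambda>A31 A32. phi (\<lambda>B1 B2 B3. cop B1 (\<lambda>B11 B12.
       eps Q (A2 * B12) * F (A1 * B11) (A31 * B2) (A32 * B3)))))"
      by (rule pentagon[OF C])
    also have "\<dots> = phi (\<lambda>A1 A2 A3. eps Q A2 * cop A3 (\<lambda>A31 A32. phi (\<lambda>B1 B2 B3.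
       F (A1 * B1) (A31 * B2) (A32 * B3))))"
      by (simp only: eps_mult mult.assoc phi_cmult[symmetric] cop_cmult[symmetric] cop_eps_right[OF l2])
    also have "\<dots> = phi F"
    proof -
      have m4: "ml2 (\<lambda>a b. cop b (\<lambda>b1 b2. phi (\<lambda>B1 B2 B3. F (a * B1) (b1 * B2) (b2 * B3))))"
        and m5: "ml2 (\<lambda>b1 b2. phi (\<lambda>B1 B2 B3. F B1 (b1 * B2) (b2 * B3)))"
        by (intro ml2I lin ml3D[OF F])+
      show ?thesis using phi_eps2[OF m4] cop_one[OF m5] by (simp only: mult_1_left)
    qed
    finally show ?thesis .
  qed
  define F where "F = (\<lambda>a b c. psi (\<lambda>x1 x2 x3. eps Q (a * x1) * B (b * x2) (c * x3)))"
  have F: "ml3 F" unfolding F_def by (intro ml3I lin ml2D[OF B])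
  have G: "ml3 (\<lambda>a b c. eps Q a * B (d * b) (e * c))" for d e by (intro ml3I lin ml2D[OF B])
  have "phi (\<lambda>X1 X2 X3. eps Q X1 * B X2 X3) =
    phi (\<lambda>A1 A2 A3. eps Q A1 * phi (\<lambda>B1 B2 B3. F B1 (A2 * B2) (A3 * B3)))"
    using phi_psi[OF G] by (simp only: F_def mult.assoc eps_one mult_1_left mult_1_right)
  also have "\<dots> = phi F"
    using main[OF F] by (subst (asm) phi_phi_swap) (simp only: phi_cmult)
  also have "\<dots> = B 1 1"
    using phi_psi[OF G[of 1 1]] by (simp only: F_def mult_1_left eps_one)
  finally show ?thesis .
qed

text \<open>Mirror image of the previous argument: \<open>\<epsilon>\<close> on the third leg of the
  pentagon gives \<open>\<Phi> ((id \<otimes> id \<otimes> \<epsilon>)(\<Phi>) \<otimes> 1) =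
  \<Phi>\<close>, and this time \<open>\<Phi>\<close> is cancelled on the left.\<close>

lemma phi_eps3:
  assumes B: "ml2 B" shows "phi (\<lambda>X1 X2 X3. eps Q X3 * B X1 X2) = B 1 1"
proof -
  have main: "phi (\<lambda>B1 B2 B3. phi (\<lambda>Z1 Z2 Z3. eps Q Z3 * F (B1 * Z1) (B2 * Z2) B3)) = phi F" if F: "ml3 F" for F
  proof -
    have C: "ml4 (\<lambda>a b c d. eps Q c * F a b d)" by (intro ml4I lin ml3D[OF F])
    have l1: "linK (\<lambda>b. phi (\<lambda>Z1 Z2 Z3. eps Q Z3 * F (a * Z1) (e * (b * Z2)) d))" for a d e
      by (intro lin ml3D[OF F])
    have m1: "ml2 (\<lambda>a d. phi (\<lambda>B1 B2 B3. phi (\<lambda>Z1 Z2 Z3. eps Q Z3 * F (B1 * Z1) (a * (B2 * Z2)) (d * B3))))"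
      by (intro ml2I lin ml3D[OF F])
    have m2: "ml2 (\<lambda>a b. cop a (\<lambda>a1 a2. F (c * a1) (d * a2) (e * b)))" for c d e by (intro ml2I lin ml3D[OF F])
    have m3: "ml2 (\<lambda>a b. F (c * a) (d * b) e)" for c d e by (intro ml2I lin ml3D[OF F])
    have l3: "linK (F a b)" for a b using F by (simp add: ml3_def)
    have "phi (\<lambda>B1 B2 B3. phi (\<lambda>Z1 Z2 Z3. eps Q Z3 * F (B1 * Z1) (B2 * Z2) B3)) =
      phi (\<lambda>A1 A2 A3. eps Q A2 * phi (\<lambda>B1 B2 B3. phi (\<lambda>Z1 Z2 Z3. eps Q Z3 * F (B1 * Z1) (A1 * (B2 * Z2)) (A3 * B3))))"
      using phi_eps2[OF m1] by (simp only: mult_1_left)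
    also have "\<dots> = phi (\<lambda>A1 A2 A3. phi (\<lambda>B1 B2 B3. cop B2 (\<lambda>B21 B22. phi (\<lambda>Z1 Z2 Z3.
       eps Q (A2 * (B22 * Z3)) * F (B1 * Z1) (A1 * (B21 * Z2)) (A3 * B3)))))"
      by (simp only: eps_mult mult.assoc phi_cmult[symmetric] cop_cmult[symmetric] cop_eps_right[OF l1])
    also have "\<dots> = phi (\<lambda>A1 A2 A3. cop A3 (\<lambda>A31 A32. phi (\<lambda>B1 B2 B3. cop B1 (\<lambda>B11 B12.
       eps Q (A31 * B2) * F (A1 * B11) (A2 * B12) (A32 * B3)))))"
      by (rule pentagon[OF C])
    also have "\<dots> = phi (\<lambda>A1 A2 A3. cop A3 (\<lambda>A31 A32. eps Q A31 * F A1 A2 A32))"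
      by (simp only: eps_mult mult.assoc phi_cmult[symmetric] cop_cmult[symmetric] phi_eps2[OF m2]
        cop_one[OF m3] mult_1_right)
    also have "\<dots> = phi F"
      by (simp only: cop_eps_left[OF l3])
    finally show ?thesis .
  qed
  define F where "F = (\<lambda>a b c. psi (\<lambda>x1 x2 x3. eps Q (x3 * c) * B (x1 * a) (x2 * b)))"
  have F: "ml3 F" unfolding F_def by (intro ml3I lin ml2D[OF B])
  have G: "ml3 (\<lambda>a b c. eps Q c * B (a * d) (b * e))" for d e by (intro ml3I lin ml2D[OF B])
  have FB: "phi (\<lambda>B1 B2 B3. F (B1 * a) (B2 * b) B3) = B a b" for a b
    unfolding F_def psi_phi_swap[symmetric]
    using psi_phi[OF G[of a b]] by (simp only: mult.assoc mult_1_left eps_one)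
  have "phi (\<lambda>X1 X2 X3. eps Q X3 * B X1 X2) =
    phi (\<lambda>Z1 Z2 Z3. phi (\<lambda>B1 B2 B3. eps Q Z3 * F (B1 * Z1) (B2 * Z2) B3))"
    by (simp only: FB phi_cmult[symmetric])
  also have "\<dots> = phi F"
    using main[OF F] by (subst (asm) phi_phi_swap)
  also have "\<dots> = B 1 1"
    using FB[of 1 1] by (simp only: mult_1_right)
  finally show ?thesis .
qed

text \<open>Apply \<open>\<epsilon>\<close> to the leg in question of
  \<open>\<Phi>\<^sup>-\<^sup>1 \<Phi> = 1\<close>; the factor \<open>\<Phi>\<close> disappears by
  its own counit rule. The next two lemmas are proved in the same way.\<close>

lemma psi_eps1: "ml2 B \<Longrightarrow> psi (\<lambda>x1 x2 x3. eps Q x1 * B x2 x3) = B 1 1"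
proof -
  assume B: "ml2 B"
  have G: "ml3 (\<lambda>a b c. eps Q a * B b c)" by (intro ml3I lin ml2D[OF B])
  have E: "ml2 (\<lambda>b c. B (d * b) (e * c))" for d e by (intro ml2I lin ml2D[OF B])
  show ?thesis using psi_phi[OF G]
    by (simp only: eps_mult mult.assoc phi_cmult[symmetric] phi_eps1[OF E] mult_1_right mult_1_left eps_one)
qed

lemma psi_eps2: "ml2 B \<Longrightarrow> psi (\<lambda>x1 x2 x3. eps Q x2 * B x1 x3) = B 1 1"
proof -
  assume B: "ml2 B"
  have G: "ml3 (\<lambda>a b c. eps Q b * B a c)" by (intro ml3I lin ml2D[OF B])
  have E: "ml2 (\<lambda>b c. B (d * b) (e * c))" for d e by (intro ml2I lin ml2D[OF B])
  show ?thesis using psi_phi[OF G]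
    by (simp only: eps_mult mult.assoc phi_cmult[symmetric] phi_eps2[OF E] mult_1_right mult_1_left eps_one)
qed

lemma psi_eps3: "ml2 B \<Longrightarrow> psi (\<lambda>x1 x2 x3. eps Q x3 * B x1 x2) = B 1 1"
proof -
  assume B: "ml2 B"
  have G: "ml3 (\<lambda>a b c. eps Q c * B a b)" by (intro ml3I lin ml2D[OF B])
  have E: "ml2 (\<lambda>b c. B (d * b) (e * c))" for d e by (intro ml2I lin ml2D[OF B])
  show ?thesis using psi_phi[OF G]
    by (simp only: eps_mult mult.assoc phi_cmult[symmetric] phi_eps3[OF E] mult_1_right mult_1_left eps_one)
qed

text \<open>The abstract content of the antipode axioms: \<open>f(S(a) \<alpha> b)\<close> is a
  \<open>linv\<close> form in \<open>a\<close>, \<open>b\<close>, and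
  \<open>f(a \<beta> S(b))\<close> is an \<open>rinv\<close> form. Lemmas stated for such forms hold
  wherever the antipode occurs in one of these two patterns.\<close>

definition linv :: "('h \<Rightarrow> 'h \<Rightarrow> 'k) \<Rightarrow> bool" where
  "linv B \<longleftrightarrow> (\<forall>h a b. cop h (\<lambda>h1 h2. B (h1 * a) (h2 * b)) = eps Q h * B a b)"

definition rinv :: "('h \<Rightarrow> 'h \<Rightarrow> 'k) \<Rightarrow> bool" where
  "rinv B \<longleftrightarrow> (\<forall>h a b. cop h (\<lambda>h1 h2. B (a * h1) (b * h2)) = eps Q h * B a b)"

lemma linvD: "linv B \<Longrightarrow> cop h (\<lambda>h1 h2. B (h1 * a) (h2 * b)) = eps Q h * B a b"
  and rinvD: "rinv B \<Longrightarrow> cop h (\<lambda>h1 h2. B (a * h1) (b * h2)) = eps Q h * B a b"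
  by (auto simp: linv_def rinv_def)

text \<open>\<open>\<Delta>\<close> is multiplicative, so applying it to one leg of two mutually
  inverse associators gives mutually inverse elements of the fourfold tensor power. This and its
  four variants allow factors of the pentagon to be moved to the other side.\<close>

lemma psi_phi_cop3:
  assumes C: "ml4 C"
  shows "psi (\<lambda>x1 x2 x3. cop x3 (\<lambda>x31 x32. phi (\<lambda>Y1 Y2 Y3. cop Y3 (\<lambda>Y31 Y32.
      C (x1 * Y1) (x2 * Y2) (x31 * Y31) (x32 * Y32))))) = C 1 1 1 1"
proof -
  have m: "ml3 (\<lambda>a b c. cop c (\<lambda>c1 c2. C a b c1 c2))" by (intro ml3I lin ml4D[OF C])
  have n: "ml2 (C a b)" for a b using C by (simp add: ml2_def ml4_def)
  show ?thesis using psi_phi[OF m] by (simp only: cop_mult[OF n] cop_one[OF n] cop_phi_swap)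
qed

lemma phi_psi_cop3:
  assumes C: "ml4 C"
  shows "phi (\<lambda>x1 x2 x3. cop x3 (\<lambda>x31 x32. psi (\<lambda>Y1 Y2 Y3. cop Y3 (\<lambda>Y31 Y32.
      C (x1 * Y1) (x2 * Y2) (x31 * Y31) (x32 * Y32))))) = C 1 1 1 1"
proof -
  have m: "ml3 (\<lambda>a b c. cop c (\<lambda>c1 c2. C a b c1 c2))" by (intro ml3I lin ml4D[OF C])
  have n: "ml2 (C a b)" for a b using C by (simp add: ml2_def ml4_def)
  show ?thesis using phi_psi[OF m] by (simp only: cop_mult[OF n] cop_one[OF n] cop_psi_swap)
qed

lemma psi_phi_cop2:
  assumes C: "ml4 C"
  shows "psi (\<lambda>x1 x2 x3. cop x2 (\<lambda>x21 x22. phi (\<lambda>Y1 Y2 Y3. cop Y2 (\<lambda>Y21 Y22.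
      C (x1 * Y1) (x21 * Y21) (x22 * Y22) (x3 * Y3))))) = C 1 1 1 1"
proof -
  have m: "ml3 (\<lambda>a b c. cop b (\<lambda>b1 b2. C a b1 b2 c))" by (intro ml3I lin ml4D[OF C])
  have n: "ml2 (\<lambda>b c. C a b c d)" for a d using C by (simp add: ml2_def ml4_def)
  show ?thesis using psi_phi[OF m] by (simp only: cop_mult[OF n] cop_one[OF n] cop_phi_swap)
qed

lemma phi_psi_cop2:
  assumes C: "ml4 C"
  shows "phi (\<lambda>x1 x2 x3. cop x2 (\<lambda>x21 x22. psi (\<lambda>Y1 Y2 Y3. cop Y2 (\<lambda>Y21 Y22.
      C (x1 * Y1) (x21 * Y21) (x22 * Y22) (x3 * Y3))))) = C 1 1 1 1"
proof -
  have m: "ml3 (\<lambda>a b c. cop b (\<lambda>b1 b2. C a b1 b2 c))" by (intro ml3I lin ml4D[OF C])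
  have n: "ml2 (\<lambda>b c. C a b c d)" for a d using C by (simp add: ml2_def ml4_def)
  show ?thesis using phi_psi[OF m] by (simp only: cop_mult[OF n] cop_one[OF n] cop_psi_swap)
qed

lemma phi_psi_cop1:
  assumes C: "ml4 C"
  shows "phi (\<lambda>x1 x2 x3. cop x1 (\<lambda>x11 x12. psi (\<lambda>Y1 Y2 Y3. cop Y1 (\<lambda>Y11 Y12.
      C (x11 * Y11) (x12 * Y12) (x2 * Y2) (x3 * Y3))))) = C 1 1 1 1"
proof -
  have m: "ml3 (\<lambda>a b c. cop a (\<lambda>a1 a2. C a1 a2 b c))" by (intro ml3I lin ml4D[OF C])
  have n: "ml2 (\<lambda>a b. C a b c d)" for c d using C by (simp add: ml2_def ml4_def)
  show ?thesis using phi_psi[OF m] by (simp only: cop_mult[OF n] cop_one[OF n] cop_psi_swap)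
qed

text \<open>In \<open>psi_coassoc\<close> the two outermost coproduct factors are contracted by the
  invariance. For the form \<open>f(a, b \<beta> S(c))\<close> this is the known rule
  \<open>\<Delta>(h1) p (1 \<otimes> S(h2)) = p (h \<otimes> 1)\<close> for
  \<open>p = x1 \<otimes> x2 \<beta> S(x3)\<close>. The next three lemmas are its variants for the
  other side and for \<open>\<Phi>\<close>.\<close>

lemma psi_rinv:
  assumes C: "ml3 C" and r: "\<And>a. rinv (C a)"
  shows "cop h (\<lambda>h1 h2. cop h1 (\<lambda>h11 h12. psi (\<lambda>y1 y2 y3. C (h11 * y1) (h12 * y2) (h2 * y3)))) =
    psi (\<lambda>y1 y2 y3. C (y1 * h) y2 y3)"
proof -
  have l: "linK (\<lambda>x. C (a * x) b c)" for a b c by (intro lin ml3D[OF C])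
  have "psi (\<lambda>x1 x2 x3. cop h (\<lambda>h1 h2. cop h2 (\<lambda>h21 h22. C (x1 * h1) (x2 * h21) (x3 * h22)))) =
    psi (\<lambda>y1 y2 y3. C (y1 * h) y2 y3)"
    by (simp only: rinvD[OF r] cop_eps_right[OF l])
  then show ?thesis using psi_coassoc[OF C] by (simp only: cop_psi_swap)
qed

lemma psi_linv:
  assumes C: "ml3 C" and l: "\<And>c. linv (\<lambda>a b. C a b c)"
  shows "psi (\<lambda>y1 y2 y3. cop h (\<lambda>h1 h2. cop h2 (\<lambda>h21 h22. C (y1 * h1) (y2 * h21) (y3 * h22)))) =
    psi (\<lambda>y1 y2 y3. C y1 y2 (h * y3))"
proof -
  have l': "linK (\<lambda>x. C a b (x * c))" for a b c by (intro lin ml3D[OF C])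
  show ?thesis unfolding psi_coassoc[OF C] by (simp only: linvD[OF l] cop_eps_left[OF l'])
qed

text \<open>For the form \<open>f(a, S(b) \<alpha> c)\<close> this is the commutation rule of
  \<open>q_R\<close>, with \<open>S\<close> applied to its second leg so that no inverse antipode
  appears.\<close>

lemma phi_linv:
  assumes C: "ml3 C" and l: "\<And>a. linv (C a)"
  shows "phi (\<lambda>X1 X2 X3. cop h (\<lambda>h1 h2. cop h1 (\<lambda>h11 h12. C (X1 * h11) (X2 * h12) (X3 * h2)))) =
    phi (\<lambda>X1 X2 X3. C (h * X1) X2 X3)"
proof -
  have l': "linK (\<lambda>x. C (x * a) b c)" for a b c by (intro lin ml3D[OF C])
  show ?thesis unfolding coassoc[OF C] by (simp only: linvD[OF l] cop_eps_right[OF l'])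
qed

lemma phi_rinv:
  assumes C: "ml3 C" and l: "\<And>c. rinv (\<lambda>a b. C a b c)"
  shows "phi (\<lambda>X1 X2 X3. cop h (\<lambda>h1 h2. cop h2 (\<lambda>h21 h22. C (h1 * X1) (h21 * X2) (h22 * X3)))) =
    phi (\<lambda>X1 X2 X3. C X1 X2 (X3 * h))"
proof -
  have l': "linK (\<lambda>x. C a b (c * x))" for a b c by (intro lin ml3D[OF C])
  show ?thesis unfolding coassoc[OF C, symmetric] by (simp only: rinvD[OF l] cop_eps_left[OF l'])
qed

text \<open>Insert a factor killed by \<open>linv\<close>, apply the pentagon, and remove a factor killed by
  \<open>rinv\<close>.\<close>

lemma zigzag:
  assumes C: "ml4 C" and r: "\<And>a d. rinv (\<lambda>b c. C a b c d)" and l: "\<And>a b. linv (C a b)"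
  shows "phi (\<lambda>X1 X2 X3. cop X1 (\<lambda>X11 X12. psi (\<lambda>s1 s2 s3. C (X11 * s1) (X12 * s2) (X2 * s3) X3))) =
    phi (\<lambda>A1 A2 A3. C 1 A1 A2 A3)"
proof -
  \<comment> \<open>\<open>D\<close> has \<open>\<Phi>\<^sup>-\<^sup>1 \<otimes> 1\<close> built in
    on the right. It cancels the factor \<open>\<Phi> \<otimes> 1\<close> of the pentagon
    (\<open>D2\<close>), while a factor \<open>(id \<otimes> id \<otimes> \<Delta>)(\<Phi>)\<close>
    on the left is invisible (\<open>D1\<close>). For \<open>f(a, b \<beta> S(c) \<alpha> d)\<close>
    the lemma contains the known relation
    \<open>\<Delta>(q1) p (1 \<otimes> S(q2)) = 1 \<otimes> 1\<close>.\<close>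
  define D where "D = (\<lambda>a b c d. psi (\<lambda>s1 s2 s3. C (a * s1) (b * s2) (c * s3) d))"
  have D: "ml4 D" unfolding D_def by (intro ml4I lin ml4D[OF C])
  have D1: "phi (\<lambda>Y1 Y2 Y3. cop Y3 (\<lambda>Y31 Y32. D (Y1 * a) (Y2 * b) (Y31 * c) (Y32 * d))) = D a b c d"
    for a b c d
  proof -
    have m: "ml2 (\<lambda>x y. psi (\<lambda>s1 s2 s3. C (x * (a * s1)) (y * (b * s2)) (c * s3) d))"
      by (intro ml2I lin ml4D[OF C])
    show ?thesis
      unfolding D_def
      using phi_eps3[OF m] by (simp only: cop_psi_swap mult.assoc linvD[OF l] psi_cmult mult_1_left)
  qed
  have D2: "phi (\<lambda>Z1 Z2 Z3. D (a * Z1) (b * (b' * Z2)) (c * (c' * Z3)) d) = C a (b * b') (c * c') d" for a b b' c c' d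
  proof -
    have m: "ml3 (\<lambda>x y z. C (a * x) (b * (b' * y)) (c * (c' * z)) d)" by (intro ml3I lin ml4D[OF C])
    show ?thesis unfolding D_def using phi_psi[OF m] by (simp only: mult.assoc mult_1_right)
  qed
  have m: "ml2 (\<lambda>x y. C x a b (c * y))" for a b c by (intro ml2I lin ml4D[OF C])
  have "phi (\<lambda>X1 X2 X3. cop X1 (\<lambda>X11 X12. D X11 X12 X2 X3)) =
    phi (\<lambda>X1 X2 X3. cop X1 (\<lambda>X11 X12. phi (\<lambda>Y1 Y2 Y3. cop Y3 (\<lambda>Y31 Y32.
      D (Y1 * X11) (Y2 * X12) (Y31 * X2) (Y32 * X3)))))"
    by (simp only: D1)
  also have "\<dots> = phi (\<lambda>Y1 Y2 Y3. cop Y3 (\<lambda>Y31 Y32. phi (\<lambda>X1 X2 X3. cop X1 (\<lambda>X11 X12.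
      D (Y1 * X11) (Y2 * X12) (Y31 * X2) (Y32 * X3)))))"
    unfolding cop_phi_swap by (subst phi_phi_swap, subst cop_cop_swap) (rule refl)
  also have "\<dots> = phi (\<lambda>A1 A2 A3. phi (\<lambda>B1 B2 B3. cop B2 (\<lambda>B21 B22. phi (\<lambda>Z1 Z2 Z3.
       D (B1 * Z1) (A1 * (B21 * Z2)) (A2 * (B22 * Z3)) (A3 * B3)))))"
    by (rule pentagon[OF D, symmetric])
  also have "\<dots> = phi (\<lambda>A1 A2 A3. phi (\<lambda>B1 B2 B3. eps Q B2 * C B1 A1 A2 (A3 * B3)))"
    by (simp only: D2 rinvD[OF r])
  also have "\<dots> = phi (\<lambda>A1 A2 A3. C 1 A1 A2 A3)"
    by (simp only: phi_eps2[OF m] mult_1_right)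
  finally show ?thesis unfolding D_def .
qed

text \<open>Solved for the two factors on the left, the pentagon has \<open>(\<Delta> \<otimes> id
  \<otimes> id)(\<Phi>) (\<Phi>\<^sup>-\<^sup>1 \<otimes> 1) (id \<otimes> \<Delta> \<otimes>
  id)(\<Phi>\<^sup>-\<^sup>1)\<close> on the right. The first of these factors multiplies slots one
  and two from the left by a coproduct, so the invariance together with \<open>phi_eps1\<close>
  removes it.\<close>

lemma pentagon_linv:
  assumes C: "ml4 C" and l: "\<And>c d. linv (\<lambda>a b. C a b c d)"
  shows "psi (\<lambda>x1 x2 x3. cop x3 (\<lambda>x31 x32. phi (\<lambda>X1 X2 X3. C x1 (x2 * X1) (x31 * X2) (x32 * X3)))) =
    psi (\<lambda>u1 u2 u3. psi (\<lambda>s1 s2 s3. cop s2 (\<lambda>s21 s22. C (u1 * s1) (u2 * s21) (u3 * s22) s3)))"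
proof -
  define D where "D = (\<lambda>a b c d. psi (\<lambda>u1 u2 u3. psi (\<lambda>s1 s2 s3. cop s2 (\<lambda>s21 s22.
    C (a * (u1 * s1)) (b * (u2 * s21)) (c * (u3 * s22)) (d * s3)))))"
  have D: "ml4 D" unfolding D_def by (intro ml4I lin ml4D[OF C])
  define E where "E = (\<lambda>a b c d. phi (\<lambda>T1 T2 T3. cop T1 (\<lambda>T11 T12. D (a * T11) (b * T12) (c * T2) (d * T3))))"
  have E: "ml4 E" unfolding E_def by (intro ml4I lin ml4D[OF D])
  have D': "ml4 (\<lambda>a' b' c' d'. D (a * a') (b * b') (c * c') (d * d'))" for a b c d by (intro ml4I lin ml4D[OF D])
  have "D 1 1 1 1 = E 1 1 1 1"
  proof -
    have m: "ml2 (\<lambda>c d. D 1 1 c d)" by (intro ml2I lin ml4D[OF D])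
    have *: "cop T1 (\<lambda>T11 T12. D T11 T12 c d) = eps Q T1 * D 1 1 c d" for T1 c d
      unfolding D_def mult_1_left
      by (simp only: cop_psi_swap cop_cop_swap[of T1] linvD[OF l] psi_cmult[symmetric] cop_cmult[symmetric])
    show ?thesis unfolding E_def mult_1_left * using phi_eps1[OF m] by simp
  qed
  also have "\<dots> = psi (\<lambda>x1 x2 x3. cop x3 (\<lambda>x31 x32. phi (\<lambda>Y1 Y2 Y3. cop Y3 (\<lambda>Y31 Y32.
      E (x1 * Y1) (x2 * Y2) (x31 * Y31) (x32 * Y32)))))"
    by (rule psi_phi_cop3[OF E, symmetric])
  also have "\<dots> = psi (\<lambda>x1 x2 x3. cop x3 (\<lambda>x31 x32. phi (\<lambda>A1 A2 A3. phi (\<lambda>B1 B2 B3. cop B2 (\<lambda>B21 B22. phi (\<lambda>Z1 Z2 Z3.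
       D (x1 * (B1 * Z1)) (x2 * (A1 * (B21 * Z2))) (x31 * (A2 * (B22 * Z3))) (x32 * (A3 * B3))))))))"
    unfolding E_def using pentagon[OF D'] by (simp only: mult.assoc)
  also have "\<dots> = psi (\<lambda>x1 x2 x3. cop x3 (\<lambda>x31 x32. phi (\<lambda>A1 A2 A3. phi (\<lambda>B1 B2 B3. cop B2 (\<lambda>B21 B22.
      psi (\<lambda>s1 s2 s3. cop s2 (\<lambda>s21 s22.
       C (x1 * (B1 * s1)) (x2 * (A1 * (B21 * s21))) (x31 * (A2 * (B22 * s22))) (x32 * (A3 * (B3 * s3)))))))))) "
  proof -
    have *: "phi (\<lambda>Z1 Z2 Z3. D (a * Z1) (b * Z2) (c * Z3) d) =
      psi (\<lambda>s1 s2 s3. cop s2 (\<lambda>s21 s22. C (a * s1) (b * s21) (c * s22) (d * s3)))" for a b c d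
    proof -
      have m: "ml3 (\<lambda>x y z. psi (\<lambda>s1 s2 s3. cop s2 (\<lambda>s21 s22.
          C (a * (x * s1)) (b * (y * s21)) (c * (z * s22)) (d * s3))))" by (intro ml3I lin ml4D[OF C])
      show ?thesis unfolding D_def using phi_psi[OF m] by (simp only: mult.assoc mult_1_left)
    qed
    show ?thesis using *[of "_ * _" "_ * (_ * _)" "_ * (_ * _)"] by (simp only: mult.assoc)
  qed
  also have "\<dots> = psi (\<lambda>x1 x2 x3. cop x3 (\<lambda>x31 x32. phi (\<lambda>X1 X2 X3. C x1 (x2 * X1) (x31 * X2) (x32 * X3))))"
  proof -
    have C': "ml4 (\<lambda>a' b' c' d'. C (a * a') (b * b') (c * c') (d * d'))" for a b c d by (intro ml4I lin ml4D[OF C])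
    show ?thesis using phi_psi_cop2[OF C', of _ "_ * _" "_ * _" "_ * _"] by (simp only: mult.assoc mult_1_right)
  qed
  finally show ?thesis unfolding D_def mult_1_left by (rule sym)
qed

text \<open>Solved for the left side, the pentagon gives \<open>(\<Phi> \<otimes> 1) (\<Delta>
  \<otimes> id \<otimes> id)(\<Phi>\<^sup>-\<^sup>1) (id \<otimes> id \<otimes>
  \<Delta>)(\<Phi>\<^sup>-\<^sup>1)\<close>. The last factor multiplies slots three and four from
  the right by a coproduct and is removed by the invariance and \<open>psi_eps3\<close>.\<close>

lemma pentagon_rinv:
  assumes C: "ml4 C" and r: "\<And>a b. rinv (C a b)"
  shows "psi (\<lambda>u1 u2 u3. cop u2 (\<lambda>u21 u22. psi (\<lambda>y1 y2 y3. C u1 (u21 * y1) (u22 * y2) (u3 * y3)))) =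
    phi (\<lambda>X1 X2 X3. psi (\<lambda>t1 t2 t3. cop t1 (\<lambda>t11 t12. C (X1 * t11) (X2 * t12) (X3 * t2) t3)))"
proof -
  define D where "D = (\<lambda>a b c d. psi (\<lambda>t1 t2 t3. cop t1 (\<lambda>t11 t12. psi (\<lambda>r1 r2 r3. cop r3 (\<lambda>r31 r32.
    C (a * (t11 * r1)) (b * (t12 * r2)) (c * (t2 * r31)) (d * (t3 * r32)))))))"
  have D: "ml4 D" unfolding D_def by (intro ml4I lin ml4D[OF C])
  have D': "ml4 (\<lambda>a' b' c' d'. D (a * a') (b * b') (c * c') (d * d'))" for a b c d by (intro ml4I lin ml4D[OF D])
  have Dr: "D a b c d = psi (\<lambda>t1 t2 t3. cop t1 (\<lambda>t11 t12. C (a * t11) (b * t12) (c * t2) (d * t3)))" for a b c d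
  proof -
    have m: "ml2 (\<lambda>x y. C (a * (t11 * x)) (b * (t12 * y)) (c * t2) (d * t3))" for t11 t12 t2 t3
      by (intro ml2I lin ml4D[OF C])
    show ?thesis unfolding D_def mult.assoc[symmetric] rinvD[OF r]
      using psi_eps3[OF m] by (simp only: mult.assoc mult_1_right)
  qed
  have "phi (\<lambda>X1 X2 X3. psi (\<lambda>t1 t2 t3. cop t1 (\<lambda>t11 t12. C (X1 * t11) (X2 * t12) (X3 * t2) t3))) =
    phi (\<lambda>X1 X2 X3. D X1 X2 X3 1)"
    by (simp only: Dr mult_1_left)
  also have "\<dots> = psi (\<lambda>u1 u2 u3. cop u2 (\<lambda>u21 u22. psi (\<lambda>y1 y2 y3. phi (\<lambda>A1 A2 A3. phi (\<lambda>B1 B2 B3. cop B2 (\<lambda>B21 B22.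
      phi (\<lambda>Z1 Z2 Z3. D (u1 * (B1 * Z1)) (u21 * (y1 * (A1 * (B21 * Z2)))) (u22 * (y2 * (A2 * (B22 * Z3)))) (u3 * (y3 * (A3 * B3))))))))))"
  proof -
    define E where "E = (\<lambda>a b c d. phi (\<lambda>Z1 Z2 Z3. D (a * Z1) (b * Z2) (c * Z3) d))"
    have E: "ml4 E" unfolding E_def by (intro ml4I lin ml4D[OF D])
    have 1: "psi (\<lambda>y1 y2 y3. phi (\<lambda>A1 A2 A3. E a (b * (y1 * (A1 * b'))) (c * (y2 * (A2 * c'))) (d * (y3 * (A3 * d'))))) =
        E a (b * b') (c * c') (d * d')" for a b b' c c' d d'
    proof -
      have m: "ml3 (\<lambda>x y z. E a (b * (x * b')) (c * (y * c')) (d * (z * d')))" by (intro ml3I lin ml4D[OF E])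
      show ?thesis using psi_phi[OF m] by (simp only: mult.assoc mult_1_left)
    qed
    have "psi (\<lambda>u1 u2 u3. cop u2 (\<lambda>u21 u22. psi (\<lambda>y1 y2 y3. phi (\<lambda>A1 A2 A3. phi (\<lambda>B1 B2 B3. cop B2 (\<lambda>B21 B22.
      E (u1 * B1) (u21 * (y1 * (A1 * B21))) (u22 * (y2 * (A2 * B22))) (u3 * (y3 * (A3 * B3))))))))) =
      psi (\<lambda>u1 u2 u3. cop u2 (\<lambda>u21 u22. phi (\<lambda>B1 B2 B3. cop B2 (\<lambda>B21 B22. psi (\<lambda>y1 y2 y3. phi (\<lambda>A1 A2 A3.
      E (u1 * B1) (u21 * (y1 * (A1 * B21))) (u22 * (y2 * (A2 * B22))) (u3 * (y3 * (A3 * B3)))))))))"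
      by (subst phi_phi_swap, simp only: cop_phi_swap cop_psi_swap psi_phi_swap)
    also have "\<dots> = E 1 1 1 1"
      unfolding 1 by (rule psi_phi_cop2[OF E])
    finally show ?thesis unfolding E_def by (simp only: mult.assoc mult_1_left)
  qed
  also have "\<dots> = psi (\<lambda>u1 u2 u3. cop u2 (\<lambda>u21 u22. psi (\<lambda>y1 y2 y3.
      phi (\<lambda>A1 A2 A3. cop A3 (\<lambda>A31 A32. phi (\<lambda>B1 B2 B3. cop B1 (\<lambda>B11 B12.
       D (u1 * (A1 * B11)) (u21 * (y1 * (A2 * B12))) (u22 * (y2 * (A31 * B2))) (u3 * (y3 * (A32 * B3))))))))))"
    using pentagon[OF D', of _ "_ * _" "_ * _" "_ * _"] by (simp only: mult.assoc)
  also have "\<dots> = psi (\<lambda>u1 u2 u3. cop u2 (\<lambda>u21 u22. psi (\<lambda>y1 y2 y3. C u1 (u21 * y1) (u22 * y2) (u3 * y3))))"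
  proof -
    have "phi (\<lambda>A1 A2 A3. cop A3 (\<lambda>A31 A32. phi (\<lambda>B1 B2 B3. cop B1 (\<lambda>B11 B12.
       D (a * (A1 * B11)) (b * (A2 * B12)) (c * (A31 * B2)) (d * (A32 * B3)))))) = C a b c d" for a b c d
    proof -
      define E where "E = (\<lambda>a b c d. psi (\<lambda>r1 r2 r3. cop r3 (\<lambda>r31 r32. C (a * r1) (b * r2) (c * r31) (d * r32))))"
      have E': "ml4 (\<lambda>x y z w. E (a * (a' * x)) (b * (b' * y)) (c * (c' * z)) (d * (d' * w)))" for a' b' c' d'
        unfolding E_def by (intro ml4I lin ml4D[OF C])
      have C': "ml4 (\<lambda>a' b' c' d'. C (a * a') (b * b') (c * c') (d * d'))" by (intro ml4I lin ml4D[OF C])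
      have DE: "D a b c d = psi (\<lambda>t1 t2 t3. cop t1 (\<lambda>t11 t12. E (a * t11) (b * t12) (c * t2) (d * t3)))" for a b c d
        unfolding D_def E_def by (simp only: mult.assoc)
      have "phi (\<lambda>B1 B2 B3. cop B1 (\<lambda>B11 B12.
         D (a * (A1 * B11)) (b * (A2 * B12)) (c * (A31 * B2)) (d * (A32 * B3)))) =
         E (a * A1) (b * A2) (c * A31) (d * A32)" for A1 A2 A31 A32
        unfolding DE using phi_psi_cop1[OF E', of A1 A2 A31 A32] by (simp only: mult.assoc mult_1_right)
      then show ?thesis
        unfolding E_def using phi_psi_cop3[OF C'] by (simp only: mult.assoc mult_1_right)
    qed
    from this[of _ "_ * _" "_ * _" "_ * _"] show ?thesis by (simp only: mult.assoc)
  qed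
  finally show ?thesis by (rule sym)
qed

end

section \<open>Surjectivity of the antipode\<close>

locale quasi_hopf =
  fixes Q :: "('k::field, 'h::ring_1, 'z) qhopf_scheme"
  assumes quasi_hopf_algebra: "quasi_hopf_algebra Q"
begin

sublocale quasi_bialg Q
  using quasi_hopf_algebra by unfold_locales (simp add: quasi_hopf_algebra_def)

abbreviation S :: "'h \<Rightarrow> 'h" where "S \<equiv> antipode Q"
abbreviation \<alpha> :: 'h where "\<alpha> \<equiv> alpha Q"
abbreviation \<beta> :: 'h where "\<beta> \<equiv> beta Q"

lemmas qh = quasi_hopf_algebra[unfolded quasi_hopf_algebra_def]

lemma linH_S [lin]: "linH f \<Longrightarrow> linH (\<lambda>x. S (f x))"
  by (rule linH_comp[of S]) (use qh in blast)

lemma S_mult: "S (a * b) = S b * S a"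
  using qh by blast

lemma S_one [simp]: "S 1 = 1"
  using qh by blast

lemma linK_zero: "linK f \<Longrightarrow> f 0 = 0"
proof -
  assume "linK f"
  then have "f (0 + 0) = f 0 + f 0" unfolding linK_iff by blast
  then show ?thesis by (simp only: add_0_left add_cancel_right_right)
qed

lemma linK_add: "linK f \<Longrightarrow> f (x + y) = f x + f y"
  unfolding linK_iff by blast

lemma linK_phi_out: "linK f \<Longrightarrow> f (phi C) = phi (\<lambda>x y z. f (C x y z))"
  by (rule phi_hom[of f, OF linK_zero[of f] linK_add[of f]])

lemma linK_psi_out: "linK f \<Longrightarrow> f (psi C) = psi (\<lambda>x y z. f (C x y z))"
  by (rule psi_hom[of f, OF linK_zero[of f] linK_add[of f]])

lemma linK_cop_out: "linK f \<Longrightarrow> f (cop h B) = cop h (\<lambda>x y. f (B x y))"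
  by (rule cop_hom[of f, OF linK_zero[of f] linK_add[of f]])

lemma antipode_left: "linK f \<Longrightarrow> cop h (\<lambda>h1 h2. f (S h1 * (\<alpha> * h2))) = eps Q h * f \<alpha>"
proof -
  assume f: "linK f"
  have "cop h (\<lambda>h1 h2. S h1 * \<alpha> * h2) = hscale Q (eps Q h) \<alpha>"
    unfolding cop_def using qh by blast
  from arg_cong[OF this, of f] show ?thesis
    by (simp add: linK_cop_out[OF f] linK_hscale[OF f] mult.assoc)
qed

lemma antipode_right: "linK f \<Longrightarrow> cop h (\<lambda>h1 h2. f (h1 * (\<beta> * S h2))) = eps Q h * f \<beta>"
proof -
  assume f: "linK f"
  have "cop h (\<lambda>h1 h2. h1 * \<beta> * S h2) = hscale Q (eps Q h) \<beta>"
    unfolding cop_def using qh by blast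
  from arg_cong[OF this, of f] show ?thesis
    by (simp add: linK_cop_out[OF f] linK_hscale[OF f] mult.assoc)
qed

lemma phi_antipode: "linK f \<Longrightarrow> phi (\<lambda>X1 X2 X3. f (X1 * (\<beta> * (S X2 * (\<alpha> * X3))))) = f 1"
proof -
  assume f: "linK f"
  have "phi (\<lambda>X1 X2 X3. X1 * \<beta> * S X2 * \<alpha> * X3) = 1"
    unfolding phi_def using qh by blast
  from arg_cong[OF this, of f] show ?thesis
    by (simp add: linK_phi_out[OF f] mult.assoc)
qed

lemma psi_antipode: "linK f \<Longrightarrow> psi (\<lambda>x1 x2 x3. f (S x1 * (\<alpha> * (x2 * (\<beta> * S x3))))) = f 1"
proof -
  assume f: "linK f"
  have "psi (\<lambda>x1 x2 x3. S x1 * \<alpha> * x2 * \<beta> * S x3) = 1"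
    unfolding psi_def using qh by blast
  from arg_cong[OF this, of f] show ?thesis
    by (simp add: linK_psi_out[OF f] mult.assoc)
qed

lemma linK_separates:
  assumes "\<And>f. linK f \<Longrightarrow> f x = f y"
  shows "x = y"
proof (rule ccontr)
  assume "x \<noteq> y"
  interpret V: vector_space "hscale Q" by (rule vector_space_H)
  interpret vector_space_pair "hscale Q" "(*) :: 'k \<Rightarrow> 'k \<Rightarrow> 'k"
    by unfold_locales (auto simp: algebra_simps)
  have "V.independent {x - y}" using \<open>x \<noteq> y\<close> by (simp add: V.dependent_single)
  then obtain g where g: "linK g" "g (x - y) = (1::'k)"
    using linear_independent_extend[of "{x - y}" "\<lambda>_. 1"] by auto
  have "g x = g ((x - y) + y)" by simp
  also have "\<dots> = g (x - y) + g y" using g(1) unfolding linK_iff by blast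
  finally show False using g(2) assms[OF g(1)] by simp
qed

text \<open>Both sides are the two sides of \<open>coassoc\<close> after a contraction, one by
  \<open>linv\<close> and one by \<open>rinv\<close>. The model is
  \<open>X1 \<beta> S(X2) \<alpha> X3\<close>, through which \<open>h\<close> passes from left to
  right.\<close>

lemma phi_balanced:
  assumes C: "ml3 C" and r: "\<And>c. rinv (\<lambda>a b. C a b c)" and l: "\<And>a. linv (C a)"
  shows "phi (\<lambda>X1 X2 X3. C (h * X1) X2 X3) = phi (\<lambda>X1 X2 X3. C X1 X2 (X3 * h))"
  using phi_linv[OF C l] phi_rinv[OF C r] coassoc[OF C] by simp

text \<open>The antipode is an epimorphism for algebra maps into any algebra structure on \<open>'h\<close>, which is
  needed both for the given product and for its opposite.\<close>

lemma antipode_epi: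
  fixes m :: "'h \<Rightarrow> 'h \<Rightarrow> 'h" and \<pi> \<rho> :: "'h \<Rightarrow> 'h"
  assumes m: "\<And>c. linH (\<lambda>x. m x c)" "\<And>c. linH (m c)" "\<And>x y z. m (m x y) z = m x (m y z)"
      "\<And>x. m 1 x = x" "\<And>x. m x 1 = x"
    and \<pi>: "linH \<pi>" "\<And>a b. \<pi> (a * b) = m (\<pi> a) (\<pi> b)" "\<pi> 1 = 1"
    and \<rho>: "linH \<rho>" "\<And>a b. \<rho> (a * b) = m (\<rho> a) (\<rho> b)" "\<rho> 1 = 1"
    and eq: "\<And>a. \<pi> (S a) = \<rho> (S a)"
  shows "\<pi> = \<rho>"
proof -
  have ml: "linH f \<Longrightarrow> linH (\<lambda>x. m (f x) c)" "linH f \<Longrightarrow> linH (\<lambda>x. m c (f x))"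
    "linH f \<Longrightarrow> linH (\<lambda>x. \<pi> (f x))" "linH f \<Longrightarrow> linH (\<lambda>x. \<rho> (f x))" for f c
    by (rule linH_comp[OF m(1)] linH_comp[OF m(2)] linH_comp[OF \<pi>(1)] linH_comp[OF \<rho>(1)], assumption)+
  \<comment> \<open>If \<open>\<pi>\<close> and \<open>\<rho>\<close> were equal, \<open>E\<close>
    would be the image of \<open>X1 \<beta> S(X2) \<alpha> X3 = 1\<close>. The plan is to prove
    \<open>E = 1\<close> without that assumption, from agreement on the image of \<open>S\<close>
    alone.\<close>
  define E where "E = phi (\<lambda>X1 X2 X3. m (\<pi> (X1 * (\<beta> * S X2))) (\<rho> (\<alpha> * X3)))"
  have fE: "f (m a (m E b)) = phi (\<lambda>X1 X2 X3. f (m a (m (m (\<pi> (X1 * (\<beta> * S X2))) (\<rho> (\<alpha> * X3))) b)))"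
    if f: "linK f" for f a b
    unfolding E_def by (rule linK_phi_out[of "\<lambda>x. f (m a (m x b))"]) (intro linK_comp[OF f] ml lin)
  have rinv: "rinv (\<lambda>a b. f (m (\<pi> (d * (a * (\<beta> * S b)))) c))" if f: "linK f" for f c d
    unfolding rinv_def
  proof (intro allI)
    fix h a b
    show "cop h (\<lambda>h1 h2. f (m (\<pi> (d * (a * h1 * (\<beta> * S (b * h2))))) c)) =
        eps Q h * f (m (\<pi> (d * (a * (\<beta> * S b)))) c)"
    proof -
      have l: "linK (\<lambda>x. f (m (\<pi> (d * (a * (x * S b)))) c))" by (intro linK_comp[OF f] ml lin)
      show ?thesis using antipode_right[OF l, of h] by (simp add: S_mult mult.assoc)
    qed
  qed
  have linv: "linv (\<lambda>b c. f (m (\<pi> (a * S b)) (\<rho> (\<alpha> * c))))" if f: "linK f" for f a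
    unfolding linv_def
  proof (intro allI)
    fix h b c
    show "cop h (\<lambda>h1 h2. f (m (\<pi> (a * S (h1 * b))) (\<rho> (\<alpha> * (h2 * c))))) =
        eps Q h * f (m (\<pi> (a * S b)) (\<rho> (\<alpha> * c)))"
    proof -
      have l: "linK (\<lambda>x. f (m (\<pi> (a * S b)) (\<rho> (x * c))))" by (intro linK_comp[OF f] ml lin)
      show ?thesis using antipode_left[OF l, of h] by (simp add: S_mult \<pi>(2) \<rho>(2) eq m(3))
    qed
  qed
  \<comment> \<open>\<open>phi_balanced\<close> applies although two different maps occur: the left
    invariance only needs \<open>\<pi>(S(b))\<close> to be rewritten as
    \<open>\<rho>(S(b))\<close>.\<close>
  have A: "m E (\<rho> h) = m (\<pi> h) E" for h
  proof (rule linK_separates)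
    fix f assume f: "linK f"
    define C where "C = (\<lambda>a b c. f (m (\<pi> (a * (\<beta> * S b))) (\<rho> (\<alpha> * c))))"
    have C: "ml3 C" unfolding C_def by (intro ml3I linK_comp[OF f] ml lin)
    have "f (m E (\<rho> h)) = phi (\<lambda>X1 X2 X3. C X1 X2 (X3 * h))"
      using fE[OF f, of 1 "\<rho> h"] by (simp add: m \<rho> C_def)
    also have "\<dots> = phi (\<lambda>X1 X2 X3. C (h * X1) X2 X3)"
      using rinv[OF f, of 1] linv[OF f, of "_ * \<beta>"]
      by (intro phi_balanced[OF C, symmetric]) (simp_all add: C_def mult.assoc)
    also have "\<dots> = f (m (\<pi> h) E)"
      using fE[OF f, of "\<pi> h" 1] by (simp add: m \<pi> C_def)
    finally show "f (m E (\<rho> h)) = f (m (\<pi> h) E)" .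
  qed
  \<comment> \<open>The unit \<open>S(s1) \<alpha> s2 \<beta> S(s3)\<close> is inserted under
    \<open>\<pi>\<close>. A trivial \<open>\<Phi>\<close> with \<open>\<epsilon>\<close> on its
    first leg is added, and left invariance in the first two slots turns
    \<open>\<epsilon>(X1)\<close> into \<open>\<Delta>(X1)\<close>, which is the shape of
    \<open>zigzag\<close>.\<close>
  have B: "\<rho> \<alpha> = m (\<pi> \<alpha>) E"
  proof (rule linK_separates)
    fix f assume f: "linK f"
    define C where "C = (\<lambda>a b c d. f (m (\<pi> (S a * (\<alpha> * (b * (\<beta> * S c))))) (\<rho> (\<alpha> * d))))"
    have C: "ml4 C" unfolding C_def by (intro ml4I linK_comp[OF f] ml lin)
    have r: "rinv (\<lambda>b c. C a b c d)" for a d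
      using rinv[OF f, of "S a * \<alpha>"] by (simp add: C_def mult.assoc)
    have l: "linv (C a b)" for a b
      using linv[OF f, of "S a * (\<alpha> * (b * \<beta>))"] by (simp add: C_def mult.assoc)
    have l': "linv (\<lambda>a b. C a b c d)" for c d
      unfolding linv_def
    proof (intro allI)
      fix h a b
      show "cop h (\<lambda>h1 h2. C (h1 * a) (h2 * b) c d) = eps Q h * C a b c d"
      proof -
        have l: "linK (\<lambda>x. f (m (\<pi> (S a * (x * (b * (\<beta> * S c))))) (\<rho> (\<alpha> * d))))" by (intro linK_comp[OF f] ml lin)
        show ?thesis using antipode_left[OF l, of h] by (simp add: C_def S_mult mult.assoc)
      qed
    qed
    have m2: "ml2 (\<lambda>x y. psi (\<lambda>s1 s2 s3. C s1 s2 (x * s3) y))" by (intro ml2I lin ml4D[OF C])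
    have "f (\<rho> \<alpha>) = psi (\<lambda>s1 s2 s3. C s1 s2 s3 1)"
    proof -
      have l: "linK (\<lambda>x. f (m (\<pi> x) (\<rho> \<alpha>)))" by (intro linK_comp[OF f] ml lin)
      show ?thesis using psi_antipode[OF l] by (simp add: C_def m \<pi>(3))
    qed
    also have "\<dots> = phi (\<lambda>X1 X2 X3. eps Q X1 * psi (\<lambda>s1 s2 s3. C s1 s2 (X2 * s3) X3))"
      using phi_eps1[OF m2] by simp
    also have "\<dots> = phi (\<lambda>X1 X2 X3. cop X1 (\<lambda>X11 X12. psi (\<lambda>s1 s2 s3. C (X11 * s1) (X12 * s2) (X2 * s3) X3)))"
      by (simp only: cop_psi_swap linvD[OF l'] psi_cmult)
    also have "\<dots> = phi (\<lambda>A1 A2 A3. C 1 A1 A2 A3)"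
      by (rule zigzag[OF C r l])
    also have "\<dots> = f (m (\<pi> \<alpha>) E)"
      using fE[OF f, of "\<pi> \<alpha>" 1] by (simp add: C_def m \<pi>)
    finally show "f (\<rho> \<alpha>) = f (m (\<pi> \<alpha>) E)" .
  qed
  have "1 = E"
  \<comment> \<open>Under \<open>\<rho>\<close>, the unit
    \<open>S(x1) \<alpha> x2 \<beta> S(x3)\<close> is converted factor by factor to
    \<open>\<pi>\<close>: \<open>S(x1)\<close> by agreement on the image of \<open>S\<close>,
    \<open>\<alpha>\<close> by \<open>B\<close> at the cost of an \<open>E\<close>, and
    \<open>A\<close> carries this \<open>E\<close> to the right end.\<close>
  proof (rule linK_separates)
    fix f assume f: "linK f"
    have "f 1 = psi (\<lambda>x1 x2 x3. f (\<rho> (S x1 * (\<alpha> * (x2 * (\<beta> * S x3))))))"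
      using psi_antipode[OF linK_comp[OF f \<rho>(1)]] by (simp add: \<rho>(3))
    also have "\<dots> = psi (\<lambda>x1 x2 x3. f (m (\<pi> (S x1)) (m (\<pi> \<alpha>) (m E (\<rho> (x2 * (\<beta> * S x3)))))))"
      by (simp only: \<rho>(2)[of "S _"] \<rho>(2)[of \<alpha>] B eq m(3))
    also have "\<dots> = psi (\<lambda>x1 x2 x3. f (m (\<pi> (S x1 * (\<alpha> * (x2 * (\<beta> * S x3))))) E))"
      by (simp only: A m(3) \<pi>(2))
    also have "\<dots> = f E"
    proof -
      have l: "linK (\<lambda>x. f (m (\<pi> x) E))" by (intro linK_comp[OF f] ml lin)
      show ?thesis using psi_antipode[OF l] by (simp add: m \<pi>(3))
    qed
    finally show "f 1 = f E" .
  qed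
  then have "m 1 (\<rho> h) = m (\<pi> h) 1" for h using A[of h] by simp
  then show ?thesis by (intro ext) (simp add: m(4,5))
qed

text \<open>\<open>\<pi> \<circ> S\<close> and \<open>\<rho> \<circ> S\<close> reverse products, so
  they are algebra maps into the opposite algebra and agree there by \<open>antipode_epi\<close>. A
  second application, now for the given product, removes the other \<open>S\<close>.\<close>

lemma antipode_square_epi:
  assumes \<pi>: "linH \<pi>" "\<And>a b. \<pi> (a * b) = \<pi> a * \<pi> b" "\<pi> 1 = 1"
    and \<rho>: "linH \<rho>" "\<And>a b. \<rho> (a * b) = \<rho> a * \<rho> b" "\<rho> 1 = 1"
    and eq: "\<And>a. \<pi> (S (S a)) = \<rho> (S (S a))"
  shows "\<pi> = \<rho>"
proof -
  have "(\<lambda>a. \<pi> (S a)) = (\<lambda>a. \<rho> (S a))"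
  proof (rule antipode_epi[where m = "\<lambda>x y. y * x"])
    show "linH (\<lambda>a. \<pi> (S a))" "linH (\<lambda>a. \<rho> (S a))"
      by (intro linH_comp[OF \<pi>(1)] linH_comp[OF \<rho>(1)] lin)+
  qed (simp_all add: \<pi>(2,3) \<rho>(2,3) S_mult eq mult.assoc linH_mult[OF linH_id])
  then have "\<pi> (S a) = \<rho> (S a)" for a by metis
  then show ?thesis
    by (intro antipode_epi[where m = "(*)"]) (simp_all add: \<pi> \<rho> mult.assoc linH_mult[OF linH_id])
qed

lemma surj_antipode:
  assumes "finite_dimensional_vector_space (hscale Q) Bs"
  shows "surj S"
proof -
  interpret V: finite_dimensional_vector_space "hscale Q" Bs by fact
  \<comment> \<open>Even powers of \<open>S\<close> are used because they preserve the order of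
    products.\<close>
  define \<sigma> where "\<sigma> n = ((\<lambda>x. S (S x)) ^^ n)" for n
  have \<sigma>_add: "\<sigma> (i + j) x = \<sigma> i (\<sigma> j x)" for i j x
    by (simp add: \<sigma>_def funpow_add)
  have \<sigma>_Suc: "\<sigma> (Suc n) x = \<sigma> n (S (S x))" for n x
    by (simp add: \<sigma>_def funpow_Suc_right del: funpow.simps)
  have \<sigma>_lin: "linH (\<sigma> n)" and \<sigma>_mult: "\<sigma> n (a * b) = \<sigma> n a * \<sigma> n b" and \<sigma>_one: "\<sigma> n 1 = 1" for n a b
  proof -
    show "linH (\<sigma> n)"
    proof (induction n)
      case 0 show ?case using linH_id by (simp add: \<sigma>_def id_def)
    next
      case (Suc n)
      have "\<sigma> (Suc n) = (\<lambda>x. \<sigma> n (S (S x)))" by (intro ext \<sigma>_Suc)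
      then show ?case by (simp only:) (intro linH_comp[OF Suc] lin)
    qed
    show "\<sigma> n (a * b) = \<sigma> n a * \<sigma> n b"
      by (induction n arbitrary: a b) (simp_all add: \<sigma>_Suc S_mult, simp add: \<sigma>_def)
    show "\<sigma> n 1 = 1"
      by (induction n) (simp_all add: \<sigma>_Suc, simp add: \<sigma>_def)
  qed
  have \<sigma>_addh: "\<sigma> n (x + y) = \<sigma> n x + \<sigma> n y" and \<sigma>_scale: "\<sigma> n (hscale Q c x) = hscale Q c (\<sigma> n x)" for n x y c
    using \<sigma>_lin[of n] unfolding linH_iff by blast+
  have \<sigma>_zero: "\<sigma> n 0 = 0" for n using \<sigma>_addh[of n 0 0] by simp
  have \<sigma>_diff: "\<sigma> n (x - y) = \<sigma> n x - \<sigma> n y" for n x y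
    using \<sigma>_addh[of n "x - y" y] by (simp add: algebra_simps)
  define K where "K n = {x. \<sigma> n x = 0}" for n
  have subR: "V.subspace (range (\<sigma> n))" for n
    unfolding V.subspace_def using \<sigma>_zero[of n]
    by (auto simp: \<sigma>_addh[symmetric] \<sigma>_scale[symmetric] intro: rangeI)
  have subK: "V.subspace (K n)" for n
    unfolding V.subspace_def by (auto simp: K_def \<sigma>_addh \<sigma>_scale \<sigma>_zero)
  have R_mono: "range (\<sigma> (i + j)) \<subseteq> range (\<sigma> i)" for i j
    by (auto simp: \<sigma>_add)
  have K_mono: "K j \<subseteq> K (i + j)" for i j
    by (auto simp: K_def \<sigma>_add \<sigma>_zero)
  \<comment> \<open>Both summands are non-increasing in \<open>n\<close>, so at a minimum of the sum
    the images and the kernels stabilise simultaneously.\<close>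
  define g where "g n = V.dim (range (\<sigma> n)) + (V.dimension - V.dim (K n))" for n
  obtain n where n: "\<And>j. g n \<le> g j"
    using ex_has_least_nat[of "\<lambda>_. True" 0 g] by blast
  \<comment> \<open>The successor keeps the minimality and makes the exponent positive, so that the
    image of \<open>\<tau>\<close> lies in the image of \<open>S\<close> at the end.\<close>
  define N where "N = Suc n"
  have dims: "V.dim (range (\<sigma> (i + j))) \<le> V.dim (range (\<sigma> i))" "V.dim (K j) \<le> V.dim (K (i + j))"
    "V.dim (K j) \<le> V.dimension" for i j
    by (intro V.dim_subset R_mono K_mono V.dim_subset_UNIV)+
  have "g N \<le> g n"
    unfolding N_def g_def using dims(1)[of n 1] dims(2)[of n 1] by simp
  then have min: "g N \<le> g (N + N)" using n[of "N + N"] by simp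
  have "V.dim (range (\<sigma> N)) \<le> V.dim (range (\<sigma> (N + N)))" "V.dim (K (N + N)) \<le> V.dim (K N)"
    using min dims(1)[of N N] dims(2)[of N N] dims(3)[of N] dims(3)[of "N + N"] unfolding g_def by linarith+
  then have R: "range (\<sigma> (N + N)) = range (\<sigma> N)" and KN: "K N = K (N + N)"
    using V.subspace_dim_equal[OF subR subR R_mono] V.subspace_dim_equal[OF subK subK K_mono] by blast+
  define \<tau> where "\<tau> = \<sigma> N"
  have ex: "\<exists>c. c \<in> range \<tau> \<and> \<tau> c = \<tau> h" for h
  proof -
    have "\<tau> h \<in> range (\<sigma> (N + N))" unfolding R \<tau>_def by blast
    then obtain d where "\<tau> h = \<sigma> (N + N) d" by blast
    then have "\<tau> (\<sigma> N d) = \<tau> h" by (simp only: \<tau>_def \<sigma>_add)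
    then show ?thesis unfolding \<tau>_def by blast
  qed
  have uniq: "c = d" if cd: "c \<in> range \<tau>" "d \<in> range \<tau>" "\<tau> c = \<tau> d" for c d
  proof -
    obtain x y where xy: "c = \<tau> x" "d = \<tau> y" using cd by auto
    have "x - y \<in> K (N + N)" using cd(3) by (simp add: K_def xy \<tau>_def \<sigma>_add \<sigma>_diff)
    then have "x - y \<in> K N" using KN by simp
    then show ?thesis by (simp add: K_def xy \<tau>_def \<sigma>_diff)
  qed
  \<comment> \<open>The Fitting projection onto the image of \<open>\<tau>\<close> along its kernel:
    existence comes from the stable image, uniqueness from the stable kernel. Since
    \<open>\<tau>\<close> is an algebra map, this description makes \<open>p\<close> one as
    well.\<close>
  define p where "p h = (THE c. c \<in> range \<tau> \<and> \<tau> c = \<tau> h)" for h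
  have p: "p h \<in> range \<tau>" "\<tau> (p h) = \<tau> h" for h
  proof -
    have "\<exists>!c. c \<in> range \<tau> \<and> \<tau> c = \<tau> h" using ex[of h] uniq by metis
    from theI'[OF this] show "p h \<in> range \<tau>" "\<tau> (p h) = \<tau> h" unfolding p_def by blast+
  qed
  have pI: "p h = c" if "c \<in> range \<tau>" "\<tau> c = \<tau> h" for h c
    using uniq[OF p(1) that(1)] that(2) p(2) by simp
  have p_lin: "linH p"
    unfolding linH_iff
  proof (intro conjI allI pI)
    show "p x + p y \<in> range \<tau>" for x y using V.subspace_add[OF subR p(1)[unfolded \<tau>_def] p(1)[unfolded \<tau>_def]]
      by (simp add: \<tau>_def)
    show "hscale Q c (p x) \<in> range \<tau>" for c x using V.subspace_scale[OF subR p(1)[unfolded \<tau>_def]]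
      by (simp add: \<tau>_def)
    show "\<tau> (p x + p y) = \<tau> (x + y)" for x y using p(2) by (simp add: \<tau>_def \<sigma>_addh)
    show "\<tau> (hscale Q c (p x)) = \<tau> (hscale Q c x)" for c x using p(2) by (simp add: \<tau>_def \<sigma>_scale)
  qed
  have p_mult: "p (a * b) = p a * p b" for a b
  proof (rule pI)
    obtain x y where "p a = \<tau> x" "p b = \<tau> y" using p(1) by (metis rangeE)
    then have "p a * p b = \<tau> (x * y)" by (simp add: \<tau>_def \<sigma>_mult)
    then show "p a * p b \<in> range \<tau>" by simp
    show "\<tau> (p a * p b) = \<tau> (a * b)" using p(2) by (simp add: \<tau>_def \<sigma>_mult)
  qed
  have p_one: "p 1 = 1"
  proof (rule pI)
    have "\<tau> 1 = 1" unfolding \<tau>_def by (rule \<sigma>_one)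
    then show "1 \<in> range \<tau>" by (metis rangeI)
  qed (rule refl)
  \<comment> \<open>One \<open>S\<^sup>2\<close> is cancelled at a time:
    \<open>p \<circ> \<sigma> j\<close> and \<open>\<sigma> j\<close> are algebra maps that agree
    after composition with \<open>S\<^sup>2\<close>.\<close>
  have cancel: "(\<forall>x. p (\<sigma> j x) = \<sigma> j x) \<Longrightarrow> p = (\<lambda>x. x)" for j
  proof (induction j)
    case 0 then show ?case by (auto simp: \<sigma>_def)
  next
    case (Suc j)
    have "(\<lambda>x. p (\<sigma> j x)) = \<sigma> j"
      using Suc.prems
      by (intro antipode_square_epi linH_comp[OF p_lin] \<sigma>_lin)
        (simp_all add: p_mult p_one \<sigma>_mult \<sigma>_one \<sigma>_Suc)
    then show ?case by (intro Suc.IH) (simp add: fun_eq_iff)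
  qed
  have "p (\<tau> x) = \<tau> x" for x by (rule pI) auto
  then have "p = (\<lambda>x. x)" by (intro cancel[of N]) (simp add: \<tau>_def)
  then have "h \<in> range \<tau>" for h using p(1)[of h] by simp
  moreover have "range \<tau> \<subseteq> range S"
    unfolding \<tau>_def N_def by (auto simp: \<sigma>_def)
  ultimately show ?thesis by blast
qed

end

section \<open>The element \<open>U\<close>\<close>

context quasi_bialg
begin

section \<open>The antipode-free computation behind the value of \<open>U\<close> at
  \<open>\<alpha>\<close>\<close>

definition ml7 :: "('h \<Rightarrow> 'h \<Rightarrow> 'h \<Rightarrow> 'h \<Rightarrow> 'h \<Rightarrow> 'h \<Rightarrow> 'h \<Rightarrow> 'k) \<Rightarrow> bool" where
  "ml7 G \<longleftrightarrow> (\<forall>b c d e f g. linK (\<lambda>a. G a b c d e f g)) \<and> (\<forall>a c d e f g. linK (\<lambda>b. G a b c d e f g)) \<and>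
     (\<forall>a b d e f g. linK (\<lambda>c. G a b c d e f g)) \<and> (\<forall>a b c e f g. linK (\<lambda>d. G a b c d e f g)) \<and>
     (\<forall>a b c d f g. linK (\<lambda>e. G a b c d e f g)) \<and> (\<forall>a b c d e g. linK (\<lambda>f. G a b c d e f g)) \<and>
     (\<forall>a b c d e f. linK (\<lambda>g. G a b c d e f g))"

lemma ml7I:
  assumes "\<And>b c d e f g. linK (\<lambda>a. G a b c d e f g)" "\<And>a c d e f g. linK (\<lambda>b. G a b c d e f g)"
    "\<And>a b d e f g. linK (\<lambda>c. G a b c d e f g)" "\<And>a b c e f g. linK (\<lambda>d. G a b c d e f g)"
    "\<And>a b c d f g. linK (\<lambda>e. G a b c d e f g)" "\<And>a b c d e g. linK (\<lambda>f. G a b c d e f g)"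
    "\<And>a b c d e f. linK (\<lambda>g. G a b c d e f g)"
  shows "ml7 G"
  unfolding ml7_def using assms by blast

lemma ml7D:
  assumes "ml7 G"
  shows "linH t \<Longrightarrow> linK (\<lambda>x. G (t x) b c d e f g)" "linH t \<Longrightarrow> linK (\<lambda>x. G a (t x) c d e f g)"
    "linH t \<Longrightarrow> linK (\<lambda>x. G a b (t x) d e f g)" "linH t \<Longrightarrow> linK (\<lambda>x. G a b c (t x) e f g)"
    "linH t \<Longrightarrow> linK (\<lambda>x. G a b c d (t x) f g)" "linH t \<Longrightarrow> linK (\<lambda>x. G a b c d e (t x) g)"
    "linH t \<Longrightarrow> linK (\<lambda>x. G a b c d e f (t x))"
  using assms by (auto simp: ml7_def linK_iff linH_iff)

text \<open>Counterpart of \<open>phi_balanced\<close> for the inverse associator, modelled on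
  \<open>S(x1) \<alpha> x2 \<beta> S(x3)\<close>. It is what lets \<open>S(h)\<close> pass through
  the inverse of the Drinfel'd twist.\<close>

lemma psi_balanced:
  assumes C: "ml3 C" and r: "\<And>a. rinv (C a)" and l: "\<And>c. linv (\<lambda>a b. C a b c)"
  shows "psi (\<lambda>x1 x2 x3. C (x1 * h) x2 x3) = psi (\<lambda>x1 x2 x3. C x1 x2 (h * x3))"
  using psi_linv[OF C l, of h] psi_rinv[OF C r, of h] psi_coassoc[OF C, of h] by (simp add: cop_psi_swap)

text \<open>The model is \<open>G = B(\<Delta>(S(a) \<alpha>) (b \<beta> S(e) \<alpha> f \<otimes> c
  \<beta> S(d) \<alpha> g))\<close>; each hypothesis is the antipode axiom for one
  \<open>\<alpha>\<close> or \<open>\<beta>\<close> in it. The left side is the expansion of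
  \<open>U (1 \<otimes> \<alpha>)\<close>, and on the right two associators are left in a position
  where \<open>X1 \<beta> S(X2) \<alpha> X3 = 1\<close> removes them.\<close>

lemma twist_core:
  assumes G: "ml7 G"
    and abc: "\<And>h a b c d e f g. cop h (\<lambda>h1 h2. cop h2 (\<lambda>h21 h22. G (h1 * a) (h21 * b) (h22 * c) d e f g)) =
        eps Q h * G a b c d e f g"
    and cd: "\<And>a b e f g. rinv (\<lambda>c d. G a b c d e f g)"
    and be: "\<And>a c d f g. rinv (\<lambda>b e. G a b c d e f g)"
    and ef: "\<And>a b c d g. linv (\<lambda>e f. G a b c d e f g)"
    and dg: "\<And>a b c e f. linv (\<lambda>d g. G a b c d e f g)"
  shows "psi (\<lambda>x1 x2 x3. cop x3 (\<lambda>x31 x32. phi (\<lambda>X1 X2 X3. cop (x2 * X1) (\<lambda>m1 m2.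
      psi (\<lambda>y1 y2 y3. phi (\<lambda>Z1 Z2 Z3.
        G x1 (m1 * y1) (m2 * y2) (Z1 * (x31 * X2 * y3)) (Z2 * (x32 * X3)) Z3 1)))))) =
    phi (\<lambda>B1 B2 B3. phi (\<lambda>A1 A2 A3. phi (\<lambda>X1 X2 X3. G X1 (X2 * A1) (X3 * B1) B2 A2 A3 B3)))"
proof -
  note mI = ml2I ml3I ml4I ml7I lin ml7D[OF G]
  \<comment> \<open>The slots \<open>b\<close> and \<open>c\<close> are bundled into one slot
    \<open>m\<close> under \<open>\<Delta>\<close>, so that the three-slot hypothesis
    \<open>abc\<close> becomes ordinary left invariance in \<open>a\<close> and \<open>m\<close>, as
    \<open>pentagon_linv\<close> requires.\<close>
  define C1 where "C1 a m d e = cop m (\<lambda>m1 m2. psi (\<lambda>y1 y2 y3. phi (\<lambda>Z1 Z2 Z3.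
      G a (m1 * y1) (m2 * y2) (Z1 * (d * y3)) (Z2 * e) Z3 1)))" for a m d e
  have C1: "ml4 C1" unfolding C1_def by (intro mI)
  have C1_cop: "C1 a (m * n) d e = cop m (\<lambda>m1 m2. cop n (\<lambda>n1 n2. psi (\<lambda>y1 y2 y3. phi (\<lambda>Z1 Z2 Z3.
      G a (m1 * (n1 * y1)) (m2 * (n2 * y2)) (Z1 * (d * y3)) (Z2 * e) Z3 1))))" for a m n d e
  proof -
    have m: "ml2 (\<lambda>m1 m2. psi (\<lambda>y1 y2 y3. phi (\<lambda>Z1 Z2 Z3.
      G a (m1 * y1) (m2 * y2) (Z1 * (d * y3)) (Z2 * e) Z3 1)))" by (intro mI)
    show ?thesis unfolding C1_def cop_mult[OF m] by (simp only: mult.assoc)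
  qed
  have C1_linv: "linv (\<lambda>a m. C1 a m d e)" for d e
    unfolding linv_def
  proof (intro allI)
    fix h a m
    have "cop h (\<lambda>h1 h2. C1 (h1 * a) (h2 * m) d e) = cop m (\<lambda>m1 m2. psi (\<lambda>y1 y2 y3. phi (\<lambda>Z1 Z2 Z3.
        cop h (\<lambda>h1 h2. cop h2 (\<lambda>h21 h22.
          G (h1 * a) (h21 * (m1 * y1)) (h22 * (m2 * y2)) (Z1 * (d * y3)) (Z2 * e) Z3 1)))))"
      unfolding C1_cop by (simp only: cop_phi_swap cop_psi_swap psi_phi_swap cop_cop_swap[of _ m])
    also have "\<dots> = eps Q h * C1 a m d e"
      unfolding abc C1_def by (simp only: phi_cmult psi_cmult cop_cmult)
    finally show "cop h (\<lambda>h1 h2. C1 (h1 * a) (h2 * m) d e) = eps Q h * C1 a m d e" .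
  qed
  define S1 where "S1 = psi (\<lambda>u1 u2 u3. psi (\<lambda>s1 s2 s3. cop u2 (\<lambda>u21 u22. psi (\<lambda>y1 y2 y3. phi (\<lambda>Z1 Z2 Z3.
      G (u1 * s1) (u21 * (y1 * s2)) (u22 * y2) (Z1 * (u3 * y3)) (Z2 * s3) Z3 1)))))"
  have "psi (\<lambda>x1 x2 x3. cop x3 (\<lambda>x31 x32. phi (\<lambda>X1 X2 X3. C1 x1 (x2 * X1) (x31 * X2) (x32 * X3)))) =
    psi (\<lambda>u1 u2 u3. psi (\<lambda>s1 s2 s3. cop s2 (\<lambda>s21 s22. C1 (u1 * s1) (u2 * s21) (u3 * s22) s3)))"
    by (rule pentagon_linv[OF C1 C1_linv])
  also have "\<dots> = S1"
  proof -
    \<comment> \<open>By the invariance in \<open>c\<close> and \<open>d\<close>, the coproduct of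
      \<open>s2\<close> passes through \<open>y\<close> and ends as a right factor of the first leg
      of \<open>y\<close>, as in \<open>psi_rinv\<close>.\<close>
    have "cop s2 (\<lambda>s21 s22. C1 a (u2 * s21) (u3 * s22) s3) =
      cop u2 (\<lambda>u21 u22. psi (\<lambda>y1 y2 y3. phi (\<lambda>Z1 Z2 Z3.
        G a (u21 * (y1 * s2)) (u22 * y2) (Z1 * (u3 * y3)) (Z2 * s3) Z3 1)))" for a u2 u3 s2 s3
    proof -
      define C where "C u21 u22 x y z = phi (\<lambda>Z1 Z2 Z3. G a (u21 * x) (u22 * y) (Z1 * (u3 * z)) (Z2 * s3) Z3 1)"
        for u21 u22 x y z
      have C: "ml3 (C u21 u22)" for u21 u22 unfolding C_def by (intro mI)
      have r: "rinv (C u21 u22 x)" for u21 u22 x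
        using cd unfolding rinv_def C_def by (simp only: cop_phi_swap mult.assoc[symmetric] phi_cmult simp_thms)
      show ?thesis
        using psi_rinv[OF C r, of s2]
        by (simp only: C1_cop cop_cop_swap[of s2 u2] C_def mult.assoc)
    qed
    then show ?thesis by (simp only: S1_def)
  qed
  also have "S1 = psi (\<lambda>u1 u2 u3. cop u2 (\<lambda>u21 u22. psi (\<lambda>y1 y2 y3. psi (\<lambda>s1 s2 s3. phi (\<lambda>Z1 Z2 Z3.
      G (u1 * s1) (u21 * y1 * s2) (u22 * y2) (Z1 * (u3 * y3)) (Z2 * s3) Z3 1)))))"
    unfolding S1_def cop_psi_swap mult.assoc by (subst psi_psi_swap) (rule refl)
  also have "\<dots> = phi (\<lambda>X1 X2 X3. psi (\<lambda>t1 t2 t3. cop t1 (\<lambda>t11 t12. psi (\<lambda>s1 s2 s3. phi (\<lambda>Z1 Z2 Z3.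
      G (X1 * t11 * s1) (X2 * t12 * s2) (X3 * t2) (Z1 * t3) (Z2 * s3) Z3 1)))))"
  proof -
    define C where "C a b c d = psi (\<lambda>s1 s2 s3. phi (\<lambda>Z1 Z2 Z3.
      G (a * s1) (b * s2) c (Z1 * d) (Z2 * s3) Z3 1))" for a b c d
    have C: "ml4 C" unfolding C_def by (intro mI)
    have r: "rinv (C a b)" for a b
      using cd unfolding rinv_def C_def by (simp only: cop_phi_swap cop_psi_swap mult.assoc[symmetric] phi_cmult psi_cmult simp_thms)
    show ?thesis using pentagon_rinv[OF C r] by (simp only: C_def)
  qed
  also have "\<dots> = psi (\<lambda>t1 t2 t3. cop t1 (\<lambda>t11 t12. psi (\<lambda>s1 s2 s3. phi (\<lambda>Z1 Z2 Z3. phi (\<lambda>X1 X2 X3.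
      G (X1 * (t11 * s1)) (X2 * (t12 * s2)) (X3 * t2) (Z1 * t3) (Z2 * s3) Z3 1)))))"
    unfolding psi_phi_swap cop_phi_swap mult.assoc by (subst phi_phi_swap) (rule refl)
  finally have 1: "psi (\<lambda>x1 x2 x3. cop x3 (\<lambda>x31 x32. phi (\<lambda>X1 X2 X3. C1 x1 (x2 * X1) (x31 * X2) (x32 * X3)))) =
      \<dots>" .
  \<comment> \<open>Absorbing this \<open>\<Phi>\<close> rebrackets the invariance in the first
    three slots: coassociativity turns \<open>h1 \<otimes> \<Delta>(h2)\<close> into
    \<open>\<Delta>(h1) \<otimes> h2\<close> (\<open>Kabc\<close>). The remaining hypotheses are
    inherited.\<close>
  define K where "K a b c d e f g = phi (\<lambda>X1 X2 X3. G (X1 * a) (X2 * b) (X3 * c) d e f g)" for a b c d e f g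
  have K: "ml7 K" unfolding K_def by (intro mI)
  note mK = ml2I ml3I ml4I ml7I lin ml7D[OF K]
  have Kabc: "cop h (\<lambda>h1 h2. cop h1 (\<lambda>h11 h12. K (h11 * a) (h12 * b) (h2 * c) d e f g)) =
      eps Q h * K a b c d e f g" for h a b c d e f g
  proof -
    have m: "ml3 (\<lambda>x y z. G (x * a) (y * b) (z * c) d e f g)" by (intro mI)
    show ?thesis unfolding K_def using coassoc[OF m, of h]
      by (simp only: mult.assoc abc phi_cmult cop_phi_swap)
  qed
  have Kcd: "rinv (\<lambda>c d. K a b c d e f g)" for a b e f g
    using cd unfolding rinv_def K_def by (simp only: cop_phi_swap mult.assoc[symmetric] phi_cmult simp_thms)
  have Kbe: "rinv (\<lambda>b e. K a b c d e f g)" for a c d f g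
    using be unfolding rinv_def K_def by (simp only: cop_phi_swap mult.assoc[symmetric] phi_cmult simp_thms)
  have Kef: "linv (\<lambda>e f. K a b c d e f g)" for a b c d g
    using ef unfolding linv_def K_def by (simp only: cop_phi_swap phi_cmult simp_thms)
  have Kdg: "linv (\<lambda>d g. K a b c d e f g)" for a b c e f
    using dg unfolding linv_def K_def by (simp only: cop_phi_swap phi_cmult simp_thms)
  define C5 where "C5 a b e f = psi (\<lambda>t1 t2 t3. cop t1 (\<lambda>t11 t12. K (t11 * a) (t12 * b) t2 t3 e f 1))" for a b e f
  have C5: "ml4 C5" unfolding C5_def by (intro mK)
  have C5be: "rinv (\<lambda>b e. C5 a b e f)" for a f
    using Kbe unfolding rinv_def C5_def by (simp only: cop_psi_swap cop_cop_swap[where u = "_"] mult.assoc[symmetric] cop_cmult psi_cmult simp_thms)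
  have C5ef: "linv (C5 a b)" for a b
    using Kef unfolding linv_def C5_def by (simp only: cop_psi_swap cop_cop_swap[where u = "_"] cop_cmult psi_cmult simp_thms)
  \<comment> \<open>A coproduct on the first two slots of \<open>C5\<close> can be traded for a left
    factor \<open>h\<close> of \<open>t3\<close>. Read backwards, this converts the factor
    \<open>Z1\<close> into the \<open>\<Delta>(Z1)\<close> that \<open>zigzag\<close> needs.\<close>
  have C5_cop: "cop h (\<lambda>h1 h2. C5 (h1 * a) (h2 * b) e f) =
      psi (\<lambda>t1 t2 t3. cop t1 (\<lambda>t11 t12. K (t11 * a) (t12 * b) t2 (h * t3) e f 1))" for h a b e f
  proof -
    define C where "C x y z = cop x (\<lambda>x1 x2. K (x1 * a) (x2 * b) y z e f 1)" for x y z
    have C: "ml3 C" unfolding C_def by (intro mK)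
    have r: "rinv (C x)" for x
      using Kcd unfolding rinv_def C_def by (simp only: cop_cop_swap[where u = x] cop_cmult simp_thms)
    have C_mult: "C (x * x') y z = cop x (\<lambda>x1 x2. cop x' (\<lambda>y1 y2. K (x1 * (y1 * a)) (x2 * (y2 * b)) y z e f 1))"
      for x x' y z
    proof -
      have m: "ml2 (\<lambda>x1 x2. K (x1 * a) (x2 * b) y z e f 1)" by (intro mK)
      show ?thesis unfolding C_def cop_mult[OF m] by (simp only: mult.assoc)
    qed
    have l: "linK (\<lambda>x. K c d y (x * z) e f 1)" for c d y z by (intro mK linH_id)
    have "cop h (\<lambda>h1 h2. cop h1 (\<lambda>h11 h12. psi (\<lambda>y1 y2 y3. C (h11 * y1) (h12 * y2) (h2 * y3)))) =
      psi (\<lambda>y1 y2 y3. cop y1 (\<lambda>y11 y12. cop h (\<lambda>h1 h2. cop h1 (\<lambda>h11 h12. cop h11 (\<lambda>h111 h112.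
        K (h111 * (y11 * a)) (h112 * (y12 * b)) (h12 * y2) (h2 * y3) e f 1)))))"
    proof -
      have sw: "cop h (\<lambda>h1 h2. cop h1 (\<lambda>h11 h12. cop h11 (\<lambda>a b. cop w (\<lambda>c d. F h1 h2 h11 h12 a b c d)))) =
          cop w (\<lambda>c d. cop h (\<lambda>h1 h2. cop h1 (\<lambda>h11 h12. cop h11 (\<lambda>a b. F h1 h2 h11 h12 a b c d))))"
        for w and F :: "'h \<Rightarrow> 'h \<Rightarrow> 'h \<Rightarrow> 'h \<Rightarrow> 'h \<Rightarrow> 'h \<Rightarrow> 'h \<Rightarrow> 'h \<Rightarrow> 'k"
        by (simp only: cop_cop_swap[of _ w])
      show ?thesis unfolding C_mult cop_psi_swap sw ..
    qed
    also have "\<dots> = psi (\<lambda>y1 y2 y3. cop y1 (\<lambda>y11 y12. K (y11 * a) (y12 * b) y2 (h * y3) e f 1))"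
      by (simp only: Kabc cop_eps_left[OF l])
    finally show ?thesis
      using psi_rinv[OF C r, of h] unfolding C_mult C5_def
      by (simp only: cop_psi_swap cop_cop_swap[of h])
  qed
  have 2: "psi (\<lambda>t1 t2 t3. cop t1 (\<lambda>t11 t12. psi (\<lambda>s1 s2 s3. phi (\<lambda>Z1 Z2 Z3.
      K (t11 * s1) (t12 * s2) t2 (Z1 * t3) (Z2 * s3) Z3 1)))) =
    phi (\<lambda>A1 A2 A3. C5 1 A1 A2 A3)"
  proof -
    have "phi (\<lambda>A1 A2 A3. C5 1 A1 A2 A3) =
      phi (\<lambda>Z1 Z2 Z3. psi (\<lambda>s1 s2 s3. cop Z1 (\<lambda>Z11 Z12. C5 (Z11 * s1) (Z12 * s2) (Z2 * s3) Z3)))"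
      using zigzag[OF C5 C5be C5ef] by (simp only: cop_psi_swap)
    also have "\<dots> = phi (\<lambda>Z1 Z2 Z3. psi (\<lambda>s1 s2 s3. psi (\<lambda>t1 t2 t3. cop t1 (\<lambda>t11 t12.
      K (t11 * s1) (t12 * s2) t2 (Z1 * t3) (Z2 * s3) Z3 1))))"
      unfolding C5_cop ..
    finally show ?thesis
      unfolding cop_psi_swap psi_phi_swap cop_phi_swap by (subst psi_psi_swap) (rule sym)
  qed
  \<comment> \<open>Set-up for a second \<open>zigzag\<close>, now for the pattern formed by the
    slots \<open>c\<close>, \<open>d\<close>, \<open>g\<close> in place of \<open>b\<close>,
    \<open>e\<close>, \<open>f\<close>.\<close>
  define C8 where "C8 m c d g = cop m (\<lambda>m1 m2. phi (\<lambda>A1 A2 A3. K m1 (m2 * A1) c d A2 A3 g))" for m c d g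
  have C8: "ml4 C8" unfolding C8_def by (intro mK)
  have C8cd: "rinv (\<lambda>c d. C8 m c d g)" for m g
    using Kcd unfolding rinv_def C8_def
    by (simp only: cop_phi_swap cop_cop_swap[where u = m] cop_cmult phi_cmult simp_thms)
  have C8dg: "linv (C8 m c)" for m c
    using Kdg unfolding linv_def C8_def
    by (simp only: cop_phi_swap cop_cop_swap[where u = m] cop_cmult phi_cmult simp_thms)
  have C8_inv: "cop h (\<lambda>h1 h2. C8 (h1 * x) (h2 * c) d g) = eps Q h * C8 x c d g" for h x c d g
  proof -
    have m: "ml2 (\<lambda>m1 m2. phi (\<lambda>A1 A2 A3. K m1 (m2 * A1) c d A2 A3 g))" for c by (intro mK)
    have "cop h (\<lambda>h1 h2. C8 (h1 * x) (h2 * c) d g) = phi (\<lambda>A1 A2 A3. cop x (\<lambda>x1 x2.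
        cop h (\<lambda>h1 h2. cop h1 (\<lambda>h11 h12. K (h11 * x1) (h12 * (x2 * A1)) (h2 * c) d A2 A3 g))))"
      unfolding C8_def cop_mult[OF m] by (simp only: cop_phi_swap mult.assoc cop_cop_swap[of _ x])
    then show ?thesis unfolding Kabc C8_def by (simp only: cop_phi_swap cop_cmult phi_cmult)
  qed
  have "phi (\<lambda>A1 A2 A3. C5 1 A1 A2 A3) = psi (\<lambda>t1 t2 t3. C8 t1 t2 t3 1)"
    unfolding C5_def C8_def by (simp only: psi_phi_swap cop_phi_swap mult_1_right)
  \<comment> \<open>A \<open>\<Phi>\<close> that is trivial under \<open>\<epsilon>\<close> on its
    first leg is inserted; \<open>C8_inv\<close> then replaces \<open>\<epsilon>(Y1)\<close> by
    \<open>\<Delta>(Y1)\<close>.\<close>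
  also have "\<dots> = phi (\<lambda>Y1 Y2 Y3. eps Q Y1 * psi (\<lambda>t1 t2 t3. C8 t1 t2 (Y2 * t3) Y3))"
  proof -
    have m: "ml2 (\<lambda>x y. psi (\<lambda>t1 t2 t3. C8 t1 t2 (x * t3) y))" by (intro ml2I lin ml4D[OF C8])
    show ?thesis using phi_eps1[OF m] by (simp only: mult_1_left)
  qed
  also have "\<dots> = phi (\<lambda>Y1 Y2 Y3. cop Y1 (\<lambda>Y11 Y12. psi (\<lambda>t1 t2 t3. C8 (Y11 * t1) (Y12 * t2) (Y2 * t3) Y3)))"
    by (simp only: cop_psi_swap C8_inv psi_cmult)
  also have "\<dots> = phi (\<lambda>B1 B2 B3. C8 1 B1 B2 B3)"
    by (rule zigzag[OF C8 C8cd C8dg])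
  also have "\<dots> = phi (\<lambda>B1 B2 B3. phi (\<lambda>A1 A2 A3. phi (\<lambda>X1 X2 X3. G X1 (X2 * A1) (X3 * B1) B2 A2 A3 B3)))"
  proof -
    have m: "ml2 (\<lambda>m1 m2. phi (\<lambda>A1 A2 A3. K m1 (m2 * A1) c d A2 A3 g))" for c d g by (intro mK)
    show ?thesis unfolding C8_def cop_one[OF m] by (simp only: K_def mult_1_left mult_1_right)
  qed
  finally show ?thesis
    using 1 2 unfolding C1_def K_def by (simp only: mult.assoc)
qed

end

context quasi_hopf
begin

section \<open>The inverse Drinfel'd twist and its commutation with coproducts\<close>

definition delta_sum :: "('h \<Rightarrow> 'h \<Rightarrow> 'k) \<Rightarrow> 'k" where
  "delta_sum B = lift2 Q B (twist_delta Q)"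

definition g_sum :: "('h \<Rightarrow> 'h \<Rightarrow> 'k) \<Rightarrow> 'k" where
  "g_sum B = lift2 Q B (twist_inv Q)"

definition U_sum :: "('h \<Rightarrow> 'h \<Rightarrow> 'v::ab_group_add) \<Rightarrow> 'v" where
  "U_sum B = lift2 Q B (U_elem Q)"

lemma linK_g_sum [lin]: "(\<And>a b. linK (\<lambda>x. F x a b)) \<Longrightarrow> linK (\<lambda>x. g_sum (\<lambda>a b. F x a b))"
  unfolding g_sum_def by (rule linK_lift2)

lemma linK_delta_sum [lin]: "(\<And>a b. linK (\<lambda>x. F x a b)) \<Longrightarrow> linK (\<lambda>x. delta_sum (\<lambda>a b. F x a b))"
  unfolding delta_sum_def by (rule linK_lift2)

lemma linK_U_sum [lin]: "(\<And>a b. linK (\<lambda>x. F x a b)) \<Longrightarrow> linK (\<lambda>x. U_sum (\<lambda>a b. F x a b))"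
  unfolding U_sum_def by (rule linK_lift2)

lemma delta_sum_cop: "delta_sum (\<lambda>a b. cop h (\<lambda>c d. F a b c d)) = cop h (\<lambda>c d. delta_sum (\<lambda>a b. F a b c d))"
  unfolding delta_sum_def cop_def by (rule lift22_swap)

lemma g_sum_cop: "g_sum (\<lambda>a b. cop h (\<lambda>c d. F a b c d)) = cop h (\<lambda>c d. g_sum (\<lambda>a b. F a b c d))"
  unfolding g_sum_def cop_def by (rule lift22_swap)

lemma g_sum_phi: "g_sum (\<lambda>a b. phi (\<lambda>c d e. F a b c d e)) = phi (\<lambda>c d e. g_sum (\<lambda>a b. F a b c d e))"
  unfolding g_sum_def phi_def by (rule lift23_swap)

lemma additive_on_H2: "additive_on (car (H2 Q)) (lift2 Q (\<lambda>_ _. 0 :: 'k))"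
  by (rule additive_on_lift2) (simp add: ml2_def linK_iff)

lemmas H2_mem = additive_on_lift2_comp(1)[OF additive_on_H2] additive_on_lift3_comp(1)[OF additive_on_H2]

lemma twist_delta_car: "twist_delta Q \<in> car (H2 Q)"
  unfolding twist_delta_def by (intro H2_mem tens2_car)

lemma delta_sum_eq:
  assumes B: "ml2 B"
  shows "delta_sum B = phi (\<lambda>X1 X2 X3. cop X1 (\<lambda>X11 X12. psi (\<lambda>y1 y2 y3.
    B (X11 * (y1 * (\<beta> * S X3))) (X12 * (y2 * (\<beta> * S (X2 * y3)))))))"
  unfolding delta_sum_def twist_delta_def
  by (simp add: additive_on_lift3_comp[OF additive_on_lift2[OF B]] additive_on_lift2_comp[OF additive_on_lift2[OF B]]
      H2_mem lift2_tens2[OF B] phi_def psi_def cop_def mult.assoc)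

lemma g_sum_eq:
  assumes B: "ml2 B"
  shows "g_sum B = psi (\<lambda>x1 x2 x3. cop (S x1 * (\<alpha> * x2)) (\<lambda>p q. delta_sum (\<lambda>d1 d2.
    cop x3 (\<lambda>x31 x32. B (p * (d1 * S x32)) (q * (d2 * S x31))))))"
proof -
  have m: "ml2 (\<lambda>a b. B (p * a) (q * b))" for p q by (intro ml2I lin ml2D[OF B])
  have m': "ml2 (\<lambda>a b. cop x3 (\<lambda>x31 x32. B (a * S x32) (b * S x31)))" for x3 by (intro ml2I lin ml2D[OF B])
  have mem: "lift2 Q (\<lambda>x31 x32. tens2 Q (S x32) (S x31)) t \<in> car (H2 Q)" for t
    by (intro H2_mem tens2_car)
  have r: "lift2 Q B' (lift2 Q (\<lambda>x31 x32. tens2 Q (S x32) (S x31)) (Delta Q x3)) = cop x3 (\<lambda>x31 x32. B' (S x32) (S x31))"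
    if "ml2 B'" for B' x3
    by (simp add: additive_on_lift2_comp[OF additive_on_lift2[OF that]] lift2_tens2[OF that] cop_def)
  show ?thesis
    unfolding g_sum_def twist_inv_def
    by (simp add: additive_on_lift3_comp[OF additive_on_lift2[OF B]] H2_mul_car twist_delta_car mem
        lift2_mul[OF B] lift2_mul[OF m'] r[OF m] psi_def cop_def[of "_ * (_ * _)"] delta_sum_def mult.assoc)
qed

text \<open>The two factors \<open>\<beta>\<close> in \<open>\<delta>\<close> absorb the coproducts
  in turn: after coassociativity \<open>psi_rinv\<close> consumes \<open>\<Delta>(h1)\<close> at the
  second \<open>\<beta>\<close>, and what remains is absorbed at the first. In Sweedler notation:
  \<open>\<Delta>(h1) \<delta> (S \<otimes> S)(\<Delta>\<^sup>c\<^sup>o\<^sup>p(h2)) = \<epsilon>(h)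
  \<delta>\<close>.\<close>

lemma delta_sum_inv:
  assumes B: "ml2 B"
  shows "cop h (\<lambda>h1 h2. cop h1 (\<lambda>p q. cop h2 (\<lambda>r s. delta_sum (\<lambda>d1 d2. B (p * (d1 * S s)) (q * (d2 * S r)))))) =
    eps Q h * delta_sum B"
proof -
  define G where "G a b c = cop a (\<lambda>a1 a2. psi (\<lambda>y1 y2 y3.
    B (a1 * (y1 * (\<beta> * S c))) (a2 * (y2 * (\<beta> * S (b * y3))))))" for a b c
  have G: "ml3 G" unfolding G_def by (intro ml3I lin ml2D[OF B])
  have G_mult: "G (a * a') b c = cop a (\<lambda>a1 a2. cop a' (\<lambda>b1 b2. psi (\<lambda>y1 y2 y3.
    B (a1 * (b1 * (y1 * (\<beta> * S c)))) (a2 * (b2 * (y2 * (\<beta> * S (b * y3))))))))" for a a' b c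
  proof -
    have m: "ml2 (\<lambda>a1 a2. psi (\<lambda>y1 y2 y3.
      B (a1 * (y1 * (\<beta> * S c))) (a2 * (y2 * (\<beta> * S (b * y3))))))" by (intro ml2I lin ml2D[OF B])
    show ?thesis unfolding G_def cop_mult[OF m] by (simp only: mult.assoc)
  qed
  have delta: "delta_sum B' = phi (\<lambda>X1 X2 X3. cop X1 (\<lambda>X11 X12. psi (\<lambda>y1 y2 y3.
    B' (X11 * (y1 * (\<beta> * S X3))) (X12 * (y2 * (\<beta> * S (X2 * y3)))))))" if "ml2 B'" for B'
    by (rule delta_sum_eq[OF that])
  have m: "ml2 (\<lambda>d1 d2. B (p * (d1 * S s)) (q * (d2 * S r)))" for p q r s by (intro ml2I lin ml2D[OF B])
  have "cop h (\<lambda>h1 h2. cop h1 (\<lambda>p q. cop h2 (\<lambda>r s. delta_sum (\<lambda>d1 d2. B (p * (d1 * S s)) (q * (d2 * S r)))))) =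
    phi (\<lambda>X1 X2 X3. cop h (\<lambda>h1 h2. cop h2 (\<lambda>r s. G (h1 * X1) (r * X2) (s * X3))))"
  proof -
    have sw: "cop h (\<lambda>h1 h2. cop h1 (\<lambda>p q. cop h2 (\<lambda>r s. F p q r s))) =
        cop h (\<lambda>h1 h2. cop h2 (\<lambda>r s. cop h1 (\<lambda>p q. F p q r s)))" for F :: "'h \<Rightarrow> 'h \<Rightarrow> 'h \<Rightarrow> 'h \<Rightarrow> 'k"
      by (intro arg_cong[where f = "cop h"] ext cop_cop_swap)
    show ?thesis unfolding sw delta[OF m] G_mult by (simp only: cop_phi_swap S_mult mult.assoc)
  qed
  also have "\<dots> = phi (\<lambda>X1 X2 X3. cop h (\<lambda>h1 h2. cop h1 (\<lambda>h11 h12. G (X1 * h11) (X2 * h12) (X3 * h2))))"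
    by (rule coassoc[OF G, symmetric])
  also have "\<dots> = phi (\<lambda>X1 X2 X3. cop X1 (\<lambda>X11 X12. psi (\<lambda>y1 y2 y3. cop h (\<lambda>h1 h2.
      B (X11 * (y1 * (h1 * (\<beta> * S (X3 * h2))))) (X12 * (y2 * (\<beta> * S (X2 * y3))))))))"
  proof -
    have "cop h1 (\<lambda>h11 h12. G (X1 * h11) (X2 * h12) c) = cop X1 (\<lambda>X11 X12. psi (\<lambda>y1 y2 y3.
      B (X11 * (y1 * (h1 * (\<beta> * S c)))) (X12 * (y2 * (\<beta> * S (X2 * y3))))))" for X1 X2 c h1
    proof -
      define C where "C X11 X12 x y z = B (X11 * (x * (\<beta> * S c))) (X12 * (y * (\<beta> * S (X2 * z))))"
        for X11 X12 x y z
      have C: "ml3 (C X11 X12)" for X11 X12 unfolding C_def by (intro ml3I lin ml2D[OF B])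
      have r: "rinv (C X11 X12 x)" for X11 X12 x
        unfolding rinv_def
      proof (intro allI)
        fix h a b
        have l: "linK (\<lambda>w. B (X11 * (x * (\<beta> * S c))) (X12 * (a * (w * S (X2 * b)))))"
          by (intro lin ml2D[OF B])
        show "cop h (\<lambda>h1 h2. C X11 X12 x (a * h1) (b * h2)) = eps Q h * C X11 X12 x a b"
          using antipode_right[OF l, of h] by (simp only: C_def S_mult mult.assoc)
      qed
      show ?thesis
        using psi_rinv[OF C r, of h1] unfolding G_mult C_def
        by (simp only: cop_cop_swap[of h1 X1] mult.assoc)
    qed
    then show ?thesis by (simp only: cop_psi_swap cop_cop_swap[of h])
  qed
  also have "\<dots> = eps Q h * delta_sum B"
  proof -
    have "cop h (\<lambda>h1 h2. B (a * (y * (h1 * (\<beta> * S (c * h2))))) b) = eps Q h * B (a * (y * (\<beta> * S c))) b" for a b c y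
    proof -
      have l: "linK (\<lambda>w. B (a * (y * (w * S c))) b)" by (intro lin ml2D[OF B])
      show ?thesis using antipode_right[OF l, of h] by (simp only: S_mult mult.assoc)
    qed
    then show ?thesis unfolding delta_sum_eq[OF B] by (simp only: phi_cmult cop_cmult psi_cmult)
  qed
  finally show ?thesis .
qed

text \<open>The characteristic property of the twist, \<open>\<Delta>(S(h)) f\<^sup>-\<^sup>1 =
  f\<^sup>-\<^sup>1 (S \<otimes> S)(\<Delta>\<^sup>c\<^sup>o\<^sup>p(h))\<close>. In the explicit
  formula \<open>h\<close> sits next to \<open>x1\<close> on one side and next to \<open>x3\<close>
  on the other, and \<open>psi_balanced\<close> moves it across.\<close>

lemma g_sum_intertwine:
  assumes B: "ml2 B"
  shows "g_sum (\<lambda>g1 g2. cop (S h) (\<lambda>p q. B (p * g1) (q * g2))) =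
    g_sum (\<lambda>g1 g2. cop h (\<lambda>r s. B (g1 * S s) (g2 * S r)))"
proof -
  define T where "T a b c = cop (S a * (\<alpha> * b)) (\<lambda>p q. delta_sum (\<lambda>d1 d2.
    cop c (\<lambda>r s. B (p * (d1 * S s)) (q * (d2 * S r)))))" for a b c
  have T: "ml3 T" unfolding T_def by (intro ml3I lin ml2D[OF B])
  have m1: "ml2 (\<lambda>g1 g2. cop (S h) (\<lambda>p q. B (p * g1) (q * g2)))" by (intro ml2I lin ml2D[OF B])
  have m2: "ml2 (\<lambda>g1 g2. cop h (\<lambda>r s. B (g1 * S s) (g2 * S r)))" by (intro ml2I lin ml2D[OF B])
  have m3: "ml2 (\<lambda>p q. delta_sum (\<lambda>d1 d2. cop c (\<lambda>r s. B (p * (d1 * S s)) (q * (d2 * S r)))))" for c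
    by (intro ml2I lin ml2D[OF B])
  have m4: "ml2 (\<lambda>r s. B (p * (d1 * S s)) (q * (d2 * S r)))" for p q d1 d2
    by (intro ml2I lin ml2D[OF B])
  have l: "linv (\<lambda>a b. T a b c)" for c
    unfolding linv_def
  proof (intro allI)
    fix h a b
    have l: "linK (\<lambda>w. cop (S a * (w * b)) (\<lambda>p q. delta_sum (\<lambda>d1 d2.
      cop c (\<lambda>r s. B (p * (d1 * S s)) (q * (d2 * S r))))))" by (intro lin ml2D[OF B])
    show "cop h (\<lambda>h1 h2. T (h1 * a) (h2 * b) c) = eps Q h * T a b c"
      using antipode_left[OF l, of h] by (simp only: T_def S_mult mult.assoc)
  qed
  \<comment> \<open>Here \<open>\<delta>\<close>, placed between the coproducts coming from
    \<open>x2\<close> and \<open>x3\<close>, plays the role of \<open>\<beta>\<close>; the required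
    absorption is \<open>delta_sum_inv\<close>.\<close>
  have r: "rinv (T a)" for a
    unfolding rinv_def
  proof (intro allI)
    fix h b c
    have m: "ml2 (\<lambda>d1 d2. cop c (\<lambda>r s. B (p * (d1 * S s)) (q * (d2 * S r))))" for p q
      by (intro ml2I lin ml2D[OF B])
    have "cop h (\<lambda>h1 h2. T a (b * h1) (c * h2)) = cop (S a * (\<alpha> * b)) (\<lambda>p q. cop h (\<lambda>h1 h2.
      cop h1 (\<lambda>p' q'. cop h2 (\<lambda>r' s'. delta_sum (\<lambda>d1 d2.
        cop c (\<lambda>r s. B (p * (p' * (d1 * S s') * S s)) (q * (q' * (d2 * S r') * S r))))))))"
    proof -
      have e: "S a * (\<alpha> * (b * h1)) = (S a * (\<alpha> * b)) * h1" for h1 by (simp only: mult.assoc)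
      show ?thesis
        unfolding T_def e cop_mult[OF m3, of "S a * (\<alpha> * b)"]
        unfolding cop_mult[OF m4] S_mult
        by (simp only: mult.assoc delta_sum_cop cop_cop_swap[of h "S a * (\<alpha> * b)"] cop_cop_swap[of c])
    qed
    also have "\<dots> = eps Q h * T a b c"
      unfolding delta_sum_inv[OF m] T_def by (simp only: cop_cmult)
    finally show "cop h (\<lambda>h1 h2. T a (b * h1) (c * h2)) = eps Q h * T a b c" .
  qed
  have "g_sum (\<lambda>g1 g2. cop (S h) (\<lambda>p q. B (p * g1) (q * g2))) = psi (\<lambda>x1 x2 x3. T (x1 * h) x2 x3)"
    unfolding g_sum_eq[OF m1] T_def S_mult mult.assoc cop_mult[OF m3, of "S h"]
    by (simp only: delta_sum_cop cop_cop_swap[of _ "S h"])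
  also have "\<dots> = psi (\<lambda>x1 x2 x3. T x1 x2 (h * x3))"
    by (rule psi_balanced[OF T r l])
  also have "\<dots> = g_sum (\<lambda>g1 g2. cop h (\<lambda>r s. B (g1 * S s) (g2 * S r)))"
    unfolding g_sum_eq[OF m2] T_def cop_mult[OF m4] S_mult mult.assoc
    by (simp only: cop_cop_swap[of h])
  finally show ?thesis .
qed

end

section \<open>The two identities for \<open>U\<close>\<close>

locale quasi_hopf_surj = quasi_hopf Q for Q :: "('k::field, 'h::ring_1, 'z) qhopf_scheme" +
  assumes surj_S: "surj (antipode Q)"
begin

lemma U_sum_eq:
  fixes B :: "'h \<Rightarrow> 'h \<Rightarrow> 'k"
  assumes B: "ml2 B"
  shows "U_sum B = g_sum (\<lambda>g1 g2. phi (\<lambda>Z1 Z2 Z3. B (g1 * (S Z2 * (\<alpha> * Z3))) (g2 * S Z1)))"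
proof -
  have q: "lift2 Q C (q_R Q) = phi (\<lambda>Z1 Z2 Z3. C Z1 (inv S (\<alpha> * Z3) * Z2))" if "ml2 C" for C
    unfolding q_R_def
    by (simp add: additive_on_lift3_comp[OF additive_on_lift2[OF that]] lift2_tens2[OF that] phi_def)
  have m: "ml2 (\<lambda>q1 q2. B (g1 * S q2) (g2 * S q1))" for g1 g2 by (intro ml2I lin ml2D[OF B])
  have "U_sum B = g_sum (\<lambda>g1 g2. lift2 Q (\<lambda>q1 q2. B (g1 * S q2) (g2 * S q1)) (q_R Q))"
    unfolding U_sum_def U_elem_def g_sum_def
    by (simp add: additive_on_lift2_comp[OF additive_on_lift2[OF B]] lift2_tens2[OF B] H2_mem)
  \<comment> \<open>\<open>inv S\<close> occurs only underneath \<open>S\<close>, so surjectivity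
    turns \<open>S(inv S (\<alpha> Z3) Z2)\<close> into \<open>S(Z2) \<alpha> Z3\<close>.\<close>
  then show ?thesis
    unfolding q[OF m] S_mult surj_f_inv_f[OF surj_S] .
qed

text \<open>\<open>g_sum_intertwine\<close> carries \<open>\<Delta>(S(h1))\<close> through the
  twist, where its legs meet \<open>q_R\<close>; together with \<open>h2\<close> they form exactly
  the coproduct that \<open>phi_linv\<close> contracts.\<close>

lemma U_sum_intertwine:
  assumes B: "ml2 B"
  shows "U_sum (\<lambda>U1 U2. cop h (\<lambda>h1 h2. cop (S h1) (\<lambda>p q. B (p * (U1 * h2)) (q * U2)))) =
    U_sum (\<lambda>U1 U2. B U1 (U2 * S h))"
proof -
  have m1: "ml2 (\<lambda>U1 U2. cop h (\<lambda>h1 h2. cop (S h1) (\<lambda>p q. B (p * (U1 * h2)) (q * U2))))"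
    and m2: "ml2 (\<lambda>U1 U2. B U1 (U2 * S h))" by (intro ml2I lin ml2D[OF B])+
  have m3: "ml2 (\<lambda>a b. B (a * (S Z2 * (\<alpha> * (Z3 * h2)))) (b * S Z1))" for Z1 Z2 Z3 h2 by (intro ml2I lin ml2D[OF B])
  define C where "C g1 g2 a b c = B (g1 * (S b * (\<alpha> * c))) (g2 * S a)" for g1 g2 a b c
  have C: "ml3 (C g1 g2)" for g1 g2 unfolding C_def by (intro ml3I lin ml2D[OF B])
  have l: "linv (C g1 g2 a)" for g1 g2 a
    unfolding linv_def
  proof (intro allI)
    fix h b c
    have l: "linK (\<lambda>w. B (g1 * (S b * (w * c))) (g2 * S a))" by (intro lin ml2D[OF B])
    show "cop h (\<lambda>h1 h2. C g1 g2 a (h1 * b) (h2 * c)) = eps Q h * C g1 g2 a b c"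
      using antipode_left[OF l, of h] by (simp only: C_def S_mult mult.assoc)
  qed
  have "U_sum (\<lambda>U1 U2. cop h (\<lambda>h1 h2. cop (S h1) (\<lambda>p q. B (p * (U1 * h2)) (q * U2)))) =
    phi (\<lambda>Z1 Z2 Z3. cop h (\<lambda>h1 h2. g_sum (\<lambda>g1 g2. cop (S h1) (\<lambda>p q.
      B (p * g1 * (S Z2 * (\<alpha> * (Z3 * h2)))) (q * g2 * S Z1)))))"
    unfolding U_sum_eq[OF m1] g_sum_phi g_sum_cop by (simp only: mult.assoc)
  also have "\<dots> = phi (\<lambda>Z1 Z2 Z3. cop h (\<lambda>h1 h2. g_sum (\<lambda>g1 g2. cop h1 (\<lambda>r s.
      B (g1 * S s * (S Z2 * (\<alpha> * (Z3 * h2)))) (g2 * S r * S Z1)))))"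
    unfolding g_sum_intertwine[OF m3] ..
  also have "\<dots> = g_sum (\<lambda>g1 g2. phi (\<lambda>Z1 Z2 Z3. cop h (\<lambda>h1 h2. cop h1 (\<lambda>r s.
      C g1 g2 (Z1 * r) (Z2 * s) (Z3 * h2)))))"
    by (simp only: g_sum_phi g_sum_cop C_def S_mult mult.assoc)
  also have "\<dots> = g_sum (\<lambda>g1 g2. phi (\<lambda>Z1 Z2 Z3. C g1 g2 (h * Z1) Z2 Z3))"
    unfolding phi_linv[OF C l] ..
  also have "\<dots> = U_sum (\<lambda>U1 U2. B U1 (U2 * S h))"
    unfolding U_sum_eq[OF m2] C_def S_mult by (simp only: mult.assoc)
  finally show ?thesis .
qed

lemma cop_swap4: "cop a (\<lambda>a1 a2. cop b (\<lambda>b1 b2. cop c (\<lambda>c1 c2. cop d (\<lambda>d1 d2. F a1 a2 b1 b2 c1 c2 d1 d2)))) =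
    cop d (\<lambda>d1 d2. cop b (\<lambda>b1 b2. cop c (\<lambda>c1 c2. cop a (\<lambda>a1 a2. F a1 a2 b1 b2 c1 c2 d1 d2))))"
proof -
  have "cop a (\<lambda>a1 a2. cop b (\<lambda>b1 b2. cop c (\<lambda>c1 c2. cop d (\<lambda>d1 d2. F a1 a2 b1 b2 c1 c2 d1 d2)))) =
    cop d (\<lambda>d1 d2. cop a (\<lambda>a1 a2. cop b (\<lambda>b1 b2. cop c (\<lambda>c1 c2. F a1 a2 b1 b2 c1 c2 d1 d2))))"
    by (simp only: cop_cop_swap[of _ d])
  then show ?thesis by (simp only: cop_cop_swap[of a])
qed

text \<open>The extra \<open>\<alpha>\<close> completes the second leg: after expansion of
  \<open>U\<close>, every antipode lies between a \<open>\<beta>\<close> and an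
  \<open>\<alpha>\<close>, apart from the one in \<open>S(x1) \<alpha>\<close>. The expression is
  then an instance of \<open>twist_core\<close>, with 1 in its last slot.\<close>

lemma U_sum_alpha:
  assumes B: "ml2 B"
  shows "U_sum (\<lambda>U1 U2. B U1 (U2 * \<alpha>)) = phi (\<lambda>X1 X2 X3. cop (S X1 * \<alpha>) (\<lambda>p q. B (p * X2) (q * X3)))"
proof -
  define G where "G a b c d e f g = cop (S a * \<alpha>) (\<lambda>p q.
    B (p * (b * (\<beta> * (S e * (\<alpha> * f))))) (q * (c * (\<beta> * (S d * (\<alpha> * g))))))" for a b c d e f g
  have G: "ml7 G" unfolding G_def by (intro ml7I lin ml2D[OF B])
  have abc: "cop h (\<lambda>h1 h2. cop h2 (\<lambda>h21 h22. G (h1 * a) (h21 * b) (h22 * c) d e f g)) =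
      eps Q h * G a b c d e f g" for h a b c d e f g
  proof -
    have m: "ml2 (\<lambda>p q. B (p * (b * (\<beta> * (S e * (\<alpha> * f))))) (q * (c * (\<beta> * (S d * (\<alpha> * g))))))"
      by (intro ml2I lin ml2D[OF B])
    have l: "linK (\<lambda>w. cop (S a * w) (\<lambda>p q.
        B (p * (b * (\<beta> * (S e * (\<alpha> * f))))) (q * (c * (\<beta> * (S d * (\<alpha> * g)))))))"
      by (intro lin ml2D[OF B])
    have e: "S a * (S h1 * (\<alpha> * h2)) = (S a * (S h1 * \<alpha>)) * h2" for h1 h2 by (simp only: mult.assoc)
    show ?thesis
      using antipode_left[OF l, of h] unfolding e cop_mult[OF m, of "S a * (S _ * \<alpha>)"] G_def S_mult
      by (simp only: mult.assoc cop_cop_swap[of "S a * (S _ * \<alpha>)"])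
  qed
  have cd: "rinv (\<lambda>c d. G a b c d e f g)" for a b e f g
    unfolding rinv_def
  proof (intro allI)
    fix h c d
    have l: "linK (\<lambda>w. cop (S a * \<alpha>) (\<lambda>p q.
        B (p * (b * (\<beta> * (S e * (\<alpha> * f))))) (q * (c * (w * (S d * (\<alpha> * g)))))))"
      by (intro lin ml2D[OF B])
    show "cop h (\<lambda>h1 h2. G a b (c * h1) (d * h2) e f g) = eps Q h * G a b c d e f g"
      using antipode_right[OF l, of h] by (simp only: G_def S_mult mult.assoc)
  qed
  have be: "rinv (\<lambda>b e. G a b c d e f g)" for a c d f g
    unfolding rinv_def
  proof (intro allI)
    fix h b e
    have l: "linK (\<lambda>w. cop (S a * \<alpha>) (\<lambda>p q.
        B (p * (b * (w * (S e * (\<alpha> * f))))) (q * (c * (\<beta> * (S d * (\<alpha> * g)))))))"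
      by (intro lin ml2D[OF B])
    show "cop h (\<lambda>h1 h2. G a (b * h1) c d (e * h2) f g) = eps Q h * G a b c d e f g"
      using antipode_right[OF l, of h] by (simp only: G_def S_mult mult.assoc)
  qed
  have ef: "linv (\<lambda>e f. G a b c d e f g)" for a b c d g
    unfolding linv_def
  proof (intro allI)
    fix h e f
    have l: "linK (\<lambda>w. cop (S a * \<alpha>) (\<lambda>p q.
        B (p * (b * (\<beta> * (S e * (w * f))))) (q * (c * (\<beta> * (S d * (\<alpha> * g)))))))"
      by (intro lin ml2D[OF B])
    show "cop h (\<lambda>h1 h2. G a b c d (h1 * e) (h2 * f) g) = eps Q h * G a b c d e f g"
      using antipode_left[OF l, of h] by (simp only: G_def S_mult mult.assoc)
  qed
  have dg: "linv (\<lambda>d g. G a b c d e f g)" for a b c e f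
    unfolding linv_def
  proof (intro allI)
    fix h d g
    have l: "linK (\<lambda>w. cop (S a * \<alpha>) (\<lambda>p q.
        B (p * (b * (\<beta> * (S e * (\<alpha> * f))))) (q * (c * (\<beta> * (S d * (w * g)))))))"
      by (intro lin ml2D[OF B])
    show "cop h (\<lambda>h1 h2. G a b c (h1 * d) e f (h2 * g)) = eps Q h * G a b c d e f g"
      using antipode_left[OF l, of h] by (simp only: G_def S_mult mult.assoc)
  qed
  note core = twist_core[OF G abc cd be ef dg]
  \<comment> \<open>Common normal form, all products bracketed to the right, of the expanded
    \<open>U\<close> and of the left side of \<open>twist_core\<close>.\<close>
  define N where "N = phi (\<lambda>X1 X2 X3. phi (\<lambda>Z1 Z2 Z3. psi (\<lambda>x1 x2 x3. psi (\<lambda>y1 y2 y3.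
    cop (S x1 * \<alpha>) (\<lambda>p q. cop x2 (\<lambda>m1 m2. cop X1 (\<lambda>X11 X12. cop x3 (\<lambda>r s.
      B (p * (m1 * (X11 * (y1 * (\<beta> * (S X3 * (S s * (S Z2 * (\<alpha> * Z3)))))))))
        (q * (m2 * (X12 * (y2 * (\<beta> * (S y3 * (S X2 * (S r * (S Z1 * \<alpha>)))))))))))))))))"
  have N1: "U_sum (\<lambda>U1 U2. B U1 (U2 * \<alpha>)) = N"
  proof -
    have m1: "ml2 (\<lambda>U1 U2. B U1 (U2 * \<alpha>))" by (intro ml2I lin ml2D[OF B])
    have m2: "ml2 (\<lambda>g1 g2. phi (\<lambda>Z1 Z2 Z3. B (g1 * (S Z2 * (\<alpha> * Z3))) (g2 * S Z1 * \<alpha>)))"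
      by (intro ml2I lin ml2D[OF B])
    have m3: "ml2 (\<lambda>d1 d2. cop x3 (\<lambda>r s. phi (\<lambda>Z1 Z2 Z3.
        B (p * (d1 * S s) * (S Z2 * (\<alpha> * Z3))) (q * (d2 * S r) * S Z1 * \<alpha>))))" for x3 p q
      by (intro ml2I lin ml2D[OF B])
    have e: "cop (S x1 * (\<alpha> * x2)) (\<lambda>p q. cop X1 (\<lambda>X11 X12. cop x3 (\<lambda>r s. B (p * (X11 * (y1 * a s))) (q * (X12 * (y2 * b r)))))) =
      cop (S x1 * \<alpha>) (\<lambda>p q. cop x2 (\<lambda>m1 m2. cop X1 (\<lambda>X11 X12. cop x3 (\<lambda>r s.
        B (p * (m1 * (X11 * (y1 * a s)))) (q * (m2 * (X12 * (y2 * b r))))))))" for x1 x2 X1 x3 y1 y2 a b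
    proof -
      have m: "ml2 (\<lambda>p q. cop X1 (\<lambda>X11 X12. cop x3 (\<lambda>r s. B (p * (X11 * (y1 * a s))) (q * (X12 * (y2 * b r))))))"
        by (intro ml2I lin ml2D[OF B])
      have "S x1 * (\<alpha> * x2) = (S x1 * \<alpha>) * x2" by (simp only: mult.assoc)
      then show ?thesis using cop_mult[OF m, of "S x1 * \<alpha>" x2] by (simp only: mult.assoc)
    qed
    show ?thesis
      unfolding U_sum_eq[OF m1] g_sum_eq[OF m2] delta_sum_eq[OF m3]
      unfolding N_def S_mult
      by (simp only: mult.assoc cop_phi_swap cop_psi_swap psi_phi_swap e)
  qed
  have N2: "psi (\<lambda>x1 x2 x3. cop x3 (\<lambda>x31 x32. phi (\<lambda>X1 X2 X3. cop (x2 * X1) (\<lambda>m1 m2.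
      psi (\<lambda>y1 y2 y3. phi (\<lambda>Z1 Z2 Z3.
        G x1 (m1 * y1) (m2 * y2) (Z1 * (x31 * X2 * y3)) (Z2 * (x32 * X3)) Z3 1)))))) = N"
  proof -
    have m: "ml2 (\<lambda>m1 m2. psi (\<lambda>y1 y2 y3. phi (\<lambda>Z1 Z2 Z3.
        G x1 (m1 * y1) (m2 * y2) (Z1 * (x31 * X2 * y3)) (Z2 * (x32 * X3)) Z3 1)))" for x1 x31 x32 X2 X3
      by (intro ml2I lin ml7D[OF G])
    show ?thesis
      unfolding cop_mult[OF m] unfolding G_def N_def S_mult mult.assoc mult_1_right
      by (simp only: cop_phi_swap cop_psi_swap psi_phi_swap cop_swap4[of "S _ * _"])
  qed
  have "phi (\<lambda>B1 B2 B3. phi (\<lambda>A1 A2 A3. phi (\<lambda>X1 X2 X3. G X1 (X2 * A1) (X3 * B1) B2 A2 A3 B3))) =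
    phi (\<lambda>B1 B2 B3. phi (\<lambda>X1 X2 X3. phi (\<lambda>A1 A2 A3. G X1 (X2 * A1) (X3 * B1) B2 A2 A3 B3)))"
    by (intro arg_cong[where f = phi] ext phi_phi_swap)
  also have "\<dots> = phi (\<lambda>X1 X2 X3. phi (\<lambda>B1 B2 B3. phi (\<lambda>A1 A2 A3. G X1 (X2 * A1) (X3 * B1) B2 A2 A3 B3)))"
    by (rule phi_phi_swap)
  also have "\<dots> = phi (\<lambda>X1 X2 X3. cop (S X1 * \<alpha>) (\<lambda>p q. phi (\<lambda>B1 B2 B3. phi (\<lambda>A1 A2 A3.
      B (p * (X2 * (A1 * (\<beta> * (S A2 * (\<alpha> * A3)))))) (q * (X3 * (B1 * (\<beta> * (S B2 * (\<alpha> * B3)))))))))) "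
    unfolding G_def by (simp only: cop_phi_swap mult.assoc)
  also have "\<dots> = phi (\<lambda>X1 X2 X3. cop (S X1 * \<alpha>) (\<lambda>p q. B (p * X2) (q * X3)))"
  proof -
    have l1: "linK (\<lambda>w. B (p * (X2 * w)) b)" and l2: "linK (\<lambda>w. B a (p * (X2 * w)))" for p X2 a b
      by (intro lin ml2D[OF B])+
    show ?thesis by (simp only: phi_antipode[OF l1] phi_antipode[OF l2] mult_1_right)
  qed
  finally show ?thesis using core unfolding N1 N2 by simp
qed

section \<open>The pentagon identity for \<open>U\<close>\<close>

lemma cop_U_swap: "cop h (\<lambda>c d. U_sum (\<lambda>a b. F a b c d)) = U_sum (\<lambda>a b. cop h (\<lambda>c d. F a b c d))"
  unfolding U_sum_def cop_def by (rule lift22_swap)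

lemma U_phi_swap: "U_sum (\<lambda>a b. phi (\<lambda>c d e. F a b c d e)) = phi (\<lambda>c d e. U_sum (\<lambda>a b. F a b c d e))"
  unfolding U_sum_def phi_def by (rule lift23_swap)

lemma U_psi_swap: "U_sum (\<lambda>a b. psi (\<lambda>c d e. F a b c d e)) = psi (\<lambda>c d e. U_sum (\<lambda>a b. F a b c d e))"
  unfolding U_sum_def psi_def by (rule lift23_swap)

lemma U_U_swap: "U_sum (\<lambda>a b. U_sum (\<lambda>c d. F a b c d)) = U_sum (\<lambda>c d. U_sum (\<lambda>a b. F a b c d))"
  unfolding U_sum_def by (rule lift22_swap)

text \<open>The functionals of the elements \<open>(id \<otimes> \<Delta>)(U) (1 \<otimes> U)\<close> and
  \<open>\<Phi> (\<Delta> \<otimes> id)(\<Delta>(S(X\<^sup>1)) U) (X\<^sup>2 \<otimes> X\<^sup>3 \<otimes> 1)\<close>. They agree because both have the same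
  commutation with \<open>1 \<otimes> 1 \<otimes> S(h)\<close> and the same value after multiplication by \<open>1 \<otimes> 1 \<otimes> \<alpha>\<close>.\<close>

definition L_sum :: "('h \<Rightarrow> 'h \<Rightarrow> 'h \<Rightarrow> 'k) \<Rightarrow> 'k" where
  "L_sum D = U_sum (\<lambda>U1 U2. cop U2 (\<lambda>a b. U_sum (\<lambda>V1 V2. D U1 (a * V1) (b * V2))))"

definition R_sum :: "('h \<Rightarrow> 'h \<Rightarrow> 'h \<Rightarrow> 'k) \<Rightarrow> 'k" where
  "R_sum D = phi (\<lambda>A1 A2 A3. phi (\<lambda>X1 X2 X3. U_sum (\<lambda>U1 U2. cop (S X1) (\<lambda>p q. cop (p * U1) (\<lambda>a b.
     D (A1 * (a * X2)) (A2 * (b * X3)) (A3 * (q * U2)))))))"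

text \<open>If \<open>L\<close> is evaluation at an element \<open>t\<close> of the threefold tensor
  power, the result is evaluation at \<open>(id \<otimes> \<Delta>)(\<Delta>(S(h11))) t (h12
  \<otimes> h2 \<otimes> 1)\<close>.\<close>

definition S3_act :: "(('h \<Rightarrow> 'h \<Rightarrow> 'h \<Rightarrow> 'k) \<Rightarrow> 'k) \<Rightarrow> 'h \<Rightarrow> ('h \<Rightarrow> 'h \<Rightarrow> 'h \<Rightarrow> 'k) \<Rightarrow> 'k" where
  "S3_act L h D = cop h (\<lambda>h1 h2. cop h1 (\<lambda>h11 h12. cop (S h11) (\<lambda>p q. cop q (\<lambda>q1 q2.
     L (\<lambda>a b c. D (p * (a * h12)) (q1 * (b * h2)) (q2 * c))))))"

text \<open>Two uses of \<open>U_sum_intertwine\<close>: the right-hand \<open>U\<close> converts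
  \<open>S(h)\<close> into \<open>\<Delta>(S(h1))\<close>, whose product with
  \<open>\<Delta>(U2)\<close> is \<open>\<Delta>(U2 S(h1))\<close>, and the left-hand
  \<open>U\<close> then takes up \<open>S(h1)\<close>.\<close>

lemma L_sum_intertwine:
  assumes D: "ml3 D"
  shows "L_sum (\<lambda>a b c. D a b (c * S h)) = S3_act L_sum h D"
proof -
  have m1: "ml2 (\<lambda>v w. D u (a * v) (b * w))" for u a b by (intro ml2I lin ml3D[OF D])
  have m2: "ml2 (\<lambda>u w. cop w (\<lambda>a b. D u (a * (V1 * h2)) (b * V2)))" for V1 V2 h2 by (intro ml2I lin ml3D[OF D])
  have m3: "ml2 (\<lambda>a b. D u (a * (V1 * h2)) (b * V2))" for u V1 V2 h2 by (intro ml2I lin ml3D[OF D])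
  have "L_sum (\<lambda>a b c. D a b (c * S h)) =
    U_sum (\<lambda>U1 U2. cop U2 (\<lambda>a b. U_sum (\<lambda>V1 V2. cop h (\<lambda>h1 h2. cop (S h1) (\<lambda>p q.
      D U1 (a * (p * (V1 * h2))) (b * (q * V2)))))))"
    unfolding L_sum_def U_sum_intertwine[OF m1] by (simp only: mult.assoc)
  also have "\<dots> = U_sum (\<lambda>V1 V2. cop h (\<lambda>h1 h2. U_sum (\<lambda>U1 U2. cop (U2 * S h1) (\<lambda>a b.
      D U1 (a * (V1 * h2)) (b * V2)))))"
  proof -
    have "cop U2 (\<lambda>a b. U_sum (\<lambda>V1 V2. cop h (\<lambda>h1 h2. cop (S h1) (\<lambda>p q. F a b V1 V2 h2 p q)))) =
      U_sum (\<lambda>V1 V2. cop h (\<lambda>h1 h2. cop U2 (\<lambda>a b. cop (S h1) (\<lambda>p q. F a b V1 V2 h2 p q))))"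
      for U2 and F :: "'h \<Rightarrow> 'h \<Rightarrow> 'h \<Rightarrow> 'h \<Rightarrow> 'h \<Rightarrow> 'h \<Rightarrow> 'h \<Rightarrow> 'k"
      by (simp only: cop_U_swap cop_cop_swap[of U2 h])
    note sw = this
    have "U_sum (\<lambda>U1 U2. U_sum (\<lambda>V1 V2. cop h (\<lambda>h1 h2. cop U2 (\<lambda>a b. cop (S h1) (\<lambda>p q.
        F U1 a b V1 V2 h2 p q))))) =
      U_sum (\<lambda>V1 V2. cop h (\<lambda>h1 h2. U_sum (\<lambda>U1 U2. cop U2 (\<lambda>a b. cop (S h1) (\<lambda>p q.
        F U1 a b V1 V2 h2 p q)))))" for F :: "'h \<Rightarrow> 'h \<Rightarrow> 'h \<Rightarrow> 'h \<Rightarrow> 'h \<Rightarrow> 'h \<Rightarrow> 'h \<Rightarrow> 'h \<Rightarrow> 'k"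
      unfolding cop_U_swap by (rule U_U_swap)
    then show ?thesis unfolding sw cop_mult[OF m3] mult.assoc by this
  qed
  also have "\<dots> = U_sum (\<lambda>V1 V2. cop h (\<lambda>h1 h2. U_sum (\<lambda>U1 U2. cop h1 (\<lambda>h11 h12. cop (S h11) (\<lambda>p q.
      cop q (\<lambda>q1 q2. cop U2 (\<lambda>a b. D (p * (U1 * h12)) (q1 * (a * (V1 * h2))) (q2 * (b * V2)))))))))"
  proof -
    have "U_sum (\<lambda>U1 U2. cop (U2 * S h1) (\<lambda>a b. D U1 (a * (V1 * h2)) (b * V2))) =
      U_sum (\<lambda>U1 U2. cop h1 (\<lambda>h11 h12. cop (S h11) (\<lambda>p q. cop (q * U2) (\<lambda>a b.
        D (p * (U1 * h12)) (a * (V1 * h2)) (b * V2)))))" for V1 V2 h1 h2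
      using U_sum_intertwine[OF m2] by simp
    then show ?thesis unfolding cop_mult[OF m3] by (simp only: mult.assoc)
  qed
  also have "\<dots> = S3_act L_sum h D"
    unfolding S3_act_def L_sum_def cop_U_swap mult.assoc by (rule U_U_swap)
  finally show ?thesis .
qed

text \<open>\<open>U_sum_intertwine\<close> applies once. Coassociativity is then needed twice,
  first to move the coproduct of \<open>h\<close> from the left of \<open>X\<close> to its right,
  then to carry the resulting \<open>\<Delta>(S(h11))\<close> past the outer
  \<open>\<Phi>\<close>.\<close>

lemma R_sum_intertwine:
  assumes D: "ml3 D"
  shows "R_sum (\<lambda>a b c. D a b (c * S h)) = S3_act R_sum h D"
proof -
  define B where "B A1 A2 A3 X1 X2 X3 u w = cop (S X1) (\<lambda>p q. cop (p * u) (\<lambda>a b.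
     D (A1 * (a * X2)) (A2 * (b * X3)) (A3 * (q * w))))" for A1 A2 A3 X1 X2 X3 u w
  have B: "ml2 (B A1 A2 A3 X1 X2 X3)" for A1 A2 A3 X1 X2 X3
    unfolding B_def by (intro ml2I lin ml3D[OF D])
  define E where "E A1 A2 A3 x y z = U_sum (\<lambda>U1 U2. B A1 A2 A3 x y z U1 U2)" for A1 A2 A3 x y z
  have E: "ml3 (E A1 A2 A3)" for A1 A2 A3
    unfolding E_def B_def by (intro ml3I lin ml3D[OF D])
  have m1: "ml2 (\<lambda>p q. cop (p * u) (\<lambda>a b. D (A1 * (a * X2)) (A2 * (b * X3)) (A3 * (q * w))))" for u w A1 A2 A3 X2 X3
    by (intro ml2I lin ml3D[OF D])
  have m2: "ml2 (\<lambda>a b. D (A1 * (a * X2)) (A2 * (b * X3)) c)" for A1 A2 c X2 X3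
    by (intro ml2I lin ml3D[OF D])
  have e1: "cop (S h1) (\<lambda>p' q'. B A1 A2 A3 X1 X2 X3 (p' * (u * h2)) (q' * w)) =
    cop h2 (\<lambda>h21 h22. B A1 A2 A3 (h1 * X1) (h21 * X2) (h22 * X3) u w)" for A1 A2 A3 X1 X2 X3 u w h1 h2
  proof -
    have "cop h2 (\<lambda>h21 h22. B A1 A2 A3 (h1 * X1) (h21 * X2) (h22 * X3) u w) =
      cop (S X1) (\<lambda>p q. cop (S h1) (\<lambda>p' q'. cop (p * (p' * u)) (\<lambda>a b. cop h2 (\<lambda>h21 h22.
        D (A1 * (a * (h21 * X2))) (A2 * (b * (h22 * X3))) (A3 * (q * (q' * w)))))))"
      unfolding B_def S_mult cop_mult[OF m1, of "S X1"]
      by (simp only: cop_cop_swap[of h2] mult.assoc)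
    also have "\<dots> = cop (S X1) (\<lambda>p q. cop (S h1) (\<lambda>p' q'. cop ((p * (p' * u)) * h2) (\<lambda>a b.
        D (A1 * (a * X2)) (A2 * (b * X3)) (A3 * (q * (q' * w))))))"
      unfolding cop_mult[OF m2, of "_ * (_ * _)"] by (simp only: mult.assoc)
    finally show ?thesis
      unfolding B_def by (simp only: cop_cop_swap[of "S h1" "S X1"] mult.assoc)
  qed
  have e2: "phi (\<lambda>A1 A2 A3. E A1 A2 A3 (X1 * h11) y z) =
    cop (S h11) (\<lambda>p q. cop q (\<lambda>q1 q2. phi (\<lambda>A1 A2 A3. U_sum (\<lambda>U1 U2. cop (S X1) (\<lambda>p' q'. cop (p' * U1) (\<lambda>a b.
      D (p * (A1 * (a * y))) (q1 * (A2 * (b * z))) (q2 * (A3 * (q' * U2)))))))))" for X1 h11 y z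
  proof -
    define F where "F a b q' U2 x1 x2 x3 = D (x1 * (a * y)) (x2 * (b * z)) (x3 * (q' * U2))" for a b q' U2 x1 x2 x3
    have F: "ml3 (F a b q' U2)" for a b q' U2 unfolding F_def by (intro ml3I lin ml3D[OF D])
    have "phi (\<lambda>A1 A2 A3. E A1 A2 A3 (X1 * h11) y z) = U_sum (\<lambda>U1 U2. cop (S X1) (\<lambda>p' q'. cop (p' * U1) (\<lambda>a b.
      phi (\<lambda>A1 A2 A3. cop (S h11) (\<lambda>k1 k2. cop k1 (\<lambda>k11 k12. F a b q' U2 (A1 * k11) (A2 * k12) (A3 * k2)))))))"
    proof -
      have sw: "cop (S h11) (\<lambda>p q. cop (S X1) (\<lambda>p' q'. cop p (\<lambda>c d. cop (p' * u) (\<lambda>a b. H p q p' q' c d a b)))) =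
        cop (S X1) (\<lambda>p' q'. cop (p' * u) (\<lambda>a b. cop (S h11) (\<lambda>p q. cop p (\<lambda>c d. H p q p' q' c d a b))))"
        for u and H :: "'h \<Rightarrow> 'h \<Rightarrow> 'h \<Rightarrow> 'h \<Rightarrow> 'h \<Rightarrow> 'h \<Rightarrow> 'h \<Rightarrow> 'h \<Rightarrow> 'k"
        by (simp only: cop_cop_swap[of _ "_ * u"] cop_cop_swap[of "S h11" "S X1"])
      show ?thesis
        unfolding E_def B_def S_mult cop_mult[OF m1, of "S h11"] mult.assoc
        unfolding cop_mult[OF m2] mult.assoc sw F_def
        by (simp only: cop_phi_swap U_phi_swap)
    qed
    also have "\<dots> = U_sum (\<lambda>U1 U2. cop (S X1) (\<lambda>p' q'. cop (p' * U1) (\<lambda>a b.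
      phi (\<lambda>A1 A2 A3. cop (S h11) (\<lambda>k1 k2. cop k2 (\<lambda>k21 k22. F a b q' U2 (k1 * A1) (k21 * A2) (k22 * A3)))))))"
      unfolding coassoc[OF F] ..
    also have "\<dots> = cop (S h11) (\<lambda>p q. cop q (\<lambda>q1 q2. phi (\<lambda>A1 A2 A3. U_sum (\<lambda>U1 U2. cop (S X1) (\<lambda>p' q'. cop (p' * U1) (\<lambda>a b.
      D (p * (A1 * (a * y))) (q1 * (A2 * (b * z))) (q2 * (A3 * (q' * U2)))))))))"
    proof -
      have sw: "cop (S X1) (\<lambda>p' q'. cop (p' * u) (\<lambda>a b. cop (S h11) (\<lambda>p q. cop q (\<lambda>c d. H p q p' q' c d a b)))) =
        cop (S h11) (\<lambda>p q. cop q (\<lambda>c d. cop (S X1) (\<lambda>p' q'. cop (p' * u) (\<lambda>a b. H p q p' q' c d a b))))"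
        for u and H :: "'h \<Rightarrow> 'h \<Rightarrow> 'h \<Rightarrow> 'h \<Rightarrow> 'h \<Rightarrow> 'h \<Rightarrow> 'h \<Rightarrow> 'h \<Rightarrow> 'k"
        by (simp only: cop_cop_swap[of "_ * u"] cop_cop_swap[of "S X1"])
      show ?thesis unfolding F_def mult.assoc by (simp only: cop_phi_swap U_phi_swap cop_U_swap sw)
    qed
    finally show ?thesis .
  qed
  have "R_sum (\<lambda>a b c. D a b (c * S h)) = phi (\<lambda>A1 A2 A3. phi (\<lambda>X1 X2 X3. U_sum (\<lambda>U1 U2. B A1 A2 A3 X1 X2 X3 U1 (U2 * S h))))"
    unfolding R_sum_def B_def by (simp only: mult.assoc)
  also have "\<dots> = phi (\<lambda>A1 A2 A3. phi (\<lambda>X1 X2 X3. cop h (\<lambda>h1 h2. cop h2 (\<lambda>h21 h22.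
      E A1 A2 A3 (h1 * X1) (h21 * X2) (h22 * X3)))))"
    unfolding U_sum_intertwine[OF B, symmetric] e1 E_def by (simp only: cop_U_swap)
  also have "\<dots> = phi (\<lambda>A1 A2 A3. phi (\<lambda>X1 X2 X3. cop h (\<lambda>h1 h2. cop h1 (\<lambda>h11 h12.
      E A1 A2 A3 (X1 * h11) (X2 * h12) (X3 * h2)))))"
    unfolding coassoc[OF E] ..
  also have "\<dots> = phi (\<lambda>X1 X2 X3. cop h (\<lambda>h1 h2. cop h1 (\<lambda>h11 h12. phi (\<lambda>A1 A2 A3.
      E A1 A2 A3 (X1 * h11) (X2 * h12) (X3 * h2)))))"
    unfolding cop_phi_swap by (rule phi_phi_swap)
  also have "\<dots> = S3_act R_sum h D"
    unfolding e2 S3_act_def R_sum_def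
    unfolding cop_phi_swap mult.assoc by (rule phi_phi_swap)
  finally show ?thesis .
qed

text \<open>After \<open>U_sum_alpha\<close> has removed every \<open>U\<close>, the two functionals
  are the two sides of the pentagon, evaluated at one and the same form \<open>N\<close>.\<close>

lemma L_sum_R_sum_alpha:
  assumes D: "ml3 D"
  shows "L_sum (\<lambda>a b c. D a b (c * \<alpha>)) = R_sum (\<lambda>a b c. D a b (c * \<alpha>))"
proof -
  define N where "N x y z w = cop (S x * \<alpha>) (\<lambda>p q. cop q (\<lambda>q1 q2. D (p * y) (q1 * z) (q2 * w)))" for x y z w
  have N: "ml4 N" unfolding N_def by (intro ml4I lin ml3D[OF D])
  have "L_sum (\<lambda>a b c. D a b (c * \<alpha>)) = phi (\<lambda>Y1 Y2 Y3. cop Y3 (\<lambda>Y31 Y32. phi (\<lambda>X1 X2 X3. cop X1 (\<lambda>X11 X12.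
      N (Y1 * X11) (Y2 * X12) (Y31 * X2) (Y32 * X3)))))"
  proof -
    have m1: "ml2 (\<lambda>v w. D u (a * v) (b * w))" for u a b by (intro ml2I lin ml3D[OF D])
    have m2: "ml2 (\<lambda>a b. D u (a * X2) (b * X3))" for u X2 X3 by (intro ml2I lin ml3D[OF D])
    define B where "B X2 X3 u w = cop w (\<lambda>a b. D u (a * X2) (b * X3))" for X2 X3 u w
    have B: "ml2 (B X2 X3)" for X2 X3 unfolding B_def by (intro ml2I lin ml3D[OF D])
    have m3: "ml2 (\<lambda>u w. B X2 X3 u (w * \<alpha>))" for X2 X3 by (intro ml2I lin ml2D[OF B])
    have m4: "ml2 (\<lambda>u w. B X2 X3 (p * (u * h2)) (q * w))" for X2 X3 p q h2 by (intro ml2I lin ml2D[OF B])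
    have "L_sum (\<lambda>a b c. D a b (c * \<alpha>)) =
      U_sum (\<lambda>U1 U2. cop U2 (\<lambda>a b. phi (\<lambda>X1 X2 X3. cop (S X1 * \<alpha>) (\<lambda>p q. D U1 (a * (p * X2)) (b * (q * X3))))))"
      unfolding L_sum_def mult.assoc U_sum_alpha[OF m1] ..
    also have "\<dots> = phi (\<lambda>X1 X2 X3. U_sum (\<lambda>U1 U2. B X2 X3 U1 (U2 * S X1 * \<alpha>)))"
      unfolding B_def mult.assoc cop_mult[OF m2, of _ "S _ * \<alpha>"] by (simp only: cop_phi_swap U_phi_swap)
    also have "\<dots> = phi (\<lambda>X1 X2 X3. cop X1 (\<lambda>X11 X12. cop (S X11) (\<lambda>p q. U_sum (\<lambda>U1 U2.
        B X2 X3 (p * (U1 * X12)) (q * (U2 * \<alpha>))))))"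
      unfolding U_sum_intertwine[OF m3, symmetric] by (simp only: cop_U_swap mult.assoc)
    also have "\<dots> = phi (\<lambda>X1 X2 X3. cop X1 (\<lambda>X11 X12. cop (S X11) (\<lambda>p q.
        phi (\<lambda>Y1 Y2 Y3. cop (S Y1 * \<alpha>) (\<lambda>p' q'. B X2 X3 (p * (p' * (Y2 * X12))) (q * (q' * Y3)))))))"
      unfolding U_sum_alpha[OF m4] mult.assoc ..
    also have "\<dots> = phi (\<lambda>Y1 Y2 Y3. phi (\<lambda>X1 X2 X3. cop X1 (\<lambda>X11 X12. cop (S X11) (\<lambda>p q.
        cop (S Y1 * \<alpha>) (\<lambda>p' q'. B X2 X3 (p * (p' * (Y2 * X12))) (q * (q' * Y3)))))))"
      unfolding cop_phi_swap by (rule phi_phi_swap)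
    also have "\<dots> = phi (\<lambda>Y1 Y2 Y3. phi (\<lambda>X1 X2 X3. cop X1 (\<lambda>X11 X12. cop Y3 (\<lambda>Y31 Y32.
        N (Y1 * X11) (Y2 * X12) (Y31 * X2) (Y32 * X3)))))"
    proof -
      have "cop (S h) (\<lambda>p q. cop (S Y1 * \<alpha>) (\<lambda>p' q'. B X2 X3 (p * (p' * y)) (q * (q' * Y3)))) =
        cop Y3 (\<lambda>Y31 Y32. N (Y1 * h) y (Y31 * X2) (Y32 * X3))" for h Y1 Y3 y X2 X3
      proof -
        have m5: "ml2 (\<lambda>p q. B X2 X3 (p * y) (q * Y3))" by (intro ml2I lin ml2D[OF B])
        have "cop (S h) (\<lambda>p q. cop (S Y1 * \<alpha>) (\<lambda>p' q'. B X2 X3 (p * (p' * y)) (q * (q' * Y3)))) =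
          cop (S (Y1 * h) * \<alpha>) (\<lambda>p q. B X2 X3 (p * y) (q * Y3))"
          unfolding S_mult using cop_mult[OF m5, of "S h" "S Y1 * \<alpha>"] by (simp only: mult.assoc)
        also have "\<dots> = cop (S (Y1 * h) * \<alpha>) (\<lambda>p q. cop q (\<lambda>q1 q2. cop Y3 (\<lambda>Y31 Y32.
            D (p * y) (q1 * (Y31 * X2)) (q2 * (Y32 * X3)))))"
          unfolding B_def cop_mult[OF m2] by (simp only: mult.assoc)
        also have "\<dots> = cop Y3 (\<lambda>Y31 Y32. N (Y1 * h) y (Y31 * X2) (Y32 * X3))"
          unfolding N_def by (simp only: cop_cop_swap[of _ Y3])
        finally show ?thesis .
      qed
      then show ?thesis by (simp only:)
    qed
    finally show ?thesis
      unfolding cop_phi_swap by (rule trans) (intro arg_cong[where f = phi] ext cop_cop_swap)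
  qed
  also have "\<dots> = phi (\<lambda>A1 A2 A3. phi (\<lambda>B1 B2 B3. cop B2 (\<lambda>B21 B22. phi (\<lambda>Z1 Z2 Z3.
       N (B1 * Z1) (A1 * (B21 * Z2)) (A2 * (B22 * Z3)) (A3 * B3)))))"
    by (rule pentagon[OF N, symmetric])
  also have "\<dots> = R_sum (\<lambda>a b c. D a b (c * \<alpha>))"
  proof -
    define B where "B A1 A2 A3 X1 X2 X3 u w = cop (S X1) (\<lambda>p q. cop (p * u) (\<lambda>a b.
       D (A1 * (a * X2)) (A2 * (b * X3)) (A3 * (q * w))))" for A1 A2 A3 X1 X2 X3 u w
    have B: "ml2 (B A1 A2 A3 X1 X2 X3)" for A1 A2 A3 X1 X2 X3
      unfolding B_def by (intro ml2I lin ml3D[OF D])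
    define F where "F y z w x1 x2 x3 = D (x1 * y) (x2 * z) (x3 * w)" for y z w x1 x2 x3
    have F: "ml3 (F y z w)" for y z w unfolding F_def by (intro ml3I lin ml3D[OF D])
    have m2: "ml2 (\<lambda>a b. D (A1 * (a * X2)) (A2 * (b * X3)) c)" for A1 A2 c X2 X3
      by (intro ml2I lin ml3D[OF D])
    have m3: "ml2 (\<lambda>p q. cop (p * u) (\<lambda>a b. D (A1 * (a * X2)) (A2 * (b * X3)) (A3 * (q * w))))"
      for u w A1 A2 A3 X2 X3 by (intro ml2I lin ml3D[OF D])
    have "R_sum (\<lambda>a b c. D a b (c * \<alpha>)) = phi (\<lambda>A1 A2 A3. phi (\<lambda>X1 X2 X3.
        U_sum (\<lambda>U1 U2. B A1 A2 A3 X1 X2 X3 U1 (U2 * \<alpha>))))"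
      unfolding R_sum_def B_def by (simp only: mult.assoc)
    also have "\<dots> = phi (\<lambda>A1 A2 A3. phi (\<lambda>X1 X2 X3. phi (\<lambda>Y1 Y2 Y3. cop (S Y1 * \<alpha>) (\<lambda>r s.
        B A1 A2 A3 X1 X2 X3 (r * Y2) (s * Y3)))))"
      unfolding U_sum_alpha[OF B] ..
    also have "\<dots> = phi (\<lambda>A1 A2 A3. phi (\<lambda>X1 X2 X3. phi (\<lambda>Y1 Y2 Y3. cop Y2 (\<lambda>Y21 Y22. cop (S (Y1 * X1) * \<alpha>) (\<lambda>p q. cop p (\<lambda>p1 p2.
        F (Y21 * X2) (Y22 * X3) Y3 (A1 * p1) (A2 * p2) (A3 * q)))))))"
    proof -
      have "cop (S Y1 * \<alpha>) (\<lambda>r s. B A1 A2 A3 X1 X2 X3 (r * Y2) (s * Y3)) =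
        cop Y2 (\<lambda>Y21 Y22. cop (S (Y1 * X1) * \<alpha>) (\<lambda>p q. cop p (\<lambda>p1 p2.
          F (Y21 * X2) (Y22 * X3) Y3 (A1 * p1) (A2 * p2) (A3 * q))))" for A1 A2 A3 X1 X2 X3 Y1 Y2 Y3
      proof -
        have "cop (S Y1 * \<alpha>) (\<lambda>r s. B A1 A2 A3 X1 X2 X3 (r * Y2) (s * Y3)) =
          cop (S X1) (\<lambda>p q. cop (S Y1 * \<alpha>) (\<lambda>r s. cop (p * (r * Y2)) (\<lambda>a b.
            D (A1 * (a * X2)) (A2 * (b * X3)) (A3 * (q * (s * Y3))))))"
          unfolding B_def by (rule cop_cop_swap)
        also have "\<dots> = cop (S (Y1 * X1) * \<alpha>) (\<lambda>p q. cop (p * Y2) (\<lambda>a b.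
            D (A1 * (a * X2)) (A2 * (b * X3)) (A3 * (q * Y3))))"
          unfolding S_mult using cop_mult[OF m3, of "S X1" "S Y1 * \<alpha>"] by (simp only: mult.assoc)
        also have "\<dots> = cop (S (Y1 * X1) * \<alpha>) (\<lambda>p q. cop p (\<lambda>p1 p2. cop Y2 (\<lambda>Y21 Y22.
            F (Y21 * X2) (Y22 * X3) Y3 (A1 * p1) (A2 * p2) (A3 * q))))"
          unfolding cop_mult[OF m2] F_def by (simp only: mult.assoc)
        finally show ?thesis by (simp only: cop_cop_swap[of _ Y2])
      qed
      then show ?thesis by (simp only:)
    qed
    also have "\<dots> = phi (\<lambda>X1 X2 X3. phi (\<lambda>Y1 Y2 Y3. cop Y2 (\<lambda>Y21 Y22. phi (\<lambda>A1 A2 A3. cop (S (Y1 * X1) * \<alpha>) (\<lambda>p q. cop p (\<lambda>p1 p2.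
        F (Y21 * X2) (Y22 * X3) Y3 (A1 * p1) (A2 * p2) (A3 * q)))))))"
    proof -
      have "phi (\<lambda>A1 A2 A3. phi (\<lambda>X1 X2 X3. phi (\<lambda>Y1 Y2 Y3. H A1 A2 A3 X1 X2 X3 Y1 Y2 Y3))) =
        phi (\<lambda>X1 X2 X3. phi (\<lambda>Y1 Y2 Y3. phi (\<lambda>A1 A2 A3. H A1 A2 A3 X1 X2 X3 Y1 Y2 Y3)))"
        for H :: "'h \<Rightarrow> 'h \<Rightarrow> 'h \<Rightarrow> 'h \<Rightarrow> 'h \<Rightarrow> 'h \<Rightarrow> 'h \<Rightarrow> 'h \<Rightarrow> 'h \<Rightarrow> 'k"
        by (rule trans[OF phi_phi_swap]) (intro arg_cong[where f = phi] ext phi_phi_swap)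
      then show ?thesis by (simp only: cop_phi_swap)
    qed
    also have "\<dots> = phi (\<lambda>X1 X2 X3. phi (\<lambda>Y1 Y2 Y3. cop Y2 (\<lambda>Y21 Y22. phi (\<lambda>A1 A2 A3.
        N (Y1 * X1) (A1 * (Y21 * X2)) (A2 * (Y22 * X3)) (A3 * Y3)))))"
      unfolding coassoc[OF F] unfolding N_def F_def mult.assoc ..
    also have "\<dots> = phi (\<lambda>A1 A2 A3. phi (\<lambda>B1 B2 B3. cop B2 (\<lambda>B21 B22. phi (\<lambda>Z1 Z2 Z3.
       N (B1 * Z1) (A1 * (B21 * Z2)) (A2 * (B22 * Z3)) (A3 * B3)))))"
    proof -
      have "phi (\<lambda>X1 X2 X3. phi (\<lambda>Y1 Y2 Y3. phi (\<lambda>A1 A2 A3. H A1 A2 A3 X1 X2 X3 Y1 Y2 Y3))) =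
        phi (\<lambda>A1 A2 A3. phi (\<lambda>Y1 Y2 Y3. phi (\<lambda>X1 X2 X3. H A1 A2 A3 X1 X2 X3 Y1 Y2 Y3)))"
        for H :: "'h \<Rightarrow> 'h \<Rightarrow> 'h \<Rightarrow> 'h \<Rightarrow> 'h \<Rightarrow> 'h \<Rightarrow> 'h \<Rightarrow> 'h \<Rightarrow> 'h \<Rightarrow> 'k"
      proof -
        have "phi (\<lambda>X1 X2 X3. phi (\<lambda>Y1 Y2 Y3. phi (\<lambda>A1 A2 A3. H A1 A2 A3 X1 X2 X3 Y1 Y2 Y3))) =
          phi (\<lambda>X1 X2 X3. phi (\<lambda>A1 A2 A3. phi (\<lambda>Y1 Y2 Y3. H A1 A2 A3 X1 X2 X3 Y1 Y2 Y3)))"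
          by (intro arg_cong[where f = phi] ext phi_phi_swap)
        also have "\<dots> = phi (\<lambda>A1 A2 A3. phi (\<lambda>X1 X2 X3. phi (\<lambda>Y1 Y2 Y3. H A1 A2 A3 X1 X2 X3 Y1 Y2 Y3)))"
          by (rule phi_phi_swap)
        also have "\<dots> = phi (\<lambda>A1 A2 A3. phi (\<lambda>Y1 Y2 Y3. phi (\<lambda>X1 X2 X3. H A1 A2 A3 X1 X2 X3 Y1 Y2 Y3)))"
          by (intro arg_cong[where f = phi] ext phi_phi_swap)
        finally show ?thesis .
      qed
      then show ?thesis by (simp only: cop_phi_swap)
    qed
    finally show ?thesis by (rule sym)
  qed
  finally show ?thesis .
qed

lemma L_sum_eq_R_sum:
  assumes D: "ml3 D"
  shows "L_sum D = R_sum D"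
proof -
  \<comment> \<open>The unit \<open>S(x1) \<alpha> x2 \<beta> S(x3)\<close> is inserted in the third
    leg. The commutation rule removes \<open>S(x1)\<close>, so \<open>L\<close> is determined by its
    values after multiplication by \<open>\<alpha>\<close>.\<close>
  have step: "L D = psi (\<lambda>x1 x2 x3. S3_act L x1 (\<lambda>a b c. D a b (c * (\<alpha> * (x2 * (\<beta> * S x3))))))"
    if lin_L: "linK (\<lambda>w. L (\<lambda>a b c. D a b (c * w)))"
      and L: "\<And>D h. ml3 D \<Longrightarrow> L (\<lambda>a b c. D a b (c * S h)) = S3_act L h D" for L
  proof -
    have m: "ml3 (\<lambda>a b c. D a b (c * (\<alpha> * (x2 * (\<beta> * S x3)))))" for x2 x3 by (intro ml3I lin ml3D[OF D])
    show ?thesis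
      using psi_antipode[OF lin_L] by (simp only: L[OF m, symmetric] mult.assoc mult_1_right)
  qed
  have l1: "linK (\<lambda>w. L_sum (\<lambda>a b c. D a b (c * w)))" and l2: "linK (\<lambda>w. R_sum (\<lambda>a b c. D a b (c * w)))"
    unfolding L_sum_def R_sum_def by (intro lin ml3D[OF D])+
  have "S3_act L_sum x1 (\<lambda>a b c. D a b (c * (\<alpha> * w))) = S3_act R_sum x1 (\<lambda>a b c. D a b (c * (\<alpha> * w)))" for x1 w
  proof -
    have m: "ml3 (\<lambda>a b c. D (p * (a * h12)) (q1 * (b * h2)) (q2 * (c * w)))" for p q1 q2 h12 h2
      by (intro ml3I lin ml3D[OF D])
    show ?thesis using L_sum_R_sum_alpha[OF m] unfolding S3_act_def by (simp only: mult.assoc)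
  qed
  then show ?thesis
    using step[OF l1 L_sum_intertwine] step[OF l2 R_sum_intertwine] by simp
qed

lemma U_sum_absorb:
  assumes D: "ml3 D"
  shows "cop k (\<lambda>k1 k2. U_sum (\<lambda>T1 T2. cop (S (k1 * x)) (\<lambda>p q. D (p * (T1 * (k2 * y))) (q * T2) z))) =
    U_sum (\<lambda>T1 T2. cop (S x) (\<lambda>p q. D (p * (T1 * y)) (q * (T2 * S k)) z))"
proof -
  define B where "B u w = cop (S x) (\<lambda>p q. D (p * (u * y)) (q * w) z)" for u w
  have B: "ml2 B" unfolding B_def by (intro ml2I lin ml3D[OF D])
  have m: "ml2 (\<lambda>p q. D (p * (u * y)) (q * w) z)" for u w by (intro ml2I lin ml3D[OF D])
  have "cop (S (k1 * x)) (\<lambda>p q. D (p * (u * (k2 * y))) (q * w) z) = cop (S k1) (\<lambda>p q. B (p * (u * k2)) (q * w))"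
    for k1 k2 u w
  proof -
    have m: "ml2 (\<lambda>p q. D (p * (u * (k2 * y))) (q * w) z)" by (intro ml2I lin ml3D[OF D])
    show ?thesis unfolding S_mult cop_mult[OF m] B_def mult.assoc by (rule cop_cop_swap)
  qed
  then show ?thesis
    using U_sum_intertwine[OF B, of k] by (simp only: cop_U_swap B_def)
qed

text \<open>Equality of \<open>L_sum\<close> and \<open>R_sum\<close> in the form met in the
  Heisenberg double, where \<open>b\<close> will be a basis element. A third copy of
  \<open>U\<close> is packed into \<open>K\<close>; the \<open>\<Phi>\<^sup>-\<^sup>1\<close> of the
  multiplication cancels the \<open>\<Phi>\<close> in \<open>R_sum\<close>, and
  \<open>U_sum_absorb\<close> handles the coproducts at the third copy.\<close>

lemma U_sum_pentagon:
  assumes D: "ml3 D"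
  shows "cop b (\<lambda>b1 b2. psi (\<lambda>x1 x2 x3. U_sum (\<lambda>V1 V2. cop V2 (\<lambda>v1 v2. U_sum (\<lambda>U1 U2. U_sum (\<lambda>T1 T2.
      cop (S (b1 * (x1 * V1))) (\<lambda>p q. D (p * (T1 * (b2 * (x2 * (v1 * U1))))) (q * T2) (x3 * (v2 * U2))))))))) =
    phi (\<lambda>X1 X2 X3. U_sum (\<lambda>V1 V2. cop (S X1) (\<lambda>r s. U_sum (\<lambda>T1 T2. cop (S X2) (\<lambda>p q.
      D (p * (T1 * X3)) (q * (T2 * S (b * (r * V1)))) (s * V2))))))"
proof -
  define K where "K x y z = U_sum (\<lambda>T1 T2. cop (S x) (\<lambda>p q. D (p * (T1 * y)) (q * (T2 * S b)) z))" for x y z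
  have K: "ml3 K" unfolding K_def by (intro ml3I lin ml3D[OF D])
  have K': "ml3 (\<lambda>a b c. K (x1 * a) (x2 * b) (x3 * c))" for x1 x2 x3 by (intro ml3I lin ml3D[OF K])
  have "cop b (\<lambda>b1 b2. psi (\<lambda>x1 x2 x3. U_sum (\<lambda>V1 V2. cop V2 (\<lambda>v1 v2. U_sum (\<lambda>U1 U2. U_sum (\<lambda>T1 T2.
      cop (S (b1 * (x1 * V1))) (\<lambda>p q. D (p * (T1 * (b2 * (x2 * (v1 * U1))))) (q * T2) (x3 * (v2 * U2))))))))) =
    psi (\<lambda>x1 x2 x3. L_sum (\<lambda>a b c. K (x1 * a) (x2 * b) (x3 * c)))"
    unfolding L_sum_def K_def U_sum_absorb[OF D, symmetric]
    by (simp only: cop_psi_swap cop_U_swap cop_cop_swap[of b])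
  also have "\<dots> = psi (\<lambda>x1 x2 x3. R_sum (\<lambda>a b c. K (x1 * a) (x2 * b) (x3 * c)))"
    unfolding L_sum_eq_R_sum[OF K'] ..
  also have "\<dots> = phi (\<lambda>X1 X2 X3. U_sum (\<lambda>V1 V2. cop (S X1) (\<lambda>r s. cop (r * V1) (\<lambda>a b. K (a * X2) (b * X3) (s * V2)))))"
  proof -
    define F where "F x y z = phi (\<lambda>X1 X2 X3. U_sum (\<lambda>V1 V2. cop (S X1) (\<lambda>r s. cop (r * V1) (\<lambda>a b.
      K (x * (a * X2)) (y * (b * X3)) (z * (s * V2))))))" for x y z
    have F: "ml3 F" unfolding F_def by (intro ml3I lin ml3D[OF K])
    show ?thesis
      using psi_phi[OF F] unfolding R_sum_def F_def by (simp only: mult.assoc mult_1_left)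
  qed
  also have "\<dots> = phi (\<lambda>X1 X2 X3. U_sum (\<lambda>V1 V2. cop (S X1) (\<lambda>r s. U_sum (\<lambda>T1 T2. cop (S X2) (\<lambda>p q.
      D (p * (T1 * X3)) (q * (T2 * S (b * (r * V1)))) (s * V2))))))"
  proof -
    have D': "ml3 (\<lambda>u w z. D u (w * S b) z)" by (intro ml3I lin ml3D[OF D])
    have "cop k (\<lambda>k1 k2. K (k1 * x) (k2 * y) z) =
      U_sum (\<lambda>T1 T2. cop (S x) (\<lambda>p q. D (p * (T1 * y)) (q * (T2 * S (b * k))) z))" for k x y z
      unfolding K_def using U_sum_absorb[OF D', of k x y z] by (simp only: S_mult mult.assoc)
    then show ?thesis by (simp only:)
  qed
  finally show ?thesis .
qed

end

section \<open>The Heisenberg double\<close>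

lemma bilinear_onD:
  assumes "bilinear_on V W s B"
  shows "x \<in> car V \<Longrightarrow> x' \<in> car V \<Longrightarrow> y \<in> car W \<Longrightarrow> B (x + x') y = B x y + B x' y"
    "x \<in> car V \<Longrightarrow> y \<in> car W \<Longrightarrow> B (scl V c x) y = s c (B x y)"
    "x \<in> car V \<Longrightarrow> y \<in> car W \<Longrightarrow> y' \<in> car W \<Longrightarrow> B x (y + y') = B x y + B x y'"
    "x \<in> car V \<Longrightarrow> y \<in> car W \<Longrightarrow> B x (scl W c y) = s c (B x y)"
  using assms unfolding bilinear_on_def by blast+

lemma vector_space_0: "vector_space s \<Longrightarrow> s c 0 = 0"
  and vector_space_add: "vector_space s \<Longrightarrow> s c (x + y) = s c x + s c y"
  by (simp_all add: module_iff_vector_space[symmetric] module.scale_zero_right module.scale_right_distrib)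

text \<open>Associativity is left out on purpose, since the Heisenberg double is in general not
  associative; closure and bilinearity are what componentwise multiplication of tensors relies
  on.\<close>

definition good_alg :: "('k::field, 'v::ab_group_add) kalg \<Rightarrow> bool" where
  "good_alg V \<longleftrightarrow> vector_space (scl V) \<and> 0 \<in> car V \<and> (\<forall>x\<in>car V. \<forall>y\<in>car V. x + y \<in> car V) \<and>
     (\<forall>c. \<forall>x\<in>car V. scl V c x \<in> car V) \<and> (\<forall>x\<in>car V. \<forall>y\<in>car V. mul V x y \<in> car V) \<and>
     bilinear_on V V (scl V) (mul V)"

lemma good_algD:
  assumes "good_alg V"
  shows "vector_space (scl V)" "0 \<in> car V" "x \<in> car V \<Longrightarrow> y \<in> car V \<Longrightarrow> x + y \<in> car V"
    "x \<in> car V \<Longrightarrow> scl V c x \<in> car V" "x \<in> car V \<Longrightarrow> y \<in> car V \<Longrightarrow> mul V x y \<in> car V"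
    "bilinear_on V V (scl V) (mul V)"
  using assms unfolding good_alg_def by blast+

text \<open>Shared origin of two products: the componentwise product of a tensor algebra and the
  Heisenberg product are both double lifts of a map \<open>N\<close> given on pairs of pure
  tensors.\<close>

lemma tlift_tlift_bilinear:
  assumes s: "vector_space s"
    and 1: "\<And>x y. x \<in> car V \<Longrightarrow> y \<in> car W \<Longrightarrow> bilinear_on V W s (N x y)"
    and 2: "\<And>x' y'. x' \<in> car V \<Longrightarrow> y' \<in> car W \<Longrightarrow> bilinear_on V W s (\<lambda>x y. N x y x' y')"
    and V: "\<And>c x. x \<in> car V \<Longrightarrow> scl V c x \<in> car V" "\<And>x y. x \<in> car V \<Longrightarrow> y \<in> car V \<Longrightarrow> x + y \<in> car V"
    and W: "\<And>c x. x \<in> car W \<Longrightarrow> scl W c x \<in> car W" "\<And>x y. x \<in> car W \<Longrightarrow> y \<in> car W \<Longrightarrow> x + y \<in> car W"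
  shows "bilinear_on (tensor_alg V W) (tensor_alg V W) s (\<lambda>t u. tlift V W (\<lambda>x y. tlift V W (N x y) u) t)"
    and "x \<in> car V \<Longrightarrow> y \<in> car W \<Longrightarrow> x' \<in> car V \<Longrightarrow> y' \<in> car W \<Longrightarrow>
      tlift V W (\<lambda>x y. tlift V W (N x y) (tens V W x' y')) (tens V W x y) = N x y x' y'"
proof -
  have hom: "tlift V W (\<lambda>x y. s c (B x y)) t = s c (tlift V W B t)" for c B t
    by (rule tlift_hom[symmetric, of "s c"]) (rule vector_space_0[OF s], rule vector_space_add[OF s])
  have outer: "bilinear_on V W s (\<lambda>x y. tlift V W (N x y) u)" if u: "u \<in> car (tensor_alg V W)" for u
    unfolding bilinear_on_def
  proof (intro conjI ballI allI)
    fix x x' y assume xy: "x \<in> car V" "x' \<in> car V" "y \<in> car W"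
    show "tlift V W (N (x + x') y) u = tlift V W (N x y) u + tlift V W (N x' y) u"
      unfolding tlift_add_fun[symmetric]
      by (rule tlift_cong[OF u]) (rule bilinear_onD(1)[OF 2 xy]; assumption)
  next
    fix c x y assume xy: "x \<in> car V" "y \<in> car W"
    show "tlift V W (N (scl V c x) y) u = s c (tlift V W (N x y) u)"
      unfolding hom[symmetric]
      by (rule tlift_cong[OF u]) (rule bilinear_onD(2)[OF 2 xy]; assumption)
    show "tlift V W (N x (scl W c y)) u = s c (tlift V W (N x y) u)"
      unfolding hom[symmetric]
      by (rule tlift_cong[OF u]) (rule bilinear_onD(4)[OF 2 xy]; assumption)
  next
    fix x y y' assume xy: "x \<in> car V" "y \<in> car W" "y' \<in> car W"
    show "tlift V W (N x (y + y')) u = tlift V W (N x y) u + tlift V W (N x y') u"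
      unfolding tlift_add_fun[symmetric]
      by (rule tlift_cong[OF u]) (rule bilinear_onD(3)[OF 2 xy]; assumption)
  qed
  have sc: "scl (tensor_alg V W) = fscale" by (simp add: tensor_alg_def)
  show "bilinear_on (tensor_alg V W) (tensor_alg V W) s (\<lambda>t u. tlift V W (\<lambda>x y. tlift V W (N x y) u) t)"
    unfolding bilinear_on_def sc
  proof (intro conjI ballI allI)
    fix t t' u assume t: "t \<in> car (tensor_alg V W)" "t' \<in> car (tensor_alg V W)" "u \<in> car (tensor_alg V W)"
    show "tlift V W (\<lambda>x y. tlift V W (N x y) u) (t + t') =
      tlift V W (\<lambda>x y. tlift V W (N x y) u) t + tlift V W (\<lambda>x y. tlift V W (N x y) u) t'"
      by (rule tlift_add[OF s outer[OF t(3)] t(1,2)])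
    show "tlift V W (\<lambda>x y. tlift V W (N x y) (t' + u)) t =
      tlift V W (\<lambda>x y. tlift V W (N x y) t') t + tlift V W (\<lambda>x y. tlift V W (N x y) u) t"
      unfolding tlift_add_fun[symmetric]
      by (rule tlift_cong[OF t(1)]) (rule tlift_add[OF s 1 t(2,3)])
  next
    fix c t u assume t: "t \<in> car (tensor_alg V W)" "u \<in> car (tensor_alg V W)"
    show "tlift V W (\<lambda>x y. tlift V W (N x y) u) (fscale c t) = s c (tlift V W (\<lambda>x y. tlift V W (N x y) u) t)"
      by (rule tlift_scale[OF s outer[OF t(2)] V(1) t(1)])
    show "tlift V W (\<lambda>x y. tlift V W (N x y) (fscale c u)) t = s c (tlift V W (\<lambda>x y. tlift V W (N x y) u) t)"
      by (subst hom[symmetric], rule tlift_cong[OF t(1)]) (rule tlift_scale[OF s 1 V(1) t(2)])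
  qed
  assume xy: "x \<in> car V" "y \<in> car W" "x' \<in> car V" "y' \<in> car W"
  show "tlift V W (\<lambda>x y. tlift V W (N x y) (tens V W x' y')) (tens V W x y) = N x y x' y'"
    unfolding tlift_tens[OF s outer[OF car_tensor_tens[OF xy(3,4)]] xy(1,2)]
    by (rule tlift_tens[OF s 1[OF xy(1,2)] xy(3,4)])
qed

lemma good_alg_tensor:
  assumes V: "good_alg V" and W: "good_alg W"
  shows "good_alg (tensor_alg V W)"
    and "x \<in> car V \<Longrightarrow> y \<in> car W \<Longrightarrow> x' \<in> car V \<Longrightarrow> y' \<in> car W \<Longrightarrow>
      mul (tensor_alg V W) (tens V W x y) (tens V W x' y') = tens V W (mul V x x') (mul W y y')"
proof -
  let ?N = "\<lambda>x y x' y'. tens V W (mul V x x') (mul W y y')"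
  note Vm = bilinear_onD[OF good_algD(6)[OF V]] and Wm = bilinear_onD[OF good_algD(6)[OF W]]
    and T = bilinear_onD[OF bilinear_on_tens[of V W]]
    and c = good_algD(5)[OF V] good_algD(5)[OF W]
  have 1: "bilinear_on V W fscale (?N x y)" if "x \<in> car V" "y \<in> car W" for x y
    unfolding bilinear_on_def using that by (simp add: Vm Wm T c)
  have 2: "bilinear_on V W fscale (\<lambda>x y. ?N x y x' y')" if "x' \<in> car V" "y' \<in> car W" for x' y'
    unfolding bilinear_on_def using that by (simp add: Vm Wm T c)
  note main = tlift_tlift_bilinear[where N = ?N, OF vector_space_fscale 1 2 good_algD(4)[OF V] good_algD(3)[OF V]
      good_algD(4)[OF W] good_algD(3)[OF W]]
  have m: "mul (tensor_alg V W) = (\<lambda>t u. tlift V W (\<lambda>x y. tlift V W (?N x y) u) t)"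
    and sc: "scl (tensor_alg V W) = fscale"
    by (simp_all add: tensor_alg_def)
  show "good_alg (tensor_alg V W)"
    unfolding good_alg_def
  proof (intro conjI ballI allI)
    show "bilinear_on (tensor_alg V W) (tensor_alg V W) (scl (tensor_alg V W)) (mul (tensor_alg V W))"
      unfolding m sc by (rule main(1))
    show "vector_space (scl (tensor_alg V W))" unfolding sc by (rule vector_space_fscale)
    show "scl (tensor_alg V W) c x \<in> car (tensor_alg V W)" if "x \<in> car (tensor_alg V W)" for c x
      unfolding sc by (rule car_tensor_scale[OF that good_algD(4)[OF V]])
    show "mul (tensor_alg V W) t u \<in> car (tensor_alg V W)"
      if "t \<in> car (tensor_alg V W)" "u \<in> car (tensor_alg V W)" for t u
      by (rule car_tensor_mul[OF that c])
    show "0 \<in> car (tensor_alg V W)" by (rule car_tensor_zero)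
    show "t + u \<in> car (tensor_alg V W)" if "t \<in> car (tensor_alg V W)" "u \<in> car (tensor_alg V W)" for t u
      by (rule car_tensor_add[OF that])
  qed
  show "mul (tensor_alg V W) (tens V W x y) (tens V W x' y') = tens V W (mul V x x') (mul W y y')"
    if "x \<in> car V" "y \<in> car W" "x' \<in> car V" "y' \<in> car W"
    unfolding m by (rule main(2); (assumption | rule that))
qed

context quasi_bialg
begin

section \<open>Products of the elements \<open>\<xi> # a\<close>\<close>

lemma hash_bilinear: "bilinear_on (dual_alg Q) (Halg Q) fscale (hash Q)"
  unfolding hash_def[abs_def] by (rule bilinear_on_tens)

lemma dual_car: "\<xi> \<in> car (dual_alg Q) \<longleftrightarrow> linK \<xi>"
  by (simp add: dual_alg_def)

lemma hash_add: "linK \<xi> \<Longrightarrow> linK \<nu> \<Longrightarrow> hash Q (\<xi> + \<nu>) c = hash Q \<xi> c + hash Q \<nu> c"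
  by (rule bilinear_onD(1)[OF hash_bilinear]) (simp_all add: dual_car)

lemma hash_scale: "linK \<xi> \<Longrightarrow> hash Q (fscale r \<xi>) c = fscale r (hash Q \<xi> c)"
  using bilinear_onD(2)[OF hash_bilinear, of \<xi> c r] by (simp add: dual_car dual_alg_def)

lemma linK_hash2 [lin]:
  assumes "linK \<xi>" "linH t"
  shows "linK (\<lambda>x. hash Q \<xi> (t x) G)"
  using bilinear_onD(3,4)[OF hash_bilinear, of \<xi>] assms
  by (simp add: linK_iff[of "\<lambda>x. hash Q \<xi> (t x) G"] linH_iff dual_car fscale_def)

lemma linK_hash1 [lin]:
  assumes 1: "\<And>x. linK (\<Xi> x)" and 2: "\<And>a. linK (\<lambda>x. \<Xi> x a)"
  shows "linK (\<lambda>x. hash Q (\<Xi> x) c G)"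
proof -
  have "\<Xi> (x + y) = \<Xi> x + \<Xi> y" "\<Xi> (hscale Q r x) = fscale r (\<Xi> x)" for x y r
    using 2 by (auto simp: fun_eq_iff linK_iff fscale_def)
  then show ?thesis
    using 1 by (simp add: linK_iff[of "\<lambda>x. hash Q (\<Xi> x) c G"] hash_add hash_scale fscale_def[of _ "hash Q _ _"])
qed

lemma linK_hit [lin]: "linK \<xi> \<Longrightarrow> linH t \<Longrightarrow> linK (\<lambda>x. hit h \<xi> (t x))"
  and linK_hit' [lin]: "linK \<xi> \<Longrightarrow> linH t \<Longrightarrow> linK (\<lambda>x. hit (t x) \<xi> a)"
  unfolding hit_def by (auto intro: linK_comp lin)

lemma conv_cop: "conv Q \<xi> \<nu> a = cop a (\<lambda>a1 a2. \<xi> a1 * \<nu> a2)"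
  by (simp add: conv_def cop_def)

lemma linK_conv: "linK \<xi> \<Longrightarrow> linK \<nu> \<Longrightarrow> linK (conv Q \<xi> \<nu>)"
  unfolding conv_cop[abs_def] by (intro lin linH_id) auto

end

lemma additive_on_zero: "additive_on (car (tensor_alg V W)) (\<lambda>_. 0 :: 'a::ab_group_add)"
  by (simp add: additive_on_def car_tensor_add)

lemma additive_on_bilinear:
  assumes "good_alg V" "good_alg W" "bilinear_on V W s B"
  shows "y \<in> car W \<Longrightarrow> additive_on (car V) (\<lambda>x. B x y)" "x \<in> car V \<Longrightarrow> additive_on (car W) (B x)"
proof -
  note V = good_algD[OF assms(1)] and W = good_algD[OF assms(2)] and B = bilinear_onD[OF assms(3)]
  show "additive_on (car V) (\<lambda>x. B x y)" if y: "y \<in> car W"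
  proof -
    have "B 0 y = B 0 y + B 0 y" using B(1)[OF V(2) V(2) y] by (simp only: add_0_left)
    then have "B 0 y = 0" by (simp only: add_cancel_right_right)
    then show ?thesis unfolding additive_on_def using V(2,3) B(1)[OF _ _ y] by blast
  qed
  show "additive_on (car W) (B x)" if x: "x \<in> car V"
  proof -
    have "B x 0 = B x 0 + B x 0" using B(3)[OF x W(2) W(2)] by (simp only: add_0_left)
    then have "B x 0 = 0" by (simp only: add_cancel_right_right)
    then show ?thesis unfolding additive_on_def using W(2,3) B(3)[OF x] by blast
  qed
qed

context quasi_bialg
begin

lemma lift2_eval: "lift2 Q F t G = lift2 Q (\<lambda>a b. F a b G) t"
  by (rule lift2_hom[of "\<lambda>t. t G"]) auto

lemma lift3_eval: "lift3 Q F t G = lift3 Q (\<lambda>a b c. F a b c G) t"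
  by (rule lift3_hom[of "\<lambda>t. t G"]) auto

lemma sum_fun_eval: "(\<Sum>i\<in>A. f i) x = (\<Sum>i\<in>A. f i x)"
  by (induction A rule: infinite_finite_induct) auto

definition hash_mul :: "('h \<Rightarrow> 'k) \<Rightarrow> 'h \<Rightarrow> ('h \<Rightarrow> 'k) \<Rightarrow> 'h \<Rightarrow> ('k, 'h) h1" where
  "hash_mul \<xi> a \<nu> b = lift3 Q (\<lambda>x1 x2 x3. lift2 Q (\<lambda>a1 a2.
     hash Q (conv Q (hit x1 \<xi>) (hit (x2 * a1) \<nu>)) (x3 * a2 * b)) (Delta Q a)) (Phi_inv Q)"

lemma hash_mul_eval: "hash_mul \<xi> a \<nu> b G = psi (\<lambda>x1 x2 x3. cop a (\<lambda>a1 a2.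
    hash Q (conv Q (hit x1 \<xi>) (hit (x2 * a1) \<nu>)) (x3 * a2 * b) G))"
  by (simp only: hash_mul_def lift3_eval lift2_eval psi_def cop_def)

lemma linK_conv1 [lin]: "(\<And>a. linK (\<lambda>x. \<Xi> x a)) \<Longrightarrow> linK (\<lambda>x. conv Q (\<Xi> x) \<nu> a)"
  and linK_conv2 [lin]: "(\<And>a. linK (\<lambda>x. \<Xi> x a)) \<Longrightarrow> linK (\<lambda>x. conv Q \<nu> (\<Xi> x) a)"
  unfolding conv_cop by (intro lin; assumption)+

lemma linK_hit0 [lin]: "linK \<xi> \<Longrightarrow> linK (hit h \<xi>)"
  unfolding hit_def by (rule linK_comp[OF _ linH_mult(1)[OF linH_id]])

lemmas linK_conv [lin]

lemma hash_car: "linK \<xi> \<Longrightarrow> hash Q \<xi> a \<in> car (heis Q)"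
  unfolding hash_def heis_def by (simp add: car_tensor_tens dual_car)

lemma heis_car: "car (heis Q) = car (tensor_alg (dual_alg Q) (Halg Q))"
  and heis_scl: "scl (heis Q) = fscale" and heis_mul: "mul (heis Q) = heis_mul Q"
  and heis_unt: "unt (heis Q) = hash Q (eps Q) 1"
  by (simp_all add: heis_def)

lemma lift2_heis_car: "(\<And>a b. F a b \<in> car (heis Q)) \<Longrightarrow> lift2 Q F t \<in> car (heis Q)"
  unfolding heis_car by (rule additive_on_lift2_comp(1)[OF additive_on_zero])

lemma lift3_heis_car: "(\<And>a b c. F a b c \<in> car (heis Q)) \<Longrightarrow> lift3 Q F t \<in> car (heis Q)"
  unfolding heis_car by (rule additive_on_lift3_comp(1)[OF additive_on_zero])

lemma hash_mul_car: "linK \<xi> \<Longrightarrow> linK \<nu> \<Longrightarrow> hash_mul \<xi> a \<nu> b \<in> car (heis Q)"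
  unfolding hash_mul_def by (intro lift3_heis_car lift2_heis_car hash_car lin)

lemma hit_add: "hit h (\<xi> + \<nu>) = hit h \<xi> + hit h \<nu>" and hit_scale: "hit h (fscale r \<xi>) = fscale r (hit h \<xi>)"
  by (auto simp: hit_def fscale_def fun_eq_iff)

lemma conv_add: "conv Q (\<xi> + \<xi>') \<nu> = conv Q \<xi> \<nu> + conv Q \<xi>' \<nu>" "conv Q \<xi> (\<nu> + \<nu>') = conv Q \<xi> \<nu> + conv Q \<xi> \<nu>'"
  by (simp_all add: fun_eq_iff conv_cop algebra_simps cop_add_fun)

lemma conv_scale: "conv Q (fscale r \<xi>) \<nu> = fscale r (conv Q \<xi> \<nu>)" "conv Q \<xi> (fscale r \<nu>) = fscale r (conv Q \<xi> \<nu>)"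
  by (simp_all add: fun_eq_iff conv_cop fscale_def cop_cmult mult.left_commute mult.assoc)

lemma hash_mul_bilinear:
  shows "linK \<xi> \<Longrightarrow> bilinear_on (dual_alg Q) (Halg Q) fscale (hash_mul \<xi> a)"
    and "linK \<nu> \<Longrightarrow> bilinear_on (dual_alg Q) (Halg Q) fscale (\<lambda>\<xi> a. hash_mul \<xi> a \<nu> b)"
proof -
  have lb: "linK (\<lambda>b. hash_mul \<xi> a \<nu> b G)" if "linK \<xi>" "linK \<nu>" for \<xi> a \<nu> G
    unfolding hash_mul_eval using that by (intro lin)
  have la: "linK (\<lambda>a. hash_mul \<xi> a \<nu> b G)" if "linK \<xi>" "linK \<nu>" for \<xi> b \<nu> G
    unfolding hash_mul_eval using that by (intro lin)
  have lins: "linK (conv Q (hit x \<xi>) (hit y \<nu>))" if "linK \<xi>" "linK \<nu>" for x y \<xi> \<nu>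
    using that by (intro lin)
  have sc: "scl (dual_alg Q) = fscale" by (simp add: dual_alg_def)
  show "bilinear_on (dual_alg Q) (Halg Q) fscale (hash_mul \<xi> a)" if \<xi>: "linK \<xi>"
    unfolding bilinear_on_def dual_car Halg_simps sc
  proof (intro conjI ballI allI; (unfold dual_car Halg_simps)?; rule ext)
    fix \<nu> \<nu>' b G assume \<nu>': "linK \<nu>" "linK \<nu>'"
    show "hash_mul \<xi> a (\<nu> + \<nu>') b G = (hash_mul \<xi> a \<nu> b + hash_mul \<xi> a \<nu>' b) G"
      by (simp add: hash_mul_eval hit_add conv_add hash_add[OF lins[OF \<xi> \<nu>'(1)] lins[OF \<xi> \<nu>'(2)]] cop_add_fun psi_add_fun)
  next
    fix r \<nu> b G assume \<nu>: "linK \<nu>"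
    show "hash_mul \<xi> a (fscale r \<nu>) b G = fscale r (hash_mul \<xi> a \<nu> b) G"
      unfolding fscale_def[of r "hash_mul _ _ _ _"]
      by (simp add: hash_mul_eval hit_scale conv_scale hash_scale[OF lins[OF \<xi> \<nu>]] fscale_def[of r "hash Q _ _"] cop_cmult psi_cmult)
    show "hash_mul \<xi> a \<nu> (hscale Q r b) G = fscale r (hash_mul \<xi> a \<nu> b) G"
      using lb[OF \<xi> \<nu>] by (simp add: linK_iff fscale_def)
    fix b'
    show "hash_mul \<xi> a \<nu> (b + b') G = (hash_mul \<xi> a \<nu> b + hash_mul \<xi> a \<nu> b') G"
      using lb[OF \<xi> \<nu>] by (simp add: linK_iff)
  qed
  show "bilinear_on (dual_alg Q) (Halg Q) fscale (\<lambda>\<xi> a. hash_mul \<xi> a \<nu> b)" if \<nu>: "linK \<nu>"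
    unfolding bilinear_on_def dual_car Halg_simps sc
  proof (intro conjI ballI allI; (unfold dual_car Halg_simps)?; rule ext)
    fix \<xi> \<xi>' a G assume \<xi>': "linK \<xi>" "linK \<xi>'"
    show "hash_mul (\<xi> + \<xi>') a \<nu> b G = (hash_mul \<xi> a \<nu> b + hash_mul \<xi>' a \<nu> b) G"
      by (simp add: hash_mul_eval hit_add conv_add hash_add[OF lins[OF \<xi>'(1) \<nu>] lins[OF \<xi>'(2) \<nu>]] cop_add_fun psi_add_fun)
  next
    fix r \<xi> a G assume \<xi>: "linK \<xi>"
    show "hash_mul (fscale r \<xi>) a \<nu> b G = fscale r (hash_mul \<xi> a \<nu> b) G"
      unfolding fscale_def[of r "hash_mul _ _ _ _"]
      by (simp add: hash_mul_eval hit_scale conv_scale hash_scale[OF lins[OF \<xi> \<nu>]] fscale_def[of r "hash Q _ _"] cop_cmult psi_cmult)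
    show "hash_mul \<xi> (hscale Q r a) \<nu> b G = fscale r (hash_mul \<xi> a \<nu> b) G"
      using la[OF \<xi> \<nu>] by (simp add: linK_iff fscale_def)
    fix a'
    show "hash_mul \<xi> (a + a') \<nu> b G = (hash_mul \<xi> a \<nu> b + hash_mul \<xi> a' \<nu> b) G"
      using la[OF \<xi> \<nu>] by (simp add: linK_iff)
  qed
qed

lemma heis_good: "good_alg (heis Q)"
  and heis_mul_hash: "linK \<xi> \<Longrightarrow> linK \<nu> \<Longrightarrow> mul (heis Q) (hash Q \<xi> a) (hash Q \<nu> b) = hash_mul \<xi> a \<nu> b"
proof -
  have sc: "scl (dual_alg Q) = fscale" by (simp add: dual_alg_def)
  have cs: "scl (dual_alg Q) c \<xi> \<in> car (dual_alg Q)" if "\<xi> \<in> car (dual_alg Q)" for c \<xi>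
    using that unfolding sc dual_car by (simp add: fscale_def linK_mult)
  have ca: "\<xi> + \<nu> \<in> car (dual_alg Q)" if "\<xi> \<in> car (dual_alg Q)" "\<nu> \<in> car (dual_alg Q)" for \<xi> \<nu>
    using that unfolding dual_car by (simp add: linK_iff algebra_simps)
  have m: "heis_mul Q = (\<lambda>p r. tlift (dual_alg Q) (Halg Q) (\<lambda>\<xi> a. tlift (dual_alg Q) (Halg Q) (hash_mul \<xi> a) r) p)"
    unfolding heis_mul_def[abs_def] hash_mul_def[abs_def] ..
  note main = tlift_tlift_bilinear[where N = hash_mul and V = "dual_alg Q" and W = "Halg Q", OF vector_space_fscale]
  have b: "bilinear_on (tensor_alg (dual_alg Q) (Halg Q)) (tensor_alg (dual_alg Q) (Halg Q)) fscale (heis_mul Q)"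
    unfolding m by (rule main(1); (rule hash_mul_bilinear cs ca)?; (simp add: dual_car)?)
  show "mul (heis Q) (hash Q \<xi> a) (hash Q \<nu> b) = hash_mul \<xi> a \<nu> b" if "linK \<xi>" "linK \<nu>"
    unfolding m heis_mul unfolding hash_def
    by (rule main(2); (rule hash_mul_bilinear cs ca)?; (simp add: dual_car that)?)
  have cl: "heis_mul Q p r \<in> car (heis Q)" if "p \<in> car (heis Q)" "r \<in> car (heis Q)" for p r
    using that unfolding m heis_car
    by (intro car_tensor_tlift) (auto simp: dual_car heis_car[symmetric] intro: hash_mul_car)
  show "good_alg (heis Q)"
    unfolding good_alg_def heis_scl heis_mul
  proof (intro conjI ballI allI)
    show "bilinear_on (heis Q) (heis Q) fscale (heis_mul Q)"
      using b by (simp add: bilinear_on_def heis_car heis_scl tensor_alg_def[of "dual_alg Q"])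
    show "fscale c x \<in> car (heis Q)" if "x \<in> car (heis Q)" for c x
      using that unfolding heis_car by (rule car_tensor_scale) (rule cs)
  qed (auto simp: heis_car vector_space_fscale intro: car_tensor_add cl[unfolded heis_car])
qed

text \<open>\<open>x1 \<rightharpoonup> \<epsilon> = \<epsilon>(x1) \<epsilon>\<close> and
  \<open>\<epsilon>\<close> is the unit of convolution, so the first leg of
  \<open>\<Phi>\<^sup>-\<^sup>1\<close> meets the counit and the associator disappears.\<close>

lemma hash_mul_eps_left:
  assumes \<nu>: "linK \<nu>"
  shows "hash_mul (eps Q) a \<nu> b = lift2 Q (\<lambda>a1 a2. hash Q (hit a1 \<nu>) (a2 * b)) (Delta Q a)"
proof
  fix G
  have e: "conv Q (hit x (eps Q)) (hit y \<nu>) = fscale (eps Q x) (hit y \<nu>)" for x y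
  proof
    fix a
    have l: "linK (hit y \<nu>)" by (intro lin \<nu>)
    have "conv Q (hit x (eps Q)) (hit y \<nu>) a = eps Q x * cop a (\<lambda>a1 a2. eps Q a1 * hit y \<nu> a2)"
      unfolding conv_cop cop_cmult by (simp add: hit_def mult_ac)
    then show "conv Q (hit x (eps Q)) (hit y \<nu>) a = fscale (eps Q x) (hit y \<nu>) a"
      by (simp add: cop_eps_left[OF l] fscale_def)
  qed
  have h: "hash Q (fscale r (hit y \<nu>)) c G = r * hash Q (hit y \<nu>) c G" for r y c
    using hash_scale[of "hit y \<nu>" r c] \<nu> by (simp add: fscale_def linK_hit0)
  have m: "ml2 (\<lambda>x2 x3. cop a (\<lambda>a1 a2. hash Q (hit (x2 * a1) \<nu>) (x3 * a2 * b) G))"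
    by (intro ml2I lin \<nu>)
  have "hash_mul (eps Q) a \<nu> b G = psi (\<lambda>x1 x2 x3. eps Q x1 * cop a (\<lambda>a1 a2. hash Q (hit (x2 * a1) \<nu>) (x3 * a2 * b) G))"
    unfolding hash_mul_eval e h cop_cmult ..
  also have "\<dots> = lift2 Q (\<lambda>a1 a2. hash Q (hit a1 \<nu>) (a2 * b)) (Delta Q a) G"
    unfolding psi_eps1[OF m] by (simp add: lift2_eval cop_def)
  finally show "hash_mul (eps Q) a \<nu> b G = lift2 Q (\<lambda>a1 a2. hash Q (hit a1 \<nu>) (a2 * b)) (Delta Q a) G" .
qed

text \<open>Here the counit falls on \<open>x2\<close> and on the first coproduct factor of
  \<open>a\<close>, which removes both the associator and the coproduct.\<close>

lemma hash_mul_eps_right: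
  assumes \<xi>: "linK \<xi>"
  shows "hash_mul \<xi> a (eps Q) b = hash Q \<xi> (a * b)"
proof
  fix G
  have e: "conv Q (hit x \<xi>) (hit y (eps Q)) = fscale (eps Q y) (hit x \<xi>)" for x y
  proof
    fix a
    have l: "linK (hit x \<xi>)" by (intro lin \<xi>)
    have "conv Q (hit x \<xi>) (hit y (eps Q)) a = eps Q y * cop a (\<lambda>a1 a2. eps Q a2 * hit x \<xi> a1)"
      unfolding conv_cop cop_cmult by (simp add: hit_def mult_ac)
    then show "conv Q (hit x \<xi>) (hit y (eps Q)) a = fscale (eps Q y) (hit x \<xi>) a"
      by (simp add: cop_eps_right[OF l] fscale_def)
  qed
  have h: "hash Q (fscale r (hit y \<xi>)) c G = r * hash Q (hit y \<xi>) c G" for r y c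
    using hash_scale[of "hit y \<xi>" r c] \<xi> by (simp add: fscale_def linK_hit0)
  have m: "ml2 (\<lambda>x1 x3. hash Q (hit x1 \<xi>) (x3 * a * b) G)"
    by (intro ml2I lin \<xi>)
  have l: "linK (\<lambda>x. hash Q (hit x1 \<xi>) (x3 * x * b) G)" for x1 x3 by (intro lin \<xi>)
  have "hash_mul \<xi> a (eps Q) b G = psi (\<lambda>x1 x2 x3. eps Q x2 * cop a (\<lambda>a1 a2. eps Q a1 * hash Q (hit x1 \<xi>) (x3 * a2 * b) G))"
    unfolding hash_mul_eval e h cop_cmult by (simp add: mult_ac)
  also have "\<dots> = hash Q \<xi> (a * b) G"
    unfolding cop_eps_left[OF l] psi_eps2[OF m] by (simp add: hit_def)
  finally show "hash_mul \<xi> a (eps Q) b G = hash Q \<xi> (a * b) G" .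
qed

lemma hash_mul_one: "linK \<nu> \<Longrightarrow> hash_mul (eps Q) 1 \<nu> b = hash Q \<nu> b"
proof
  fix G assume \<nu>: "linK \<nu>"
  have m: "ml2 (\<lambda>a1 a2. hash Q (hit a1 \<nu>) (a2 * b) G)" by (intro ml2I lin \<nu>)
  show "hash_mul (eps Q) 1 \<nu> b G = hash Q \<nu> b G"
    using cop_one[OF m] by (simp add: hash_mul_eps_left[OF \<nu>] lift2_eval cop_def hit_def)
qed

lemma heis_unt_car: "unt (heis Q) \<in> car (heis Q)"
  unfolding heis_unt by (rule hash_car[OF linK_eps])

lemma heis_mul_unt:
  assumes t: "t \<in> car (heis Q)"
  shows "mul (heis Q) t (unt (heis Q)) = t" "mul (heis Q) (unt (heis Q)) t = t"
proof -
  note t' = t[unfolded heis_car]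
  have h: "tlift (dual_alg Q) (Halg Q) (hash Q) t = t"
    unfolding hash_def[abs_def] by (rule tlift_tens_self[OF t'])
  note ad = additive_on_bilinear[OF heis_good heis_good good_algD(6)[OF heis_good]]
  have hc: "hash Q x y \<in> car (heis Q)" if "x \<in> car (dual_alg Q)" for x y
    using that by (simp add: dual_car hash_car)
  have "mul (heis Q) (tlift (dual_alg Q) (Halg Q) (hash Q) t) (unt (heis Q)) =
      tlift (dual_alg Q) (Halg Q) (\<lambda>\<xi> a. mul (heis Q) (hash Q \<xi> a) (unt (heis Q))) t"
    by (rule additive_on_tlift_comp(2)[OF ad(1)[OF heis_unt_car] t']) (rule hc)
  also have "\<dots> = tlift (dual_alg Q) (Halg Q) (hash Q) t"
    by (rule tlift_cong[OF t']) (simp add: heis_unt heis_mul_hash dual_car linK_eps hash_mul_eps_right)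
  finally show "mul (heis Q) t (unt (heis Q)) = t" by (simp add: h)
  have "mul (heis Q) (unt (heis Q)) (tlift (dual_alg Q) (Halg Q) (hash Q) t) =
      tlift (dual_alg Q) (Halg Q) (\<lambda>\<xi> a. mul (heis Q) (unt (heis Q)) (hash Q \<xi> a)) t"
    by (rule additive_on_tlift_comp(2)[OF ad(2)[OF heis_unt_car] t']) (rule hc)
  also have "\<dots> = tlift (dual_alg Q) (Halg Q) (hash Q) t"
    by (rule tlift_cong[OF t']) (simp add: heis_unt heis_mul_hash dual_car linK_eps hash_mul_one)
  finally show "mul (heis Q) (unt (heis Q)) t = t" by (simp add: h)
qed

section \<open>Tensor powers of the Heisenberg double\<close>

lemma heis2_good: "good_alg (heis2 Q)"
  unfolding heis2_def by (rule good_alg_tensor(1)[OF heis_good heis_good])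

lemma heis3_good: "good_alg (heis3 Q)"
  unfolding heis3_def by (rule good_alg_tensor(1)[OF heis_good heis2_good])

lemma htens2_car: "p \<in> car (heis Q) \<Longrightarrow> r \<in> car (heis Q) \<Longrightarrow> htens2 Q p r \<in> car (heis2 Q)"
  unfolding htens2_def heis2_def by (rule car_tensor_tens)

lemma htens3_car: "p \<in> car (heis Q) \<Longrightarrow> r \<in> car (heis Q) \<Longrightarrow> s \<in> car (heis Q) \<Longrightarrow> htens3 Q p r s \<in> car (heis3 Q)"
  unfolding htens3_def heis3_def by (intro car_tensor_tens htens2_car)

lemma heis_mul_car: "p \<in> car (heis Q) \<Longrightarrow> r \<in> car (heis Q) \<Longrightarrow> mul (heis Q) p r \<in> car (heis Q)"
  by (rule good_algD(5)[OF heis_good])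

lemma htens3_mul:
  assumes "p \<in> car (heis Q)" "r \<in> car (heis Q)" "s \<in> car (heis Q)"
    "p' \<in> car (heis Q)" "r' \<in> car (heis Q)" "s' \<in> car (heis Q)"
  shows "mul (heis3 Q) (htens3 Q p r s) (htens3 Q p' r' s') =
    htens3 Q (mul (heis Q) p p') (mul (heis Q) r r') (mul (heis Q) s s')"
proof -
  have "mul (heis2 Q) (htens2 Q r s) (htens2 Q r' s') = htens2 Q (mul (heis Q) r r') (mul (heis Q) s s')"
    unfolding htens2_def heis2_def using assms by (intro good_alg_tensor(2) heis_good)
  then show ?thesis
    unfolding htens3_def heis3_def
    using good_alg_tensor(2)[OF heis_good heis2_good assms(1) htens2_car[OF assms(2,3)] assms(4) htens2_car[OF assms(5,6)]]
    by simp
qed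

lemma htens2_bilinear: "bilinear_on (heis Q) (heis Q) fscale (htens2 Q)"
  unfolding htens2_def[abs_def] by (rule bilinear_on_tens)

lemma htens3_bilinear: "bilinear_on (heis Q) (heis2 Q) fscale (tens (heis Q) (heis2 Q))"
  by (rule bilinear_on_tens)

lemma heis2_scl: "scl (heis2 Q) = fscale"
  by (simp add: heis2_def tensor_alg_def)

lemma htens3_bilinear12: "s \<in> car (heis Q) \<Longrightarrow> bilinear_on (heis Q) (heis Q) fscale (\<lambda>p r. htens3 Q p r s)"
  and htens3_bilinear13: "r \<in> car (heis Q) \<Longrightarrow> bilinear_on (heis Q) (heis Q) fscale (\<lambda>p s. htens3 Q p r s)"
  and htens3_bilinear23: "p \<in> car (heis Q) \<Longrightarrow> bilinear_on (heis Q) (heis Q) fscale (\<lambda>r s. htens3 Q p r s)"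
proof -
  note 2 = bilinear_onD[OF htens2_bilinear, unfolded heis_scl]
    and 3 = bilinear_onD[OF htens3_bilinear, unfolded heis_scl heis2_scl]
  show "s \<in> car (heis Q) \<Longrightarrow> bilinear_on (heis Q) (heis Q) fscale (\<lambda>p r. htens3 Q p r s)"
    "r \<in> car (heis Q) \<Longrightarrow> bilinear_on (heis Q) (heis Q) fscale (\<lambda>p s. htens3 Q p r s)"
    "p \<in> car (heis Q) \<Longrightarrow> bilinear_on (heis Q) (heis Q) fscale (\<lambda>r s. htens3 Q p r s)"
    unfolding bilinear_on_def heis_scl htens3_def by (simp_all add: 2 3 htens2_car)
qed

lemma additive_on_htens3:
  shows "r \<in> car (heis Q) \<Longrightarrow> s \<in> car (heis Q) \<Longrightarrow> additive_on (car (heis Q)) (\<lambda>p. htens3 Q p r s)"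
    "p \<in> car (heis Q) \<Longrightarrow> s \<in> car (heis Q) \<Longrightarrow> additive_on (car (heis Q)) (\<lambda>r. htens3 Q p r s)"
    "p \<in> car (heis Q) \<Longrightarrow> r \<in> car (heis Q) \<Longrightarrow> additive_on (car (heis Q)) (\<lambda>s. htens3 Q p r s)"
  using additive_on_bilinear[OF heis_good heis_good htens3_bilinear12]
    additive_on_bilinear[OF heis_good heis_good htens3_bilinear23] by blast+

lemma slot_additive:
  "additive_on (car (heis2 Q)) (slot12 Q)" "additive_on (car (heis2 Q)) (slot13 Q)" "additive_on (car (heis2 Q)) (slot23 Q)"
  unfolding slot12_def[abs_def] slot13_def[abs_def] slot23_def[abs_def] heis2_def
  by (rule additive_on_tlift[OF vector_space_fscale htens3_bilinear12[OF heis_unt_car]]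
      additive_on_tlift[OF vector_space_fscale htens3_bilinear13[OF heis_unt_car]]
      additive_on_tlift[OF vector_space_fscale htens3_bilinear23[OF heis_unt_car]])+

lemma slot_htens2:
  assumes "p \<in> car (heis Q)" "r \<in> car (heis Q)"
  shows "slot12 Q (htens2 Q p r) = htens3 Q p r (unt (heis Q))"
    "slot13 Q (htens2 Q p r) = htens3 Q p (unt (heis Q)) r"
    "slot23 Q (htens2 Q p r) = htens3 Q (unt (heis Q)) p r"
  unfolding slot12_def slot13_def slot23_def htens2_def
  by (rule tlift_tens[OF vector_space_fscale htens3_bilinear12[OF heis_unt_car] assms]
      tlift_tens[OF vector_space_fscale htens3_bilinear13[OF heis_unt_car] assms]
      tlift_tens[OF vector_space_fscale htens3_bilinear23[OF heis_unt_car] assms])+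

lemma additive_on_mul3:
  "u \<in> car (heis3 Q) \<Longrightarrow> additive_on (car (heis3 Q)) (\<lambda>t. mul (heis3 Q) t u)"
  "u \<in> car (heis3 Q) \<Longrightarrow> additive_on (car (heis3 Q)) (mul (heis3 Q) u)"
  by (rule additive_on_bilinear[OF heis3_good heis3_good good_algD(6)[OF heis3_good]]; assumption)+

text \<open>Fixing two slots and evaluating at \<open>F\<close> leaves a map of \<open>\<xi>\<close>
  and \<open>a\<close> that is a bilinear form \<open>G\<close>; by the model of tensors, evaluating
  it is the same as evaluating \<open>\<xi> # a\<close> at \<open>G\<close>. Linearity facts about
  \<open>hash\<close> thus carry over to each slot.\<close>

lemma htens3_as_hash:
  assumes r: "r \<in> car (heis Q)" and s: "s \<in> car (heis Q)"
  shows "\<exists>G. \<forall>\<xi> a. linK \<xi> \<longrightarrow> htens3 Q (hash Q \<xi> a) r s F = hash Q \<xi> a G"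
    "\<exists>G. \<forall>\<xi> a. linK \<xi> \<longrightarrow> htens3 Q r (hash Q \<xi> a) s F = hash Q \<xi> a G"
    "\<exists>G. \<forall>\<xi> a. linK \<xi> \<longrightarrow> htens3 Q r s (hash Q \<xi> a) F = hash Q \<xi> a G"
proof -
  have main: "\<exists>G. \<forall>\<xi> a. linK \<xi> \<longrightarrow> f (hash Q \<xi> a) F = hash Q \<xi> a G"
    if add: "\<And>p p'. p \<in> car (heis Q) \<Longrightarrow> p' \<in> car (heis Q) \<Longrightarrow> f (p + p') = f p + f p'"
      and sc: "\<And>c p. p \<in> car (heis Q) \<Longrightarrow> f (fscale c p) = fscale c (f p)" for f :: "('k, 'h) h1 \<Rightarrow> ('k, 'h) h1_3"
  proof -
    define G where "G \<xi> a = f (hash Q \<xi> a) F" for \<xi> a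
    have scd: "scl (dual_alg Q) = fscale" by (simp add: dual_alg_def)
    have "bilinear_on (dual_alg Q) (Halg Q) (*) G"
      unfolding bilinear_on_def G_def
      using bilinear_onD[OF hash_bilinear, unfolded scd]
      by (simp add: scd dual_car hash_car add sc fscale_def[of _ "f _"])
    then have "hash Q \<xi> a G = G \<xi> a" for \<xi> a
      unfolding hash_def tens_def by simp
    then show ?thesis unfolding G_def by metis
  qed
  note b = bilinear_onD[OF htens3_bilinear12[OF s], unfolded heis_scl] bilinear_onD[OF htens3_bilinear23[OF r], unfolded heis_scl]
  show "\<exists>G. \<forall>\<xi> a. linK \<xi> \<longrightarrow> htens3 Q (hash Q \<xi> a) r s F = hash Q \<xi> a G"
    by (rule main[of "\<lambda>p. htens3 Q p r s"]) (simp_all add: b r s)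
  show "\<exists>G. \<forall>\<xi> a. linK \<xi> \<longrightarrow> htens3 Q r (hash Q \<xi> a) s F = hash Q \<xi> a G"
    by (rule main[of "\<lambda>p. htens3 Q r p s"]) (simp_all add: b r s)
  show "\<exists>G. \<forall>\<xi> a. linK \<xi> \<longrightarrow> htens3 Q r s (hash Q \<xi> a) F = hash Q \<xi> a G"
    by (rule main[of "\<lambda>p. htens3 Q r s p"]) (simp_all add: b r s)
qed

definition tev :: "('h \<Rightarrow> 'k) \<Rightarrow> 'h \<Rightarrow> ('h \<Rightarrow> 'k) \<Rightarrow> 'h \<Rightarrow> ('h \<Rightarrow> 'k) \<Rightarrow> 'h \<Rightarrow> (('k, 'h) h1 \<Rightarrow> ('k, 'h) h1_2 \<Rightarrow> 'k) \<Rightarrow> 'k" where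
  "tev \<xi> a \<nu> b \<zeta> c F = htens3 Q (hash Q \<xi> a) (hash Q \<nu> b) (hash Q \<zeta> c) F"

lemma linK_tev [lin]:
  assumes "linK \<xi>" "linK \<nu>" "linK \<zeta>" "linH t"
  shows "linK (\<lambda>x. tev \<xi> (t x) \<nu> b \<zeta> c F)" "linK (\<lambda>x. tev \<xi> a \<nu> (t x) \<zeta> c F)"
    "linK (\<lambda>x. tev \<xi> a \<nu> b \<zeta> (t x) F)"
proof -
  obtain G where "\<And>\<xi> a. linK \<xi> \<Longrightarrow> htens3 Q (hash Q \<xi> a) (hash Q \<nu> b) (hash Q \<zeta> c) F = hash Q \<xi> a G"
    using htens3_as_hash(1)[OF hash_car hash_car] assms by metis
  then show "linK (\<lambda>x. tev \<xi> (t x) \<nu> b \<zeta> c F)"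
    unfolding tev_def using linK_hash2[OF assms(1,4)] assms(1) by simp
  obtain G where "\<And>\<nu> b. linK \<nu> \<Longrightarrow> htens3 Q (hash Q \<xi> a) (hash Q \<nu> b) (hash Q \<zeta> c) F = hash Q \<nu> b G"
    using htens3_as_hash(2)[OF hash_car hash_car] assms by metis
  then show "linK (\<lambda>x. tev \<xi> a \<nu> (t x) \<zeta> c F)"
    unfolding tev_def using linK_hash2[OF assms(2,4)] assms(2) by simp
  obtain G where "\<And>\<zeta> c. linK \<zeta> \<Longrightarrow> htens3 Q (hash Q \<xi> a) (hash Q \<nu> b) (hash Q \<zeta> c) F = hash Q \<zeta> c G"
    using htens3_as_hash(3)[OF hash_car hash_car] assms by metis
  then show "linK (\<lambda>x. tev \<xi> a \<nu> b \<zeta> (t x) F)"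
    unfolding tev_def using linK_hash2[OF assms(3,4)] assms(3) by simp
qed

lemma hash_sum:
  assumes "\<And>m. m \<in> A \<Longrightarrow> linK (f m)"
  shows "hash Q (\<lambda>x. \<Sum>m\<in>A. k m * f m x) c G = (\<Sum>m\<in>A. k m * hash Q (f m) c G)"
proof -
  \<comment> \<open>Base case for the empty sum, and also for an infinite index set, over which a
    sum is 0 by convention.\<close>
  have z: "hash Q (\<lambda>x. 0) c G = 0"
  proof -
    have l: "linK (\<lambda>x. 0)" by (simp add: linK_iff)
    have "hash Q (fscale 0 (\<lambda>x. 0)) c G = 0" unfolding hash_scale[OF l] by (simp add: fscale_def)
    then show ?thesis by (simp add: fscale_def)
  qed
  show ?thesis using assms
  proof (induction A rule: infinite_finite_induct)
    case (insert m A)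
    have l1: "linK (fscale (k m) (f m))" using insert.prems[of m] by (simp add: fscale_def linK_mult)
    have l2: "linK (\<lambda>x. \<Sum>m\<in>A. k m * f m x)" using insert.prems by (intro linK_sum linK_mult) auto
    have "(\<lambda>x. \<Sum>m\<in>insert m A. k m * f m x) = fscale (k m) (f m) + (\<lambda>x. \<Sum>m\<in>A. k m * f m x)"
      using insert.hyps by (auto simp: fscale_def fun_eq_iff)
    then have "hash Q (\<lambda>x. \<Sum>m\<in>insert m A. k m * f m x) c G =
        fscale (k m) (hash Q (f m) c) G + hash Q (\<lambda>x. \<Sum>m\<in>A. k m * f m x) c G"
      using insert.prems[of m] by (simp add: hash_add[OF l1 l2] hash_scale)
    then show ?case using insert by (simp add: fscale_def)
  qed (simp_all add: z)
qed

lemma sum_cop: "(\<Sum>i\<in>A. cop h (\<lambda>a b. F i a b)) = cop h (\<lambda>a b. \<Sum>i\<in>A. F i a b)"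
  by (induction A rule: infinite_finite_induct) (simp_all add: cop_add_fun, simp_all add: cop_def)

lemma sum_psi: "(\<Sum>i\<in>A. psi (\<lambda>a b c. F i a b c)) = psi (\<lambda>a b c. \<Sum>i\<in>A. F i a b c)"
  by (induction A rule: infinite_finite_induct) (simp_all add: psi_add_fun, simp_all add: psi_def)

lemma sum_phi: "(\<Sum>i\<in>A. phi (\<lambda>a b c. F i a b c)) = phi (\<lambda>a b c. \<Sum>i\<in>A. F i a b c)"
  by (induction A rule: infinite_finite_induct) (simp_all add: phi_add_fun, simp_all add: phi_def)

lemma basis_expand:
  assumes I: "finite I" "is_basis (hscale Q) I e" "is_dual_basis (hscale Q) I e e'" and f: "linK f"
  shows "f x = (\<Sum>i\<in>I. e' i x * f (e i))"
proof -
  interpret V: vector_space "hscale Q" by (rule vector_space_H)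
  have lin: "linK (e' i)" and dual: "j \<in> I \<Longrightarrow> e' i (e j) = (if i = j then 1 else 0)" if "i \<in> I" for i j
    using I(3) that by (auto simp: is_dual_basis_def)
  have g: "linK (\<lambda>x. \<Sum>i\<in>I. e' i x * f (e i))" by (intro linK_sum linK_mult lin)
  have "x \<in> V.span (e ` I)" using I(2) by (simp add: is_basis_def)
  then show ?thesis
  proof (induction rule: V.span_induct)
    case base
    have f0: "f 0 = 0" if "linK f" for f
      using that[unfolded linK_iff, THEN conjunct2, rule_format, of 0 0] by simp
    show ?case
      unfolding V.subspace_def mem_Collect_eq
    proof (intro conjI ballI allI impI)
      show "f 0 = (\<Sum>i\<in>I. e' i 0 * f (e i))" using f0[OF f] f0[OF g] by simp
      fix x y assume xy: "x \<in> {x. f x = (\<Sum>i\<in>I. e' i x * f (e i))}" "y \<in> {x. f x = (\<Sum>i\<in>I. e' i x * f (e i))}"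
      then show "f (x + y) = (\<Sum>i\<in>I. e' i (x + y) * f (e i))"
        using f g unfolding linK_iff by simp
    next
      fix c x assume "x \<in> {x. f x = (\<Sum>i\<in>I. e' i x * f (e i))}"
      then show "f (hscale Q c x) = (\<Sum>i\<in>I. e' i (hscale Q c x) * f (e i))"
        using f g unfolding linK_iff by simp
    qed
  next
    case (step x)
    then obtain j where "j \<in> I" "x = e j" by blast
    then show ?case using I(1) by (simp add: dual if_distrib[of "\<lambda>c. c * _"] sum.delta' cong: if_cong)
  qed
qed

lemma heis3_mul_sum:
  assumes "\<And>i. i \<in> A \<Longrightarrow> f i \<in> car (heis3 Q)" "\<And>j. j \<in> B \<Longrightarrow> g j \<in> car (heis3 Q)"
  shows "mul (heis3 Q) (sum f A) (sum g B) = (\<Sum>i\<in>A. \<Sum>j\<in>B. mul (heis3 Q) (f i) (g j))"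
proof -
  have g: "sum g B \<in> car (heis3 Q)"
    \<comment> \<open>Multiplication by 0 appears merely as some additive map on the carrier, to
      obtain closure under sums.\<close>
    by (rule additive_on_sum(1)[OF additive_on_mul3(1)[OF good_algD(2)[OF heis3_good]]]) (rule assms(2))
  have "mul (heis3 Q) (sum f A) (sum g B) = (\<Sum>i\<in>A. mul (heis3 Q) (f i) (sum g B))"
    by (rule additive_on_sum(2)[OF additive_on_mul3(1)[OF g] assms(1)])
  also have "\<dots> = (\<Sum>i\<in>A. \<Sum>j\<in>B. mul (heis3 Q) (f i) (g j))"
    by (intro sum.cong refl additive_on_sum(2)[OF additive_on_mul3(2)] assms)
  finally show ?thesis .
qed

lemma heis3_lift_car:
  "(\<And>a b. F a b \<in> car (heis3 Q)) \<Longrightarrow> lift2 Q F t \<in> car (heis3 Q)"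
  "(\<And>a b c. F' a b c \<in> car (heis3 Q)) \<Longrightarrow> lift3 Q F' t' \<in> car (heis3 Q)"
  using additive_on_lift2_comp(1)[OF additive_on_mul3(1)[OF good_algD(2)[OF heis3_good]]]
    additive_on_lift3_comp(1)[OF additive_on_mul3(1)[OF good_algD(2)[OF heis3_good]]] by blast+

lemma heis3_mul_lift:
  "u \<in> car (heis3 Q) \<Longrightarrow> (\<And>a b. F a b \<in> car (heis3 Q)) \<Longrightarrow>
    mul (heis3 Q) (lift2 Q F t) u = lift2 Q (\<lambda>a b. mul (heis3 Q) (F a b) u) t"
  "u \<in> car (heis3 Q) \<Longrightarrow> (\<And>a b. F a b \<in> car (heis3 Q)) \<Longrightarrow>
    mul (heis3 Q) u (lift2 Q F t) = lift2 Q (\<lambda>a b. mul (heis3 Q) u (F a b)) t"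
  "u \<in> car (heis3 Q) \<Longrightarrow> (\<And>a b c. F' a b c \<in> car (heis3 Q)) \<Longrightarrow>
    mul (heis3 Q) (lift3 Q F' t') u = lift3 Q (\<lambda>a b c. mul (heis3 Q) (F' a b c) u) t'"
  "u \<in> car (heis3 Q) \<Longrightarrow> (\<And>a b c. F' a b c \<in> car (heis3 Q)) \<Longrightarrow>
    mul (heis3 Q) u (lift3 Q F' t') = lift3 Q (\<lambda>a b c. mul (heis3 Q) u (F' a b c)) t'"
  by (rule additive_on_lift2_comp(2)[OF additive_on_mul3(1)] additive_on_lift2_comp(2)[OF additive_on_mul3(2)]
      additive_on_lift3_comp(2)[OF additive_on_mul3(1)] additive_on_lift3_comp(2)[OF additive_on_mul3(2)]; blast)+

lemma heis_mul_eps: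
  "linK \<xi> \<Longrightarrow> mul (heis Q) (hash Q \<xi> a) (hash Q (eps Q) b) = hash Q \<xi> (a * b)"
  by (simp add: heis_mul_hash linK_eps hash_mul_eps_right)

lemma heis_eps_mul:
  "linK \<nu> \<Longrightarrow> mul (heis Q) (hash Q (eps Q) a) (hash Q \<nu> b) = lift2 Q (\<lambda>a1 a2. hash Q (hit a1 \<nu>) (a2 * b)) (Delta Q a)"
  by (simp add: heis_mul_hash linK_eps hash_mul_eps_left)

lemma heis_lift2_mul_eps:
  assumes "\<And>x y. linK (\<Xi> x y)"
  shows "mul (heis Q) (lift2 Q (\<lambda>x y. hash Q (\<Xi> x y) (f x y)) t) (hash Q (eps Q) b) =
    lift2 Q (\<lambda>x y. hash Q (\<Xi> x y) (f x y * b)) t"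
proof -
  note ad = additive_on_bilinear(1)[OF heis_good heis_good good_algD(6)[OF heis_good] hash_car[OF linK_eps]]
  show ?thesis
    by (subst additive_on_lift2_comp(2)[OF ad]) (simp_all add: hash_car assms heis_mul_eps)
qed

lemma htens3_lift2:
  assumes "p \<in> car (heis Q)" "s \<in> car (heis Q)" "\<And>a b. f a b \<in> car (heis Q)"
  shows "htens3 Q p (lift2 Q f t) s F = lift2 Q (\<lambda>a b. htens3 Q p (f a b) s F) t"
    "htens3 Q p s (lift2 Q f t) F = lift2 Q (\<lambda>a b. htens3 Q p s (f a b) F) t"
  by (simp_all add: additive_on_lift2_comp(2)[OF additive_on_htens3(2)] additive_on_lift2_comp(2)[OF additive_on_htens3(3)]
      assms lift2_eval)

lemma htens3_hash_mul:
  assumes "p \<in> car (heis Q)" "r \<in> car (heis Q)" "linK \<xi>" "linK \<nu>"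
  shows "htens3 Q p r (hash_mul \<xi> a \<nu> b) F = psi (\<lambda>x1 x2 x3. cop a (\<lambda>a1 a2.
    htens3 Q p r (hash Q (conv Q (hit x1 \<xi>) (hit (x2 * a1) \<nu>)) (x3 * a2 * b)) F))"
proof -
  have c: "hash Q (conv Q (hit x \<xi>) (hit y \<nu>)) z \<in> car (heis Q)" for x y z
    using assms by (intro hash_car lin)
  show ?thesis
    unfolding hash_mul_def psi_def cop_def
    by (simp add: additive_on_lift3_comp(2)[OF additive_on_htens3(3)] additive_on_lift2_comp(2)[OF additive_on_htens3(3)]
        assms c lift2_heis_car lift3_eval lift2_eval)
qed

end

section \<open>The pentagon equations\<close>

locale quasi_hopf_basis = quasi_hopf_surj Q for Q :: "('k::field, 'h::ring_1, 'z) qhopf_scheme" +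
  fixes I :: "'i set" and e :: "'i \<Rightarrow> 'h" and e' :: "'i \<Rightarrow> 'h \<Rightarrow> 'k"
  assumes finite_I: "finite I" and basis: "is_basis (hscale Q) I e" and dual: "is_dual_basis (hscale Q) I e e'"
begin

section \<open>Calculus with the canonical element of a basis and its dual\<close>

lemma linK_dual: "i \<in> I \<Longrightarrow> linK (e' i)"
  using dual by (simp add: is_dual_basis_def)

lemma expand: "linK f \<Longrightarrow> (\<Sum>i\<in>I. e' i x * f (e i)) = f x"
  by (rule basis_expand[OF finite_I basis dual, symmetric])

lemma hash_expand:
  assumes "linK \<xi>"
  shows "hash Q \<xi> c G = (\<Sum>m\<in>I. \<xi> (e m) * hash Q (e' m) c G)"
proof -
  have "\<xi> = (\<lambda>x. \<Sum>m\<in>I. \<xi> (e m) * e' m x)"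
    using expand[OF assms] by (simp add: fun_eq_iff mult.commute)
  then have "hash Q \<xi> c G = hash Q (\<lambda>x. \<Sum>m\<in>I. \<xi> (e m) * e' m x) c G" by simp
  also have "\<dots> = (\<Sum>m\<in>I. \<xi> (e m) * hash Q (e' m) c G)"
    by (rule hash_sum) (rule linK_dual)
  finally show ?thesis .
qed

lemma tev_expand:
  assumes \<xi>: "linK \<xi>" "linK \<nu>" "linK \<zeta>"
  shows "tev \<xi> a \<nu> b \<zeta> c F = (\<Sum>m\<in>I. \<nu> (e m) * tev \<xi> a (e' m) b \<zeta> c F)"
    "tev \<xi> a \<nu> b \<zeta> c F = (\<Sum>m\<in>I. \<zeta> (e m) * tev \<xi> a \<nu> b (e' m) c F)"
proof -
  obtain G where G: "\<And>\<nu> b. linK \<nu> \<Longrightarrow> htens3 Q (hash Q \<xi> a) (hash Q \<nu> b) (hash Q \<zeta> c) F = hash Q \<nu> b G"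
    using htens3_as_hash(2)[OF hash_car hash_car] \<xi> by metis
  show "tev \<xi> a \<nu> b \<zeta> c F = (\<Sum>m\<in>I. \<nu> (e m) * tev \<xi> a (e' m) b \<zeta> c F)"
    unfolding tev_def G[OF \<xi>(2)] hash_expand[OF \<xi>(2)]
    by (intro sum.cong refl) (simp add: G linK_dual)
  obtain G where G: "\<And>\<zeta> c. linK \<zeta> \<Longrightarrow> htens3 Q (hash Q \<xi> a) (hash Q \<nu> b) (hash Q \<zeta> c) F = hash Q \<zeta> c G"
    using htens3_as_hash(3)[OF hash_car hash_car] \<xi> by metis
  show "tev \<xi> a \<nu> b \<zeta> c F = (\<Sum>m\<in>I. \<zeta> (e m) * tev \<xi> a \<nu> b (e' m) c F)"
    unfolding tev_def G[OF \<xi>(3)] hash_expand[OF \<xi>(3)]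
    by (intro sum.cong refl) (simp add: G linK_dual)
qed

text \<open>The canonical element represents the identity, so an action on the dual leg can be moved
  to the other one: the sum of \<open>e i \<otimes> (c \<rightharpoonup> e' i)\<close> equals the
  sum of \<open>e n * c \<otimes> e' n\<close>.\<close>

lemma collapse_hit2:
  assumes "linH t" "linK \<zeta>"
  shows "(\<Sum>i\<in>I. tev (eps Q) (t (e i)) (hit c (e' i)) b \<zeta> d F) = (\<Sum>n\<in>I. tev (eps Q) (t (e n * c)) (e' n) b \<zeta> d F)"
proof -
  have "(\<Sum>i\<in>I. tev (eps Q) (t (e i)) (hit c (e' i)) b \<zeta> d F) =
      (\<Sum>i\<in>I. \<Sum>n\<in>I. e' i (e n * c) * tev (eps Q) (t (e i)) (e' n) b \<zeta> d F)"
  proof (rule sum.cong[OF refl])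
    fix i assume i: "i \<in> I"
    show "tev (eps Q) (t (e i)) (hit c (e' i)) b \<zeta> d F = (\<Sum>n\<in>I. e' i (e n * c) * tev (eps Q) (t (e i)) (e' n) b \<zeta> d F)"
      unfolding tev_expand(1)[OF linK_eps linK_hit0[OF linK_dual[OF i]] assms(2)] unfolding hit_def ..
  qed
  also have "\<dots> = (\<Sum>n\<in>I. \<Sum>i\<in>I. e' i (e n * c) * tev (eps Q) (t (e i)) (e' n) b \<zeta> d F)"
    by (rule sum.swap)
  also have "\<dots> = (\<Sum>n\<in>I. tev (eps Q) (t (e n * c)) (e' n) b \<zeta> d F)"
    by (intro sum.cong refl expand linK_tev linK_eps linK_dual assms)
  finally show ?thesis .
qed

lemma collapse_hit3:
  assumes "linH t" "linK \<nu>"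
  shows "(\<Sum>i\<in>I. tev (eps Q) a \<nu> (t (e i)) (hit c (e' i)) d F) = (\<Sum>n\<in>I. tev (eps Q) a \<nu> (t (e n * c)) (e' n) d F)"
proof -
  have "(\<Sum>i\<in>I. tev (eps Q) a \<nu> (t (e i)) (hit c (e' i)) d F) =
      (\<Sum>i\<in>I. \<Sum>n\<in>I. e' i (e n * c) * tev (eps Q) a \<nu> (t (e i)) (e' n) d F)"
  proof (rule sum.cong[OF refl])
    fix i assume i: "i \<in> I"
    show "tev (eps Q) a \<nu> (t (e i)) (hit c (e' i)) d F = (\<Sum>n\<in>I. e' i (e n * c) * tev (eps Q) a \<nu> (t (e i)) (e' n) d F)"
      unfolding tev_expand(2)[OF linK_eps assms(2) linK_hit0[OF linK_dual[OF i]]] unfolding hit_def ..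
  qed
  also have "\<dots> = (\<Sum>n\<in>I. \<Sum>i\<in>I. e' i (e n * c) * tev (eps Q) a \<nu> (t (e i)) (e' n) d F)"
    by (rule sum.swap)
  also have "\<dots> = (\<Sum>n\<in>I. tev (eps Q) a \<nu> (t (e n * c)) (e' n) d F)"
    by (intro sum.cong refl expand linK_tev linK_eps linK_dual assms)
  finally show ?thesis .
qed

text \<open>Convolution is dual to \<open>\<Delta>\<close>: a double sum over \<open>e i\<close>,
  \<open>e j\<close> and the product of \<open>e' i\<close> and \<open>e' j\<close> becomes a single
  sum over \<open>\<Delta>(e m)\<close> and \<open>e' m\<close>, the actions turning into right
  multiplications by \<open>x\<close> and \<open>y\<close>.\<close>

lemma collapse_conv:
  assumes g: "\<And>m. m \<in> I \<Longrightarrow> ml2 (g m)" and tv: "\<And>i j \<zeta>. i \<in> I \<Longrightarrow> j \<in> I \<Longrightarrow> linK \<zeta> \<Longrightarrow> f i j \<zeta> = (\<Sum>m\<in>I. \<zeta> (e m) * g m (e i) (e j))"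
  shows "(\<Sum>i\<in>I. \<Sum>j\<in>I. f i j (conv Q (hit x (e' i)) (hit y (e' j)))) =
    (\<Sum>m\<in>I. cop (e m) (\<lambda>b1 b2. g m (b1 * x) (b2 * y)))"
proof -
  have "(\<Sum>i\<in>I. \<Sum>j\<in>I. f i j (conv Q (hit x (e' i)) (hit y (e' j)))) =
    (\<Sum>i\<in>I. \<Sum>j\<in>I. \<Sum>m\<in>I. cop (e m) (\<lambda>b1 b2. e' i (b1 * x) * (e' j (b2 * y) * g m (e i) (e j))))"
  proof (intro sum.cong refl)
    fix i j assume ij: "i \<in> I" "j \<in> I"
    have "linK (conv Q (hit x (e' i)) (hit y (e' j)))" by (intro lin linK_dual ij)
    then show "f i j (conv Q (hit x (e' i)) (hit y (e' j))) =
      (\<Sum>m\<in>I. cop (e m) (\<lambda>b1 b2. e' i (b1 * x) * (e' j (b2 * y) * g m (e i) (e j))))"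
      by (simp add: tv[OF ij] conv_cop hit_def mult.commute[of "cop _ _"] cop_cmult mult_ac)
  qed
  also have "\<dots> = (\<Sum>m\<in>I. \<Sum>i\<in>I. \<Sum>j\<in>I. cop (e m) (\<lambda>b1 b2. e' i (b1 * x) * (e' j (b2 * y) * g m (e i) (e j))))"
    by (rule trans[OF sum.cong[OF refl sum.swap] sum.swap])
  also have "\<dots> = (\<Sum>m\<in>I. cop (e m) (\<lambda>b1 b2. \<Sum>i\<in>I. e' i (b1 * x) * (\<Sum>j\<in>I. e' j (b2 * y) * g m (e i) (e j))))"
    by (simp only: sum_cop sum_distrib_left)
  also have "\<dots> = (\<Sum>m\<in>I. cop (e m) (\<lambda>b1 b2. g m (b1 * x) (b2 * y)))"
  proof (rule sum.cong[OF refl])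
    fix m assume m: "m \<in> I"
    have l1: "linK (\<lambda>y. g m x y)" and l2: "linK (\<lambda>x. g m x y)" for x y using g[OF m] by (auto simp: ml2_def)
    show "cop (e m) (\<lambda>b1 b2. \<Sum>i\<in>I. e' i (b1 * x) * (\<Sum>j\<in>I. e' j (b2 * y) * g m (e i) (e j))) =
      cop (e m) (\<lambda>b1 b2. g m (b1 * x) (b2 * y))"
      by (simp only: expand[OF l1] expand[OF l2])
  qed
  finally show ?thesis .
qed

section \<open>The equation for \<open>W\<close>\<close>

abbreviation M3 :: "('k, 'h) h1_3 \<Rightarrow> ('k, 'h) h1_3 \<Rightarrow> ('k, 'h) h1_3" where "M3 \<equiv> mul (heis3 Q)"
abbreviation W :: "('k, 'h) h1_2" where "W \<equiv> W_elem Q I e e'"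
abbreviation Wt :: "('k, 'h) h1_2" where "Wt \<equiv> W_tilde Q I e e'"
abbreviation \<eta> :: "'h \<Rightarrow> ('k, 'h) h1" where "\<eta> \<equiv> hash Q (eps Q)"

lemmas h_car = hash_car[OF linK_eps] hash_car heis_unt_car htens2_car htens3_car heis_mul_car lift2_heis_car

lemma slots_sum:
  assumes "\<And>i. i \<in> I \<Longrightarrow> A i \<in> car (heis2 Q)"
  shows "slot12 Q (\<Sum>i\<in>I. A i) = (\<Sum>i\<in>I. slot12 Q (A i))"
    "slot13 Q (\<Sum>i\<in>I. A i) = (\<Sum>i\<in>I. slot13 Q (A i))"
    "slot23 Q (\<Sum>i\<in>I. A i) = (\<Sum>i\<in>I. slot23 Q (A i))"
  by (rule additive_on_sum(2)[OF slot_additive(1) assms] additive_on_sum(2)[OF slot_additive(2) assms]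
      additive_on_sum(2)[OF slot_additive(3) assms]; assumption)+

lemma slots_W:
  "slot12 Q W = (\<Sum>i\<in>I. htens3 Q (\<eta> (e i)) (hash Q (e' i) 1) (unt (heis Q)))"
  "slot13 Q W = (\<Sum>i\<in>I. htens3 Q (\<eta> (e i)) (unt (heis Q)) (hash Q (e' i) 1))"
  "slot23 Q W = (\<Sum>i\<in>I. htens3 Q (unt (heis Q)) (\<eta> (e i)) (hash Q (e' i) 1))"
proof -
  have c: "htens2 Q (\<eta> (e i)) (hash Q (e' i) 1) \<in> car (heis2 Q)" if "i \<in> I" for i
    using that by (intro h_car linK_dual)
  show "slot12 Q W = (\<Sum>i\<in>I. htens3 Q (\<eta> (e i)) (hash Q (e' i) 1) (unt (heis Q)))"
    "slot13 Q W = (\<Sum>i\<in>I. htens3 Q (\<eta> (e i)) (unt (heis Q)) (hash Q (e' i) 1))"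
    "slot23 Q W = (\<Sum>i\<in>I. htens3 Q (unt (heis Q)) (\<eta> (e i)) (hash Q (e' i) 1))"
    unfolding W_elem_def
    by (rule trans[OF slots_sum(1) sum.cong[OF refl slot_htens2(1)]]
          trans[OF slots_sum(2) sum.cong[OF refl slot_htens2(2)]]
          trans[OF slots_sum(3) sum.cong[OF refl slot_htens2(3)]];
        intro h_car linK_dual; assumption)+
qed

text \<open>Only the third tensor factor multiplies two nontrivial functionals, and it supplies the
  \<open>\<Phi>\<^sup>-\<^sup>1\<close>; \<open>collapse_conv\<close> contracts them. The resulting
  normal form is also that of the other side in \<open>W_right_eval\<close>.\<close>

lemma W_left_eval:
  "M3 (M3 (slot12 Q W) (slot13 Q W)) (slot23 Q W) F =
    (\<Sum>i\<in>I. \<Sum>m\<in>I. psi (\<lambda>x1 x2 x3. cop (e m) (\<lambda>b1 b2.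
      tev (eps Q) (e i * (b1 * x1)) (e' i) (b2 * x2) (e' m) x3 F)))"
proof -
  have 1: "M3 (slot12 Q W) (slot13 Q W) =
    (\<Sum>i\<in>I. \<Sum>j\<in>I. htens3 Q (\<eta> (e i * e j)) (hash Q (e' i) 1) (hash Q (e' j) 1))"
    unfolding slots_W
    by (subst heis3_mul_sum) (auto intro!: sum.cong h_car linK_dual
        simp: htens3_mul h_car linK_dual heis_mul_unt heis_mul_eps linK_eps)
  have c: "(\<Sum>j\<in>I. htens3 Q (\<eta> (e i * e j)) (hash Q (e' i) 1) (hash Q (e' j) 1)) \<in> car (heis3 Q)" if "i \<in> I" for i
    by (rule additive_on_sum(1)[OF additive_on_mul3(1)[OF good_algD(2)[OF heis3_good]]]) (intro h_car linK_dual that; assumption)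
  have 2: "M3 (M3 (slot12 Q W) (slot13 Q W)) (slot23 Q W) =
    (\<Sum>i\<in>I. \<Sum>l\<in>I. \<Sum>j\<in>I. htens3 Q (\<eta> (e i * e j)) (hash Q (e' i) (e l)) (hash_mul (e' j) 1 (e' l) 1))"
    unfolding 1 unfolding slots_W
  proof (subst heis3_mul_sum; (intro sum.cong refl)?)
    fix i l assume i: "i \<in> I" and l: "l \<in> I"
    have u: "htens3 Q (unt (heis Q)) (\<eta> (e l)) (hash Q (e' l) 1) \<in> car (heis3 Q)" by (intro h_car linK_dual l)
    have "M3 (\<Sum>j\<in>I. htens3 Q (\<eta> (e i * e j)) (hash Q (e' i) 1) (hash Q (e' j) 1)) (htens3 Q (unt (heis Q)) (\<eta> (e l)) (hash Q (e' l) 1)) =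
      (\<Sum>j\<in>I. M3 (htens3 Q (\<eta> (e i * e j)) (hash Q (e' i) 1) (hash Q (e' j) 1)) (htens3 Q (unt (heis Q)) (\<eta> (e l)) (hash Q (e' l) 1)))"
      by (rule additive_on_sum(2)[OF additive_on_mul3(1)[OF u]]) (intro h_car linK_dual i; assumption)
    also have "\<dots> = (\<Sum>j\<in>I. htens3 Q (\<eta> (e i * e j)) (hash Q (e' i) (e l)) (hash_mul (e' j) 1 (e' l) 1))"
      by (intro sum.cong refl) (simp add: htens3_mul h_car linK_dual i l heis_mul_unt hash_mul_eps_right linK_eps heis_mul_hash)
    finally show "M3 (\<Sum>j\<in>I. htens3 Q (\<eta> (e i * e j)) (hash Q (e' i) 1) (hash Q (e' j) 1)) (htens3 Q (unt (heis Q)) (\<eta> (e l)) (hash Q (e' l) 1)) =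
      (\<Sum>j\<in>I. htens3 Q (\<eta> (e i * e j)) (hash Q (e' i) (e l)) (hash_mul (e' j) 1 (e' l) 1))" .
  qed (auto intro!: h_car linK_dual c)
  have ev: "htens3 Q (\<eta> a) (hash Q (e' i) b) (hash_mul (e' j) 1 (e' l) 1) F =
    psi (\<lambda>x1 x2 x3. tev (eps Q) a (e' i) b (conv Q (hit x1 (e' j)) (hit x2 (e' l))) x3 F)"
    if ij: "i \<in> I" "j \<in> I" "l \<in> I" for a b i j l
  proof -
    have m: "ml2 (\<lambda>a1 a2. htens3 Q (\<eta> a) (hash Q (e' i) b) (hash Q (conv Q (hit x1 (e' j)) (hit (x2 * a1) (e' l))) (x3 * a2 * 1)) F)"
      for x1 x2 x3
    proof -
      obtain G where "\<And>\<zeta> c. linK \<zeta> \<Longrightarrow> htens3 Q (\<eta> a) (hash Q (e' i) b) (hash Q \<zeta> c) F = hash Q \<zeta> c G"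
        using htens3_as_hash(3)[OF h_car(1) hash_car[OF linK_dual[OF ij(1)]]] by metis
      then have e: "(\<lambda>a1 a2. htens3 Q (\<eta> a) (hash Q (e' i) b) (hash Q (conv Q (hit x1 (e' j)) (hit (x2 * a1) (e' l))) (x3 * a2 * 1)) F) =
        (\<lambda>a1 a2. hash Q (conv Q (hit x1 (e' j)) (hit (x2 * a1) (e' l))) (x3 * a2 * 1) G)"
        using ij by (auto simp: fun_eq_iff linK_conv linK_hit0 linK_dual)
      show ?thesis unfolding e by (intro ml2I lin linK_dual ij)
    qed
    show ?thesis
      unfolding htens3_hash_mul[OF h_car(1) hash_car[OF linK_dual[OF ij(1)]] linK_dual[OF ij(2)] linK_dual[OF ij(3)]]
        cop_one[OF m] tev_def by simp
  qed
  have "(\<Sum>i\<in>I. \<Sum>l\<in>I. \<Sum>j\<in>I. htens3 Q (\<eta> (e i * e j)) (hash Q (e' i) (e l)) (hash_mul (e' j) 1 (e' l) 1)) F =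
    (\<Sum>i\<in>I. psi (\<lambda>x1 x2 x3. \<Sum>j\<in>I. \<Sum>l\<in>I. tev (eps Q) (e i * e j) (e' i) (e l) (conv Q (hit x1 (e' j)) (hit x2 (e' l))) x3 F))"
    unfolding sum_psi[symmetric] sum_fun_eval
    by (intro sum.cong refl trans[OF sum.swap]) (simp add: ev)
  also have "\<dots> = (\<Sum>i\<in>I. psi (\<lambda>x1 x2 x3. \<Sum>m\<in>I. cop (e m) (\<lambda>b1 b2.
      tev (eps Q) (e i * (b1 * x1)) (e' i) (b2 * x2) (e' m) x3 F)))"
  proof (rule sum.cong[OF refl], intro arg_cong[where f = psi] ext)
    fix i x1 x2 x3 assume i: "i \<in> I"
    have g: "ml2 (\<lambda>y z. tev (eps Q) (e i * y) (e' i) z (e' m) x3 F)" if "m \<in> I" for m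
      by (intro ml2I lin linK_dual linK_eps i that)
    show "(\<Sum>j\<in>I. \<Sum>l\<in>I. tev (eps Q) (e i * e j) (e' i) (e l) (conv Q (hit x1 (e' j)) (hit x2 (e' l))) x3 F) =
      (\<Sum>m\<in>I. cop (e m) (\<lambda>b1 b2. tev (eps Q) (e i * (b1 * x1)) (e' i) (b2 * x2) (e' m) x3 F))"
      by (rule collapse_conv[where g = "\<lambda>m y z. tev (eps Q) (e i * y) (e' i) z (e' m) x3 F"])
        (rule g, assumption, rule tev_expand(2)[OF linK_eps linK_dual[OF i]], assumption)
  qed
  finally show ?thesis unfolding 2 by (simp only: sum_psi)
qed

lemma W_right_eval:
  "M3 (M3 (slot23 Q W) (slot12 Q W)) (heis_Phi_inv Q) F =
    (\<Sum>i\<in>I. \<Sum>m\<in>I. psi (\<lambda>x1 x2 x3. cop (e m) (\<lambda>b1 b2.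
      tev (eps Q) (e i * (b1 * x1)) (e' i) (b2 * x2) (e' m) x3 F)))"
proof -
  \<comment> \<open>The middle factor \<open>(\<epsilon> # e l)(e' i # 1)\<close> of the product of
    the slots 23 and 12, by \<open>hash_mul_eps_left\<close>.\<close>
  define s2 where "s2 i l = lift2 Q (\<lambda>a1 a2. hash Q (hit a1 (e' i)) (a2 * 1)) (Delta Q (e l))" for i l
  have s2c: "s2 i l \<in> car (heis Q)" if "i \<in> I" for i l
    unfolding s2_def by (intro h_car linK_hit0 linK_dual that)
  have 1: "M3 (slot23 Q W) (slot12 Q W) =
    (\<Sum>l\<in>I. \<Sum>i\<in>I. htens3 Q (\<eta> (e i)) (s2 i l) (hash Q (e' l) 1))"
    unfolding slots_W
    by (subst heis3_mul_sum) (auto intro!: sum.cong h_car linK_dual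
        simp: htens3_mul h_car linK_dual heis_mul_unt heis_eps_mul s2_def)
  have c0: "htens3 Q (\<eta> y1) (\<eta> y2) (\<eta> y3) \<in> car (heis3 Q)" for y1 y2 y3 by (intro h_car)
  have c: "htens3 Q (\<eta> (e i)) (s2 i l) (hash Q (e' l) 1) \<in> car (heis3 Q)" if "i \<in> I" "l \<in> I" for i l
    by (intro htens3_car h_car(1) s2c hash_car linK_dual that)
  have cs: "(\<Sum>i\<in>I. htens3 Q (\<eta> (e i)) (s2 i l) (hash Q (e' l) 1)) \<in> car (heis3 Q)" if "l \<in> I" for l
    by (rule additive_on_sum(1)[OF additive_on_mul3(1)[OF good_algD(2)[OF heis3_good]]]) (rule c[OF _ that])
  have P: "heis_Phi_inv Q \<in> car (heis3 Q)" unfolding heis_Phi_inv_def by (rule heis3_lift_car(2)[OF c0])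
  have "M3 (M3 (slot23 Q W) (slot12 Q W)) (heis_Phi_inv Q) =
    (\<Sum>l\<in>I. \<Sum>i\<in>I. M3 (htens3 Q (\<eta> (e i)) (s2 i l) (hash Q (e' l) 1)) (heis_Phi_inv Q))"
    unfolding 1 by (subst additive_on_sum(2)[OF additive_on_mul3(1)[OF P] cs])
      (auto intro!: sum.cong additive_on_sum(2)[OF additive_on_mul3(1)[OF P]] c)
  also have "\<dots> = (\<Sum>l\<in>I. \<Sum>i\<in>I. lift3 Q (\<lambda>y1 y2 y3. htens3 Q (\<eta> (e i * y1))
      (lift2 Q (\<lambda>a1 a2. hash Q (hit a1 (e' i)) (a2 * 1 * y2)) (Delta Q (e l))) (hash Q (e' l) y3)) (Phi_inv Q))"
  proof (intro sum.cong refl)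
    fix l i assume l: "l \<in> I" and i: "i \<in> I"
    have "mul (heis Q) (s2 i l) (\<eta> y) = lift2 Q (\<lambda>a1 a2. hash Q (hit a1 (e' i)) (a2 * 1 * y)) (Delta Q (e l))" for y
      unfolding s2_def by (rule heis_lift2_mul_eps) (intro linK_hit0 linK_dual i)
    then show "M3 (htens3 Q (\<eta> (e i)) (s2 i l) (hash Q (e' l) 1)) (heis_Phi_inv Q) =
      lift3 Q (\<lambda>y1 y2 y3. htens3 Q (\<eta> (e i * y1))
        (lift2 Q (\<lambda>a1 a2. hash Q (hit a1 (e' i)) (a2 * 1 * y2)) (Delta Q (e l))) (hash Q (e' l) y3)) (Phi_inv Q)"
      unfolding heis_Phi_inv_def heis3_mul_lift(4)[OF c[OF i l] c0]
      by (simp add: htens3_mul h_car(1) hash_car linK_dual i l s2c heis_mul_eps linK_eps)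
  qed
  finally have 2: "M3 (M3 (slot23 Q W) (slot12 Q W)) (heis_Phi_inv Q) = \<dots>" .
  have "(\<Sum>l\<in>I. \<Sum>i\<in>I. lift3 Q (\<lambda>y1 y2 y3. htens3 Q (\<eta> (e i * y1))
      (lift2 Q (\<lambda>a1 a2. hash Q (hit a1 (e' i)) (a2 * 1 * y2)) (Delta Q (e l))) (hash Q (e' l) y3)) (Phi_inv Q)) F =
    (\<Sum>l\<in>I. \<Sum>i\<in>I. psi (\<lambda>y1 y2 y3. cop (e l) (\<lambda>a1 a2. tev (eps Q) (e i * y1) (hit a1 (e' i)) (a2 * y2) (e' l) y3 F)))"
    unfolding sum_fun_eval
  proof (intro sum.cong refl)
    fix l i assume l: "l \<in> I" and i: "i \<in> I"
    have hc: "hash Q (hit a1 (e' i)) b \<in> car (heis Q)" for a1 b by (intro hash_car linK_hit0 linK_dual i)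
    show "lift3 Q (\<lambda>y1 y2 y3. htens3 Q (\<eta> (e i * y1))
      (lift2 Q (\<lambda>a1 a2. hash Q (hit a1 (e' i)) (a2 * 1 * y2)) (Delta Q (e l))) (hash Q (e' l) y3)) (Phi_inv Q) F =
      psi (\<lambda>y1 y2 y3. cop (e l) (\<lambda>a1 a2. tev (eps Q) (e i * y1) (hit a1 (e' i)) (a2 * y2) (e' l) y3 F))"
      by (simp add: lift3_eval htens3_lift2(1)[OF h_car(1) hash_car[OF linK_dual[OF l]] hc] psi_def cop_def tev_def)
  qed
  also have "\<dots> = (\<Sum>l\<in>I. psi (\<lambda>y1 y2 y3. cop (e l) (\<lambda>a1 a2. \<Sum>i\<in>I. tev (eps Q) (e i * y1) (hit a1 (e' i)) (a2 * y2) (e' l) y3 F)))"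
    by (simp only: sum_psi sum_cop)
  also have "\<dots> = (\<Sum>l\<in>I. psi (\<lambda>y1 y2 y3. cop (e l) (\<lambda>a1 a2. \<Sum>n\<in>I. tev (eps Q) (e n * a1 * y1) (e' n) (a2 * y2) (e' l) y3 F)))"
    by (intro sum.cong refl arg_cong[where f = psi] arg_cong[where f = "cop _"] ext collapse_hit2[where t = "\<lambda>x. x * _"] lin linK_dual)
  also have "\<dots> = (\<Sum>l\<in>I. \<Sum>n\<in>I. psi (\<lambda>y1 y2 y3. cop (e l) (\<lambda>a1 a2. tev (eps Q) (e n * (a1 * y1)) (e' n) (a2 * y2) (e' l) y3 F)))"
    by (simp only: sum_psi sum_cop mult.assoc)
  also have "\<dots> = (\<Sum>n\<in>I. \<Sum>l\<in>I. psi (\<lambda>y1 y2 y3. cop (e l) (\<lambda>a1 a2. tev (eps Q) (e n * (a1 * y1)) (e' n) (a2 * y2) (e' l) y3 F)))"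
    by (rule sum.swap)
  finally show ?thesis unfolding 2 .
qed

section \<open>The equation for the second element, built from \<open>U\<close>\<close>

lemma sum_U: "(\<Sum>i\<in>A. U_sum (\<lambda>a b. F i a b)) = U_sum (\<lambda>a b. \<Sum>i\<in>A. F i a b)"
  by (induction A rule: infinite_finite_induct) (simp_all add: U_sum_def lift2_add_fun)

lemma U_sum_eval: "U_sum F G = U_sum (\<lambda>a b. F a b G)"
  unfolding U_sum_def by (rule lift2_eval)

lemma U_sum_car: "(\<And>a b. F a b \<in> car (heis3 Q)) \<Longrightarrow> U_sum F \<in> car (heis3 Q)"
  unfolding U_sum_def by (rule heis3_lift_car(1))

lemma heis3_mul_U_left:
  "u \<in> car (heis3 Q) \<Longrightarrow> (\<And>a b. F a b \<in> car (heis3 Q)) \<Longrightarrow> M3 (U_sum F) u = U_sum (\<lambda>a b. M3 (F a b) u)"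
  unfolding U_sum_def by (rule heis3_mul_lift(1))

lemma heis3_mul_U:
  assumes "\<And>a b. F a b \<in> car (heis3 Q)" "\<And>a b. G a b \<in> car (heis3 Q)"
  shows "M3 (U_sum F) (U_sum G) = U_sum (\<lambda>a b. U_sum (\<lambda>c d. M3 (F a b) (G c d)))"
  using heis3_mul_lift(1)[OF U_sum_car[OF assms(2)] assms(1)] heis3_mul_lift(2)[OF assms(1) assms(2)]
  by (simp add: U_sum_def)

lemma sum_car3: "(\<And>i. i \<in> A \<Longrightarrow> f i \<in> car (heis3 Q)) \<Longrightarrow> sum f A \<in> car (heis3 Q)"
  by (rule additive_on_sum(1)[OF additive_on_mul3(1)[OF good_algD(2)[OF heis3_good]]])

lemma slots_Wt:
  "slot12 Q Wt = (\<Sum>i\<in>I. U_sum (\<lambda>U1 U2. htens3 Q (\<eta> (S (e i * U1))) (hash Q (e' i) U2) (unt (heis Q))))"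
  "slot13 Q Wt = (\<Sum>i\<in>I. U_sum (\<lambda>U1 U2. htens3 Q (\<eta> (S (e i * U1))) (unt (heis Q)) (hash Q (e' i) U2)))"
  "slot23 Q Wt = (\<Sum>i\<in>I. U_sum (\<lambda>U1 U2. htens3 Q (unt (heis Q)) (\<eta> (S (e i * U1))) (hash Q (e' i) U2)))"
proof -
  have c: "htens2 Q (\<eta> (S (e i * U1))) (hash Q (e' i) U2) \<in> car (heis2 Q)" if "i \<in> I" for i U1 U2
    using that by (intro h_car linK_dual)
  have c2: "U_sum (\<lambda>U1 U2. htens2 Q (\<eta> (S (e i * U1))) (hash Q (e' i) U2)) \<in> car (heis2 Q)" if "i \<in> I" for i
    unfolding U_sum_def by (rule additive_on_lift2_comp(1)[OF slot_additive(1) c[OF that]])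
  have s: "f (U_sum (\<lambda>U1 U2. htens2 Q (\<eta> (S (e i * U1))) (hash Q (e' i) U2))) =
      U_sum (\<lambda>U1 U2. f (htens2 Q (\<eta> (S (e i * U1))) (hash Q (e' i) U2)))"
    if "i \<in> I" "additive_on (car (heis2 Q)) f" for i f
    unfolding U_sum_def by (rule additive_on_lift2_comp(2)[OF that(2) c[OF that(1)]])
  have W: "Wt = (\<Sum>i\<in>I. U_sum (\<lambda>U1 U2. htens2 Q (\<eta> (S (e i * U1))) (hash Q (e' i) U2)))"
    unfolding W_tilde_def U_sum_def ..
  show "slot12 Q Wt = (\<Sum>i\<in>I. U_sum (\<lambda>U1 U2. htens3 Q (\<eta> (S (e i * U1))) (hash Q (e' i) U2) (unt (heis Q))))"
    unfolding W by (rule trans[OF slots_sum(1) sum.cong[OF refl]], erule c2)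
      (simp add: s slot_additive slot_htens2 h_car(1) hash_car linK_dual)
  show "slot13 Q Wt = (\<Sum>i\<in>I. U_sum (\<lambda>U1 U2. htens3 Q (\<eta> (S (e i * U1))) (unt (heis Q)) (hash Q (e' i) U2)))"
    unfolding W by (rule trans[OF slots_sum(2) sum.cong[OF refl]], erule c2)
      (simp add: s slot_additive slot_htens2 h_car(1) hash_car linK_dual)
  show "slot23 Q Wt = (\<Sum>i\<in>I. U_sum (\<lambda>U1 U2. htens3 Q (unt (heis Q)) (\<eta> (S (e i * U1))) (hash Q (e' i) U2)))"
    unfolding W by (rule trans[OF slots_sum(3) sum.cong[OF refl]], erule c2)
      (simp add: s slot_additive slot_htens2 h_car(1) hash_car linK_dual)
qed

lemma Wt_left_eval:
  "M3 (M3 (slot23 Q Wt) (slot13 Q Wt)) (slot12 Q Wt) F =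
    (\<Sum>n\<in>I. \<Sum>m\<in>I. U_sum (\<lambda>V1 V2. U_sum (\<lambda>U1 U2. U_sum (\<lambda>T1 T2. psi (\<lambda>x1 x2 x3. cop V2 (\<lambda>v1 v2.
      cop (e m) (\<lambda>b1 b2. cop (S (b1 * x1 * V1)) (\<lambda>c1 c2.
        tev (eps Q) (S (b2 * (x2 * v1) * U1) * S (e n * c1 * T1)) (e' n) (c2 * T2) (e' m) (x3 * v2 * U2) F))))))))"
proof -
  \<comment> \<open>The middle factor \<open>(\<epsilon> # S(e i V1))(e' k # T2)\<close>. The copies
    of \<open>U\<close> in slots 23, 13 and 12 are named \<open>V\<close>, \<open>U\<close> and
    \<open>T\<close>.\<close>
  define s2 where "s2 i k V1 T2 = lift2 Q (\<lambda>c1 c2. hash Q (hit c1 (e' k)) (c2 * T2)) (Delta Q (S (e i * V1)))" for i k V1 T2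
  have s2c: "s2 i k V1 T2 \<in> car (heis Q)" if "k \<in> I" for i k V1 T2
    unfolding s2_def by (intro h_car linK_hit0 linK_dual that)
  define A where "A i j V1 V2 U1 U2 = htens3 Q (\<eta> (S (e j * U1))) (\<eta> (S (e i * V1))) (hash_mul (e' i) V2 (e' j) U2)" for i j V1 V2 U1 U2
  have Ac: "A i j V1 V2 U1 U2 \<in> car (heis3 Q)" if "i \<in> I" "j \<in> I" for i j V1 V2 U1 U2
    unfolding A_def by (intro htens3_car h_car(1) hash_mul_car linK_dual that)
  have 1: "M3 (slot23 Q Wt) (slot13 Q Wt) =
    (\<Sum>i\<in>I. \<Sum>j\<in>I. U_sum (\<lambda>V1 V2. U_sum (\<lambda>U1 U2. A i j V1 V2 U1 U2)))"
    unfolding slots_Wt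
    by (subst heis3_mul_sum) (auto intro!: sum.cong U_sum_car htens3_car h_car(1) hash_car heis_unt_car linK_dual
        simp: heis3_mul_U htens3_car h_car(1) hash_car heis_unt_car linK_dual A_def[abs_def] htens3_mul heis_mul_unt heis_mul_hash)
  have 2: "M3 (M3 (slot23 Q Wt) (slot13 Q Wt)) (slot12 Q Wt) =
    (\<Sum>i\<in>I. \<Sum>k\<in>I. \<Sum>j\<in>I. U_sum (\<lambda>V1 V2. U_sum (\<lambda>U1 U2. U_sum (\<lambda>T1 T2.
      htens3 Q (\<eta> (S (e j * U1) * S (e k * T1))) (s2 i k V1 T2) (hash_mul (e' i) V2 (e' j) U2)))))"
    unfolding 1 unfolding slots_Wt
  proof (subst heis3_mul_sum; (intro sum.cong refl)?)
    fix i k assume i: "i \<in> I" and k: "k \<in> I"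
    let ?B = "\<lambda>T1 T2. htens3 Q (\<eta> (S (e k * T1))) (hash Q (e' k) T2) (unt (heis Q))"
    have Bc: "?B T1 T2 \<in> car (heis3 Q)" for T1 T2 by (intro htens3_car h_car(1) hash_car heis_unt_car linK_dual k)
    have AB: "M3 (A i j V1 V2 U1 U2) (?B T1 T2) =
      htens3 Q (\<eta> (S (e j * U1) * S (e k * T1))) (s2 i k V1 T2) (hash_mul (e' i) V2 (e' j) U2)" if "j \<in> I" for j V1 V2 U1 U2 T1 T2
      unfolding A_def s2_def
      by (subst htens3_mul) (simp_all add: h_car(1) hash_car hash_mul_car heis_unt_car linK_dual i k that heis_mul_unt
          heis_mul_eps linK_eps heis_eps_mul)
    have "M3 (\<Sum>j\<in>I. U_sum (\<lambda>V1 V2. U_sum (\<lambda>U1 U2. A i j V1 V2 U1 U2))) (U_sum ?B) =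
      (\<Sum>j\<in>I. M3 (U_sum (\<lambda>V1 V2. U_sum (\<lambda>U1 U2. A i j V1 V2 U1 U2))) (U_sum ?B))"
      by (rule additive_on_sum(2)[OF additive_on_mul3(1)[OF U_sum_car[OF Bc]]]) (intro U_sum_car Ac i; assumption)
    also have "\<dots> = (\<Sum>j\<in>I. U_sum (\<lambda>V1 V2. U_sum (\<lambda>U1 U2. U_sum (\<lambda>T1 T2.
      htens3 Q (\<eta> (S (e j * U1) * S (e k * T1))) (s2 i k V1 T2) (hash_mul (e' i) V2 (e' j) U2)))))"
    proof (rule sum.cong[OF refl])
      fix j assume j: "j \<in> I"
      note Ac' = Ac[OF i j]
      have "M3 (U_sum (\<lambda>V1 V2. U_sum (\<lambda>U1 U2. A i j V1 V2 U1 U2))) (U_sum ?B) =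
        U_sum (\<lambda>V1 V2. M3 (U_sum (\<lambda>U1 U2. A i j V1 V2 U1 U2)) (U_sum ?B))"
        by (rule heis3_mul_U_left[OF U_sum_car[OF Bc] U_sum_car[OF Ac']])
      then show "M3 (U_sum (\<lambda>V1 V2. U_sum (\<lambda>U1 U2. A i j V1 V2 U1 U2))) (U_sum ?B) =
        U_sum (\<lambda>V1 V2. U_sum (\<lambda>U1 U2. U_sum (\<lambda>T1 T2.
          htens3 Q (\<eta> (S (e j * U1) * S (e k * T1))) (s2 i k V1 T2) (hash_mul (e' i) V2 (e' j) U2))))"
        unfolding heis3_mul_U[OF Ac' Bc] AB[OF j] .
    qed
    finally show "M3 (\<Sum>j\<in>I. U_sum (\<lambda>V1 V2. U_sum (\<lambda>U1 U2. A i j V1 V2 U1 U2))) (U_sum ?B) =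
      (\<Sum>j\<in>I. U_sum (\<lambda>V1 V2. U_sum (\<lambda>U1 U2. U_sum (\<lambda>T1 T2.
      htens3 Q (\<eta> (S (e j * U1) * S (e k * T1))) (s2 i k V1 T2) (hash_mul (e' i) V2 (e' j) U2)))))" .
  qed (auto intro!: sum_car3 U_sum_car Ac htens3_car h_car(1) hash_car heis_unt_car linK_dual)
  have ev: "htens3 Q (\<eta> a) (s2 i k V1 T2) (hash_mul (e' i) V2 (e' j) U2) F =
    psi (\<lambda>x1 x2 x3. cop V2 (\<lambda>v1 v2. cop (S (e i * V1)) (\<lambda>c1 c2.
      tev (eps Q) a (hit c1 (e' k)) (c2 * T2) (conv Q (hit x1 (e' i)) (hit (x2 * v1) (e' j))) (x3 * v2 * U2) F)))"
    if i: "i \<in> I" and j: "j \<in> I" and k: "k \<in> I" for a i j k V1 V2 U2 T2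
  proof -
    have hc: "hash Q (hit c (e' k)) b \<in> car (heis Q)" and cc: "hash Q (conv Q (hit x (e' i)) (hit y (e' j))) b \<in> car (heis Q)" for c b x y
      by (intro hash_car lin linK_dual i j k)+
    have "htens3 Q (\<eta> a) (s2 i k V1 T2) s F = cop (S (e i * V1)) (\<lambda>c1 c2. htens3 Q (\<eta> a) (hash Q (hit c1 (e' k)) (c2 * T2)) s F)"
      if "s \<in> car (heis Q)" for s
      unfolding s2_def cop_def by (rule htens3_lift2(1)[OF h_car(1) that hc])
    then show ?thesis
      unfolding htens3_hash_mul[OF h_car(1) s2c[OF k] linK_dual[OF i] linK_dual[OF j]] tev_def by (simp add: cc)
  qed
  have 3: "(\<Sum>i\<in>I. \<Sum>j\<in>I. \<Sum>k\<in>I. htens3 Q (\<eta> (S (e j * U1) * S (e k * T1))) (s2 i k V1 T2) (hash_mul (e' i) V2 (e' j) U2) F) =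
    psi (\<lambda>x1 x2 x3. cop V2 (\<lambda>v1 v2. \<Sum>m\<in>I. cop (e m) (\<lambda>b1 b2. cop (S (b1 * x1 * V1)) (\<lambda>c1 c2. \<Sum>n\<in>I.
        tev (eps Q) (S (b2 * (x2 * v1) * U1) * S (e n * c1 * T1)) (e' n) (c2 * T2) (e' m) (x3 * v2 * U2) F))))"
    for V1 V2 U1 U2 T1 T2
  proof -
    have "(\<Sum>i\<in>I. \<Sum>j\<in>I. \<Sum>k\<in>I. htens3 Q (\<eta> (S (e j * U1) * S (e k * T1))) (s2 i k V1 T2) (hash_mul (e' i) V2 (e' j) U2) F) =
      psi (\<lambda>x1 x2 x3. cop V2 (\<lambda>v1 v2. \<Sum>i\<in>I. \<Sum>j\<in>I. cop (S (e i * V1)) (\<lambda>c1 c2. \<Sum>k\<in>I.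
        tev (eps Q) (S (e j * U1) * S (e k * T1)) (hit c1 (e' k)) (c2 * T2) (conv Q (hit x1 (e' i)) (hit (x2 * v1) (e' j))) (x3 * v2 * U2) F)))"
      unfolding sum_cop[symmetric] sum_psi[symmetric] by (intro sum.cong refl ev)
    also have "\<dots> = psi (\<lambda>x1 x2 x3. cop V2 (\<lambda>v1 v2. \<Sum>i\<in>I. \<Sum>j\<in>I. cop (S (e i * V1)) (\<lambda>c1 c2. \<Sum>n\<in>I.
        tev (eps Q) (S (e j * U1) * S (e n * c1 * T1)) (e' n) (c2 * T2) (conv Q (hit x1 (e' i)) (hit (x2 * v1) (e' j))) (x3 * v2 * U2) F)))"
      by (intro sum.cong refl arg_cong[where f = psi] arg_cong[where f = "cop _"] ext
          collapse_hit2[where t = "\<lambda>z. S _ * S (z * _)"] lin linK_dual)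
    also have "\<dots> = psi (\<lambda>x1 x2 x3. cop V2 (\<lambda>v1 v2. \<Sum>m\<in>I. cop (e m) (\<lambda>b1 b2. cop (S (b1 * x1 * V1)) (\<lambda>c1 c2. \<Sum>n\<in>I.
        tev (eps Q) (S (b2 * (x2 * v1) * U1) * S (e n * c1 * T1)) (e' n) (c2 * T2) (e' m) (x3 * v2 * U2) F))))"
    proof (intro arg_cong[where f = psi] arg_cong[where f = "cop V2"] ext)
      fix x1 x2 x3 v1 v2
      \<comment> \<open>The index \<open>i\<close> also occurs inside the coproduct of the middle
        factor, so that coproduct and the sum over \<open>n\<close> have to be part of the function
        passed to \<open>collapse_conv\<close>.\<close>
      let ?f = "\<lambda>i j \<zeta>. cop (S (e i * V1)) (\<lambda>c1 c2. \<Sum>n\<in>I.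
        tev (eps Q) (S (e j * U1) * S (e n * c1 * T1)) (e' n) (c2 * T2) \<zeta> (x3 * v2 * U2) F)"
      let ?g = "\<lambda>m y z. cop (S (y * V1)) (\<lambda>c1 c2. \<Sum>n\<in>I.
        tev (eps Q) (S (z * U1) * S (e n * c1 * T1)) (e' n) (c2 * T2) (e' m) (x3 * v2 * U2) F)"
      have g: "ml2 (?g m)" if "m \<in> I" for m
        by (intro ml2I lin linK_sum linK_eps linK_dual that; assumption)
      have f: "?f i j \<zeta> = (\<Sum>m\<in>I. \<zeta> (e m) * ?g m (e i) (e j))" if "linK \<zeta>" for i j \<zeta>
      proof -
        have "?f i j \<zeta> = cop (S (e i * V1)) (\<lambda>c1 c2. \<Sum>n\<in>I. \<Sum>m\<in>I. \<zeta> (e m) *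
          tev (eps Q) (S (e j * U1) * S (e n * c1 * T1)) (e' n) (c2 * T2) (e' m) (x3 * v2 * U2) F)"
          by (intro arg_cong[where f = "cop _"] ext sum.cong refl tev_expand(2) linK_eps linK_dual that)
        also have "\<dots> = cop (S (e i * V1)) (\<lambda>c1 c2. \<Sum>m\<in>I. \<Sum>n\<in>I. \<zeta> (e m) *
          tev (eps Q) (S (e j * U1) * S (e n * c1 * T1)) (e' n) (c2 * T2) (e' m) (x3 * v2 * U2) F)"
          by (intro arg_cong[where f = "cop _"] ext sum.swap)
        also have "\<dots> = (\<Sum>m\<in>I. \<zeta> (e m) * ?g m (e i) (e j))"
          by (simp only: cop_cmult sum_cop sum_distrib_left)
        finally show ?thesis .
      qed
      show "(\<Sum>i\<in>I. \<Sum>j\<in>I. ?f i j (conv Q (hit x1 (e' i)) (hit (x2 * v1) (e' j)))) =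
        (\<Sum>m\<in>I. cop (e m) (\<lambda>b1 b2. ?g m (b1 * x1) (b2 * (x2 * v1))))"
        by (rule collapse_conv[where g = ?g and f = ?f]) (rule g f; assumption)+
    qed
    finally show ?thesis .
  qed
  have "M3 (M3 (slot23 Q Wt) (slot13 Q Wt)) (slot12 Q Wt) F =
    (\<Sum>i\<in>I. \<Sum>j\<in>I. \<Sum>k\<in>I. U_sum (\<lambda>V1 V2. U_sum (\<lambda>U1 U2. U_sum (\<lambda>T1 T2.
      htens3 Q (\<eta> (S (e j * U1) * S (e k * T1))) (s2 i k V1 T2) (hash_mul (e' i) V2 (e' j) U2) F))))"
    unfolding 2 sum_fun_eval U_sum_eval by (intro sum.cong refl sum.swap)
  also have "\<dots> = U_sum (\<lambda>V1 V2. U_sum (\<lambda>U1 U2. U_sum (\<lambda>T1 T2. \<Sum>i\<in>I. \<Sum>j\<in>I. \<Sum>k\<in>I.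
      htens3 Q (\<eta> (S (e j * U1) * S (e k * T1))) (s2 i k V1 T2) (hash_mul (e' i) V2 (e' j) U2) F)))"
    by (simp only: sum_U)
  also have "\<dots> = (\<Sum>m\<in>I. \<Sum>n\<in>I. U_sum (\<lambda>V1 V2. U_sum (\<lambda>U1 U2. U_sum (\<lambda>T1 T2. psi (\<lambda>x1 x2 x3. cop V2 (\<lambda>v1 v2.
      cop (e m) (\<lambda>b1 b2. cop (S (b1 * x1 * V1)) (\<lambda>c1 c2.
        tev (eps Q) (S (b2 * (x2 * v1) * U1) * S (e n * c1 * T1)) (e' n) (c2 * T2) (e' m) (x3 * v2 * U2) F))))))))"
    unfolding 3 by (simp only: sum_cop sum_psi sum_U)
  finally show ?thesis by (rule trans) (rule sum.swap)
qed

lemma Wt_right_eval: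
  "M3 (M3 (heis_Phi_S321 Q) (slot12 Q Wt)) (slot23 Q Wt) F =
    (\<Sum>n\<in>I. \<Sum>m\<in>I. phi (\<lambda>X1 X2 X3. U_sum (\<lambda>U1 U2. U_sum (\<lambda>V1 V2. cop (S X2) (\<lambda>c1 c2. cop (S X1) (\<lambda>d1 d2.
      tev (eps Q) (S X3 * S (e n * c1 * U1)) (e' n) (c2 * U2 * S (e m * d1 * V1)) (e' m) (d2 * V2) F))))))"
proof -
  \<comment> \<open>The product \<open>(\<epsilon> # S(X2))(e' i # U2)\<close>. It is used for the
    middle factor and, with \<open>X1\<close> and \<open>V2\<close>, also for the third
    factor.\<close>
  define r2 where "r2 i X2 U2 = lift2 Q (\<lambda>c1 c2. hash Q (hit c1 (e' i)) (c2 * U2)) (Delta Q (S X2))" for i X2 U2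
  have r2c: "r2 i X2 U2 \<in> car (heis Q)" if "i \<in> I" for i X2 U2
    unfolding r2_def by (intro h_car linK_hit0 linK_dual that)
  define A where "A i X1 X2 X3 U1 U2 = htens3 Q (\<eta> (S X3 * S (e i * U1))) (r2 i X2 U2) (\<eta> (S X1))" for i X1 X2 X3 U1 U2
  have Ac: "A i X1 X2 X3 U1 U2 \<in> car (heis3 Q)" if "i \<in> I" for i X1 X2 X3 U1 U2
    unfolding A_def by (intro htens3_car h_car(1) r2c that)
  have c0: "htens3 Q (\<eta> y1) (\<eta> y2) (\<eta> y3) \<in> car (heis3 Q)" for y1 y2 y3 by (intro h_car)
  have P: "heis_Phi_S321 Q \<in> car (heis3 Q)" unfolding heis_Phi_S321_def by (rule heis3_lift_car(2)[OF c0])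
  have wc: "htens3 Q (\<eta> (S (e i * U1))) (hash Q (e' i) U2) (unt (heis Q)) \<in> car (heis3 Q)"
    "htens3 Q (unt (heis Q)) (\<eta> (S (e i * U1))) (hash Q (e' i) U2) \<in> car (heis3 Q)" if "i \<in> I" for i U1 U2
    by (intro htens3_car h_car(1) hash_car heis_unt_car linK_dual that)+
  have 1: "M3 (heis_Phi_S321 Q) (slot12 Q Wt) =
    (\<Sum>i\<in>I. phi (\<lambda>X1 X2 X3. U_sum (\<lambda>U1 U2. A i X1 X2 X3 U1 U2)))"
    unfolding slots_Wt
  proof (rule trans[OF additive_on_sum(2)[OF additive_on_mul3(2)[OF P]] sum.cong[OF refl]])
    fix i assume i: "i \<in> I"
    let ?B = "\<lambda>U1 U2. htens3 Q (\<eta> (S (e i * U1))) (hash Q (e' i) U2) (unt (heis Q))"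
    show Bc: "U_sum ?B \<in> car (heis3 Q)" by (intro U_sum_car wc i)
    show "M3 (heis_Phi_S321 Q) (U_sum ?B) = phi (\<lambda>X1 X2 X3. U_sum (\<lambda>U1 U2. A i X1 X2 X3 U1 U2))"
      unfolding heis_Phi_S321_def heis3_mul_lift(3)[OF Bc c0] phi_def
      unfolding U_sum_def heis3_mul_lift(2)[OF c0 wc(1)[OF i]] A_def r2_def
      by (simp add: htens3_mul h_car(1) hash_car heis_unt_car linK_dual i heis_mul_unt heis_mul_eps linK_eps heis_eps_mul)
  qed
  have 2: "M3 (M3 (heis_Phi_S321 Q) (slot12 Q Wt)) (slot23 Q Wt) =
    (\<Sum>i\<in>I. \<Sum>j\<in>I. phi (\<lambda>X1 X2 X3. U_sum (\<lambda>U1 U2. U_sum (\<lambda>V1 V2.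
      htens3 Q (\<eta> (S X3 * S (e i * U1))) (r2 i X2 (U2 * S (e j * V1))) (r2 j X1 V2)))))"
    unfolding 1 unfolding slots_Wt
  proof (subst heis3_mul_sum; (intro sum.cong refl)?)
    fix i j assume i: "i \<in> I" and j: "j \<in> I"
    let ?B = "\<lambda>V1 V2. htens3 Q (unt (heis Q)) (\<eta> (S (e j * V1))) (hash Q (e' j) V2)"
    have Bc: "U_sum ?B \<in> car (heis3 Q)" by (intro U_sum_car wc j)
    have r2m: "mul (heis Q) (r2 i X2 U2) (\<eta> y) = r2 i X2 (U2 * y)" for X2 U2 y
      unfolding r2_def mult.assoc[symmetric] by (rule heis_lift2_mul_eps) (intro linK_hit0 linK_dual i)
    have AB: "M3 (A i X1 X2 X3 U1 U2) (?B V1 V2) =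
      htens3 Q (\<eta> (S X3 * S (e i * U1))) (r2 i X2 (U2 * S (e j * V1))) (r2 j X1 V2)" for X1 X2 X3 U1 U2 V1 V2
      unfolding A_def
      by (subst htens3_mul) (simp_all add: h_car(1) hash_car heis_unt_car linK_dual i j r2c r2m heis_mul_unt heis_eps_mul,
          simp add: r2_def)
    have "M3 (phi (\<lambda>X1 X2 X3. U_sum (\<lambda>U1 U2. A i X1 X2 X3 U1 U2))) (U_sum ?B) =
      phi (\<lambda>X1 X2 X3. M3 (U_sum (\<lambda>U1 U2. A i X1 X2 X3 U1 U2)) (U_sum ?B))"
      unfolding phi_def by (rule heis3_mul_lift(3)[OF Bc]) (intro U_sum_car Ac i)
    then show "M3 (phi (\<lambda>X1 X2 X3. U_sum (\<lambda>U1 U2. A i X1 X2 X3 U1 U2))) (U_sum ?B) =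
      phi (\<lambda>X1 X2 X3. U_sum (\<lambda>U1 U2. U_sum (\<lambda>V1 V2.
        htens3 Q (\<eta> (S X3 * S (e i * U1))) (r2 i X2 (U2 * S (e j * V1))) (r2 j X1 V2))))"
      unfolding heis3_mul_U[OF Ac[OF i] wc(2)[OF j]] AB .
  next
    fix i assume i: "i \<in> I"
    show "phi (\<lambda>X1 X2 X3. U_sum (\<lambda>U1 U2. A i X1 X2 X3 U1 U2)) \<in> car (heis3 Q)"
      unfolding phi_def by (intro heis3_lift_car(2) U_sum_car Ac i)
    show "U_sum (\<lambda>U1 U2. htens3 Q (unt (heis Q)) (\<eta> (S (e i * U1))) (hash Q (e' i) U2)) \<in> car (heis3 Q)"
      by (intro U_sum_car wc i)
  qed
  have ev: "htens3 Q (\<eta> a) (r2 i X2 y) (r2 j X1 z) F = cop (S X2) (\<lambda>c1 c2. cop (S X1) (\<lambda>d1 d2.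
      tev (eps Q) a (hit c1 (e' i)) (c2 * y) (hit d1 (e' j)) (d2 * z) F))" if i: "i \<in> I" and j: "j \<in> I" for a i j X1 X2 y z
  proof -
    have hc: "hash Q (hit c (e' i)) b \<in> car (heis Q)" "hash Q (hit c (e' j)) b \<in> car (heis Q)" for c b
      by (intro hash_car lin linK_dual i j)+
    have "htens3 Q (\<eta> a) (r2 i X2 y) (r2 j X1 z) F =
      cop (S X2) (\<lambda>c1 c2. htens3 Q (\<eta> a) (hash Q (hit c1 (e' i)) (c2 * y)) (r2 j X1 z) F)"
      unfolding r2_def[of i] cop_def by (rule htens3_lift2(1)[OF h_car(1) r2c[OF j] hc(1)])
    also have "\<dots> = cop (S X2) (\<lambda>c1 c2. cop (S X1) (\<lambda>d1 d2.
      tev (eps Q) a (hit c1 (e' i)) (c2 * y) (hit d1 (e' j)) (d2 * z) F))"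
      unfolding r2_def cop_def tev_def htens3_lift2(2)[OF h_car(1) hc(1) hc(2)] ..
    finally show ?thesis .
  qed
  have 3: "(\<Sum>i\<in>I. \<Sum>j\<in>I. htens3 Q (\<eta> (S X3 * S (e i * U1))) (r2 i X2 (U2 * S (e j * V1))) (r2 j X1 V2) F) =
    cop (S X2) (\<lambda>c1 c2. cop (S X1) (\<lambda>d1 d2. \<Sum>n\<in>I. \<Sum>m\<in>I.
      tev (eps Q) (S X3 * S (e n * c1 * U1)) (e' n) (c2 * U2 * S (e m * d1 * V1)) (e' m) (d2 * V2) F))"
    for X1 X2 X3 U1 U2 V1 V2
  proof -
    have "(\<Sum>i\<in>I. \<Sum>j\<in>I. htens3 Q (\<eta> (S X3 * S (e i * U1))) (r2 i X2 (U2 * S (e j * V1))) (r2 j X1 V2) F) =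
      (\<Sum>j\<in>I. \<Sum>i\<in>I. htens3 Q (\<eta> (S X3 * S (e i * U1))) (r2 i X2 (U2 * S (e j * V1))) (r2 j X1 V2) F)"
      by (rule sum.swap)
    also have "\<dots> = cop (S X2) (\<lambda>c1 c2. cop (S X1) (\<lambda>d1 d2. \<Sum>j\<in>I. \<Sum>i\<in>I.
      tev (eps Q) (S X3 * S (e i * U1)) (hit c1 (e' i)) (c2 * (U2 * S (e j * V1))) (hit d1 (e' j)) (d2 * V2) F))"
      unfolding sum_cop[symmetric] by (intro sum.cong refl ev)
    also have "\<dots> = cop (S X2) (\<lambda>c1 c2. cop (S X1) (\<lambda>d1 d2. \<Sum>j\<in>I. \<Sum>n\<in>I.
      tev (eps Q) (S X3 * S (e n * c1 * U1)) (e' n) (c2 * (U2 * S (e j * V1))) (hit d1 (e' j)) (d2 * V2) F))"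
      by (intro sum.cong refl arg_cong[where f = "cop _"] ext
          collapse_hit2[where t = "\<lambda>z. S _ * S (z * _)"] lin linK_dual)
    also have "\<dots> = cop (S X2) (\<lambda>c1 c2. cop (S X1) (\<lambda>d1 d2. \<Sum>n\<in>I. \<Sum>j\<in>I.
      tev (eps Q) (S X3 * S (e n * c1 * U1)) (e' n) (c2 * (U2 * S (e j * V1))) (hit d1 (e' j)) (d2 * V2) F))"
      by (intro arg_cong[where f = "cop _"] ext sum.swap)
    also have "\<dots> = cop (S X2) (\<lambda>c1 c2. cop (S X1) (\<lambda>d1 d2. \<Sum>n\<in>I. \<Sum>m\<in>I.
      tev (eps Q) (S X3 * S (e n * c1 * U1)) (e' n) (c2 * (U2 * S (e m * d1 * V1))) (e' m) (d2 * V2) F))"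
      by (intro sum.cong refl arg_cong[where f = "cop _"] ext
          collapse_hit3[where t = "\<lambda>z. _ * (_ * S (z * _))"] lin linK_dual; assumption)
    finally show ?thesis by (simp only: mult.assoc)
  qed
  have "M3 (M3 (heis_Phi_S321 Q) (slot12 Q Wt)) (slot23 Q Wt) F =
    phi (\<lambda>X1 X2 X3. U_sum (\<lambda>U1 U2. U_sum (\<lambda>V1 V2. \<Sum>i\<in>I. \<Sum>j\<in>I.
      htens3 Q (\<eta> (S X3 * S (e i * U1))) (r2 i X2 (U2 * S (e j * V1))) (r2 j X1 V2) F)))"
    unfolding 2 sum_fun_eval phi_def lift3_eval U_sum_eval
    unfolding phi_def[symmetric] by (simp only: sum_phi sum_U)
  then show ?thesis unfolding 3 by (simp only: sum_cop sum_phi sum_U)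
qed

text \<open>For fixed basis indices the coefficients on the two sides are the two sides of
  \<open>U_sum_pentagon\<close> with \<open>b = e m\<close>; the antipode and the basis element
  \<open>e n\<close> in the first factor are absorbed into the form \<open>D\<close>.\<close>

lemma Wt_pentagon_eval:
  assumes n: "n \<in> I" and m: "m \<in> I"
  shows "U_sum (\<lambda>V1 V2. U_sum (\<lambda>U1 U2. U_sum (\<lambda>T1 T2. psi (\<lambda>x1 x2 x3. cop V2 (\<lambda>v1 v2.
      cop (e m) (\<lambda>b1 b2. cop (S (b1 * x1 * V1)) (\<lambda>c1 c2.
        tev (eps Q) (S (b2 * (x2 * v1) * U1) * S (e n * c1 * T1)) (e' n) (c2 * T2) (e' m) (x3 * v2 * U2) F))))))) =
    phi (\<lambda>X1 X2 X3. U_sum (\<lambda>U1 U2. U_sum (\<lambda>V1 V2. cop (S X2) (\<lambda>c1 c2. cop (S X1) (\<lambda>d1 d2.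
      tev (eps Q) (S X3 * S (e n * c1 * U1)) (e' n) (c2 * U2 * S (e m * d1 * V1)) (e' m) (d2 * V2) F)))))"
proof -
  define D where "D p q r = tev (eps Q) (S (e n * p)) (e' n) q (e' m) r F" for p q r
  have D: "ml3 D" unfolding D_def by (intro ml3I lin linK_eps linK_dual n m)
  have "phi (\<lambda>X1 X2 X3. U_sum (\<lambda>V1 V2. cop (S X1) (\<lambda>r s. U_sum (\<lambda>T1 T2. cop (S X2) (\<lambda>p q.
      D (p * (T1 * X3)) (q * (T2 * S (e m * (r * V1)))) (s * V2)))))) =
    phi (\<lambda>X1 X2 X3. U_sum (\<lambda>U1 U2. U_sum (\<lambda>V1 V2. cop (S X2) (\<lambda>c1 c2. cop (S X1) (\<lambda>d1 d2.
      tev (eps Q) (S X3 * S (e n * c1 * U1)) (e' n) (c2 * U2 * S (e m * d1 * V1)) (e' m) (d2 * V2) F)))))"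
    unfolding cop_U_swap D_def S_mult mult.assoc
    by (intro arg_cong[where f = phi] ext, rule trans[OF U_U_swap])
      (intro arg_cong[where f = U_sum] ext cop_cop_swap)
  then show ?thesis
    using U_sum_pentagon[OF D, of "e m"] unfolding D_def
    by (simp only: cop_psi_swap cop_U_swap U_psi_swap cop_cop_swap[of "e m"] S_mult mult.assoc)
qed

end

theorem theorem4p4:
  fixes Q :: "('k::field, 'h::ring_1) qhopf"
    and I :: "'i set" and e :: "'i \<Rightarrow> 'h" and e' :: "'i \<Rightarrow> 'h \<Rightarrow> 'k"
  assumes "quasi_hopf_algebra Q"
    and "\<exists>B. finite_dimensional_vector_space (hscale Q) B"
    and "is_basis (hscale Q) I e"
    and "is_dual_basis (hscale Q) I e e'"
  shows "let M = mul (heis3 Q); W = W_elem Q I e e'; Wt = W_tilde Q I e e' in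
      M (M (slot12 Q W) (slot13 Q W)) (slot23 Q W) =
        M (M (slot23 Q W) (slot12 Q W)) (heis_Phi_inv Q) \<and>
      M (M (slot23 Q Wt) (slot13 Q Wt)) (slot12 Q Wt) =
        M (M (heis_Phi_S321 Q) (slot12 Q Wt)) (slot23 Q Wt)"
proof -
  obtain B where B: "finite_dimensional_vector_space (hscale Q) B" using assms(2) by blast
  interpret quasi_hopf Q by unfold_locales (rule assms(1))
  interpret V: finite_dimensional_vector_space "hscale Q" B by (rule B)
  have "finite (e ` I)" using assms(3) V.finiteI_independent unfolding is_basis_def by blast
  then have "finite I" using assms(3) finite_imageD unfolding is_basis_def by blast
  then interpret quasi_hopf_basis Q I e e'
    using assms(3,4) surj_antipode[OF B] by unfold_locales
  show ?thesis
    \<comment> \<open>Elements of the threefold power are functions of a form \<open>F\<close>, so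
      extensionality reduces both equations to the evaluations at an arbitrary
      \<open>F\<close>.\<close>
    unfolding Let_def
    by (intro conjI ext) (simp_all only: W_left_eval W_right_eval Wt_left_eval Wt_right_eval Wt_pentagon_eval cong: sum.cong)
qed

end
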